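(* Let $F$ be a field of characteristic zero, let $n\ge 2$, and let $V$ be an irreducible representation of $SL_n(F)$. Let $SL_n(F[t])$ act on $V$ via the homomorphism $SL_n(F[t])\to SL_n(F)$, $t\mapsto 0$. Then $$H^1(SL_n(F[t]),V)\cong\begin{cases} H^1(SL_n(F),V) & \text{if } V\not\cong \mathrm{Ad},\\ H^1(SL_n(F),V)\oplus F^{\infty} & \text{if } V\cong\mathrm{Ad},\ n=2,\\ H^1(SL_n(F),V)\oplus F & \text{if } V\cong\mathrm{Ad},\ n\ge 3.\end{cases}$$
   Context: Cohomology is group cohomology of the abstract (discrete) groups. "Irreducible representation" means an irreducible finite-dimensional rational (algebraic) representation over $F$. $\mathrm{Ad}$ denotes the adjoint representation $\mathfrak{sl}_n(F)$. The symbol $F^{\infty}$ denotes the infinite-dimensional $F$-vector space $\mathrm{Hom}_F(tF[t],F)$ (equivalently, a product of countably infinitely many copies of $F$). The symbol $\cong$ is isomorphism of $F$-vector spaces. *)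

theory Defs
  imports "Jordan_Normal_Form.VS_Connect" "HOL-Algebra.QuotRing"
begin

section \<open>Vector spaces\<close>

text \<open>
  A field \<open>F\<close> is a type \<open>'a\<close> of class \<open>field\<close>, and an \<open>F\<close>-vector space is a module record \<open>V\<close>
  with \<open>vectorspace class_ring V\<close>. The fields \<open>mult\<close> and \<open>one\<close> of a module record play no role;
  below they are filled arbitrarily.
\<close>

definition vs_isomorphic ::
    "('k, 'd) ring_scheme \<Rightarrow> ('k, 'v, 'e) module_scheme \<Rightarrow> ('k, 'w, 'f) module_scheme \<Rightarrow> bool" where
  "vs_isomorphic K V W \<longleftrightarrow> (\<exists>f. linear_map K V W f \<and> bij_betw f (carrier V) (carrier W))"

definition self_vs :: "('a::field, 'a) module" where
  "self_vs = \<lparr>carrier = UNIV, mult = (*), one = 1, zero = 0, add = (+), smult = (*)\<rparr>"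

text \<open>All functions \<open>S \<rightarrow> V\<close>; they take the value \<open>undefined\<close> outside \<open>S\<close>.\<close>

definition fun_vs :: "'s set \<Rightarrow> ('k, 'v, 'e) module_scheme \<Rightarrow> ('k, 's \<Rightarrow> 'v) module" where
  "fun_vs S V = \<lparr>carrier = S \<rightarrow>\<^sub>E carrier V,
     mult = (\<lambda>f g. restrict (\<lambda>_. \<zero>\<^bsub>V\<^esub>) S),
     one = restrict (\<lambda>_. \<zero>\<^bsub>V\<^esub>) S,
     zero = restrict (\<lambda>_. \<zero>\<^bsub>V\<^esub>) S,
     add = (\<lambda>f g. restrict (\<lambda>s. f s \<oplus>\<^bsub>V\<^esub> g s) S),
     smult = (\<lambda>c f. restrict (\<lambda>s. c \<odot>\<^bsub>V\<^esub> f s) S)\<rparr>"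

definition hom_vs ::
    "('k, 'd) ring_scheme \<Rightarrow> ('k, 'v, 'e) module_scheme \<Rightarrow> ('k, 'w, 'f) module_scheme
      \<Rightarrow> ('k, 'v \<Rightarrow> 'w) module" where
  "hom_vs K V W = (fun_vs (carrier V) W)
     \<lparr>carrier := LinearCombinations.module_hom K V W \<inter> extensional (carrier V)\<rparr>"

text \<open>
  The quotient of \<open>V\<close> by a subspace \<open>N\<close>. As for \<^const>\<open>rcoset_mult\<close>, scalar multiplication is
  the union of the cosets \<open>N + c x\<close> over all representatives \<open>x\<close>.
\<close>

definition quot_vs :: "('k, 'v, 'e) module_scheme \<Rightarrow> 'v set \<Rightarrow> ('k, 'v set) module" where
  "quot_vs V N = \<lparr>carrier = a_rcosets\<^bsub>V\<^esub> N,
     mult = (\<lambda>X Y. N), one = N, zero = N,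
     add = set_add V,
     smult = (\<lambda>c X. \<Union>x\<in>X. N +>\<^bsub>V\<^esub> (c \<odot>\<^bsub>V\<^esub> x))\<rparr>"


section \<open>Linear representations\<close>

locale linear_rep = G?: group G + V?: vectorspace K V
  for G :: "('g, 'b) monoid_scheme" and K :: "('k, 'd) ring_scheme"
    and V :: "('k, 'v, 'e) module_scheme" +
  fixes \<rho> :: "'g \<Rightarrow> 'v \<Rightarrow> 'v"
  assumes rep_hom: "g \<in> carrier G \<Longrightarrow> \<rho> g \<in> LinearCombinations.module_hom K V V"
    and rep_mult: "\<lbrakk>g \<in> carrier G; h \<in> carrier G; v \<in> carrier V\<rbrakk>
          \<Longrightarrow> \<rho> (g \<otimes>\<^bsub>G\<^esub> h) v = \<rho> g (\<rho> h v)"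
    and rep_one: "v \<in> carrier V \<Longrightarrow> \<rho> \<one>\<^bsub>G\<^esub> v = v"

definition rep_irreducible ::
    "('g, 'b) monoid_scheme \<Rightarrow> ('k, 'd) ring_scheme \<Rightarrow> ('k, 'v, 'e) module_scheme
      \<Rightarrow> ('g \<Rightarrow> 'v \<Rightarrow> 'v) \<Rightarrow> bool" where
  "rep_irreducible G K V \<rho> \<longleftrightarrow>
     linear_rep G K V \<rho> \<and> carrier V \<noteq> {\<zero>\<^bsub>V\<^esub>} \<and>
     (\<forall>W. VectorSpace.subspace K W V \<and> (\<forall>g\<in>carrier G. \<forall>w\<in>W. \<rho> g w \<in> W)
          \<longrightarrow> W = {\<zero>\<^bsub>V\<^esub>} \<or> W = carrier V)"

definition rep_isomorphic ::
    "('g, 'b) monoid_scheme \<Rightarrow> ('k, 'd) ring_scheme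
      \<Rightarrow> ('k, 'v, 'e) module_scheme \<Rightarrow> ('g \<Rightarrow> 'v \<Rightarrow> 'v)
      \<Rightarrow> ('k, 'w, 'f) module_scheme \<Rightarrow> ('g \<Rightarrow> 'w \<Rightarrow> 'w) \<Rightarrow> bool" where
  "rep_isomorphic G K V \<rho> W \<sigma> \<longleftrightarrow>
     (\<exists>f. linear_map K V W f \<and> bij_betw f (carrier V) (carrier W) \<and>
          (\<forall>g\<in>carrier G. \<forall>v\<in>carrier V. f (\<rho> g v) = \<sigma> g (f v)))"


section \<open>Cohomology of discrete groups\<close>

text \<open>
  Group cohomology is computed by the inhomogeneous cochain complex. A \<open>k\<close>-cochain is a function
  on \<open>k\<close>-tuples of group elements, and a tuple \<open>(g\<^sub>1, \<dots>, g\<^sub>k)\<close> is a list of length \<open>k\<close>.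
\<close>

definition tuples :: "('g, 'b) monoid_scheme \<Rightarrow> nat \<Rightarrow> 'g list set" where
  "tuples G k = {gs. length gs = k \<and> set gs \<subseteq> carrier G}"

abbreviation cochains ::
    "('g, 'b) monoid_scheme \<Rightarrow> ('k, 'v, 'e) module_scheme \<Rightarrow> nat \<Rightarrow> ('k, 'g list \<Rightarrow> 'v) module" where
  "cochains G V k \<equiv> fun_vs (tuples G k) V"

text \<open>\<open>(g\<^sub>1, \<dots>, g\<^sub>i g\<^sub>i\<^sub>+\<^sub>1, \<dots>, g\<^sub>k\<^sub>+\<^sub>1)\<close> for \<open>1 \<le> i \<le> k\<close>; list indices start at \<open>0\<close>.\<close>

definition merge_at :: "('g, 'b) monoid_scheme \<Rightarrow> nat \<Rightarrow> 'g list \<Rightarrow> 'g list" where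
  "merge_at G i gs = take (i - 1) gs @ [gs ! (i - 1) \<otimes>\<^bsub>G\<^esub> gs ! i] @ drop (i + 1) gs"

definition signed_term :: "('k, 'v, 'e) module_scheme \<Rightarrow> nat \<Rightarrow> 'v \<Rightarrow> 'v" where
  "signed_term V i v = (if even i then v else \<ominus>\<^bsub>V\<^esub> v)"

definition coboundary ::
    "('g, 'b) monoid_scheme \<Rightarrow> ('k, 'v, 'e) module_scheme \<Rightarrow> ('g \<Rightarrow> 'v \<Rightarrow> 'v)
      \<Rightarrow> nat \<Rightarrow> ('g list \<Rightarrow> 'v) \<Rightarrow> 'g list \<Rightarrow> 'v" where
  "coboundary G V \<rho> k f = restrict
     (\<lambda>gs. \<rho> (hd gs) (f (tl gs))
           \<oplus>\<^bsub>V\<^esub> (\<Oplus>\<^bsub>V\<^esub>i\<in>{1..k}. signed_term V i (f (merge_at G i gs)))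
           \<oplus>\<^bsub>V\<^esub> signed_term V (k + 1) (f (butlast gs)))
     (tuples G (k + 1))"

definition cocycles ::
    "('g, 'b) monoid_scheme \<Rightarrow> ('k, 'v, 'e) module_scheme \<Rightarrow> ('g \<Rightarrow> 'v \<Rightarrow> 'v)
      \<Rightarrow> nat \<Rightarrow> ('g list \<Rightarrow> 'v) set" where
  "cocycles G V \<rho> k =
     {f \<in> carrier (cochains G V k). coboundary G V \<rho> k f = \<zero>\<^bsub>cochains G V (k + 1)\<^esub>}"

definition coboundaries ::
    "('g, 'b) monoid_scheme \<Rightarrow> ('k, 'v, 'e) module_scheme \<Rightarrow> ('g \<Rightarrow> 'v \<Rightarrow> 'v)
      \<Rightarrow> nat \<Rightarrow> ('g list \<Rightarrow> 'v) set" where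
  "coboundaries G V \<rho> k =
     (if k = 0 then {\<zero>\<^bsub>cochains G V 0\<^esub>}
      else coboundary G V \<rho> (k - 1) ` carrier (cochains G V (k - 1)))"

definition group_cohomology ::
    "nat \<Rightarrow> ('g, 'b) monoid_scheme \<Rightarrow> ('k, 'v, 'e) module_scheme \<Rightarrow> ('g \<Rightarrow> 'v \<Rightarrow> 'v)
      \<Rightarrow> ('k, ('g list \<Rightarrow> 'v) set) module" where
  "group_cohomology k G V \<rho> =
     quot_vs ((cochains G V k)\<lparr>carrier := cocycles G V \<rho> k\<rparr>) (coboundaries G V \<rho> k)"


section \<open>The special linear group and its rational representations\<close>

definition SL :: "nat \<Rightarrow> 'r::comm_ring_1 mat monoid" where
  "SL n = \<lparr>carrier = {A \<in> carrier_mat n n. det A = 1}, mult = (*), one = 1\<^sub>m n\<rparr>"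

definition eval_at_0 :: "'a::comm_ring_1 poly mat \<Rightarrow> 'a mat" where
  "eval_at_0 = map_mat (\<lambda>p. poly p 0)"

text \<open>Polynomials in the \<open>n\<^sup>2\<close> matrix entries.\<close>

inductive_set entry_polys :: "nat \<Rightarrow> ('a::comm_ring_1 mat \<Rightarrow> 'a) set" for n :: nat where
  const: "(\<lambda>A. c) \<in> entry_polys n"
| entry: "\<lbrakk>i < n; j < n\<rbrakk> \<Longrightarrow> (\<lambda>A. A $$ (i, j)) \<in> entry_polys n"
| add: "\<lbrakk>p \<in> entry_polys n; q \<in> entry_polys n\<rbrakk> \<Longrightarrow> (\<lambda>A. p A + q A) \<in> entry_polys n"
| mult: "\<lbrakk>p \<in> entry_polys n; q \<in> entry_polys n\<rbrakk> \<Longrightarrow> (\<lambda>A. p A * q A) \<in> entry_polys n"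

definition regular_on_SL :: "nat \<Rightarrow> ('a::comm_ring_1 mat \<Rightarrow> 'a) \<Rightarrow> bool" where
  "regular_on_SL n f \<longleftrightarrow> (\<exists>p\<in>entry_polys n. \<forall>A\<in>carrier (SL n). f A = p A)"

text \<open>
  A finite-dimensional representation is rational (algebraic) if all its matrix coefficients
  \<open>A \<mapsto> l (\<rho> A v)\<close> are regular functions on \<open>SL\<^sub>n\<close>, that is, polynomials in the entries of \<open>A\<close>;
  the inverse of the determinant is not needed since \<open>det A = 1\<close>. Over an infinite field
  \<open>SL\<^sub>n(F)\<close> is Zariski dense in \<open>SL\<^sub>n\<close>, so these are the representations of the algebraic group
  \<open>SL\<^sub>n\<close> over \<open>F\<close>, with the same subrepresentations and isomorphisms.
\<close>

definition rational_rep ::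
    "nat \<Rightarrow> ('a::field, 'v, 'e) module_scheme \<Rightarrow> ('a mat \<Rightarrow> 'v \<Rightarrow> 'v) \<Rightarrow> bool" where
  "rational_rep n V \<rho> \<longleftrightarrow>
     linear_rep (SL n) class_ring V \<rho> \<and> vectorspace.fin_dim class_ring V \<and>
     (\<forall>v\<in>carrier V. \<forall>l\<in>LinearCombinations.module_hom class_ring V self_vs. regular_on_SL n (\<lambda>A. l (\<rho> A v)))"

definition irreducible_rational_rep ::
    "nat \<Rightarrow> ('a::field, 'v, 'e) module_scheme \<Rightarrow> ('a mat \<Rightarrow> 'v \<Rightarrow> 'v) \<Rightarrow> bool" where
  "irreducible_rational_rep n V \<rho> \<longleftrightarrow>
     rational_rep n V \<rho> \<and> rep_irreducible (SL n) class_ring V \<rho>"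

definition mat_trace :: "'a::comm_monoid_add mat \<Rightarrow> 'a" where
  "mat_trace X = (\<Sum>i<dim_row X. X $$ (i, i))"

definition sl_vs :: "nat \<Rightarrow> ('a::field, 'a mat) module" where
  "sl_vs n = (module_mat TYPE('a) n n)\<lparr>carrier := {X \<in> carrier_mat n n. mat_trace X = 0}\<rparr>"

definition Ad :: "nat \<Rightarrow> 'a::field mat \<Rightarrow> 'a mat \<Rightarrow> 'a mat" where
  "Ad n A X = A * X * inv\<^bsub>SL n\<^esub> A"


section \<open>The space \<open>F\<^sup>\<infinity> = Hom\<^sub>F(tF[t], F)\<close>\<close>

definition tFt :: "('a::field, 'a poly) module" where
  "tFt = \<lparr>carrier = {[:0, 1:] * p | p. True}, mult = (*), one = 0, zero = 0, add = (+),
     smult = Polynomial.smult\<rparr>"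

definition F_infinity :: "('a::field, 'a poly \<Rightarrow> 'a) module" where
  "F_infinity = hom_vs class_ring tFt self_vs"


section \<open>The definitions yield groups, vector spaces and representations\<close>

text \<open>
  In particular \<open>cocycles_1\<close> and \<open>coboundaries_1\<close> identify \<open>H\<^sup>1\<close> with crossed homomorphisms modulo
  principal crossed homomorphisms.
\<close>


lemma vectorspaceI: "field K \<Longrightarrow> Module.module K V \<Longrightarrow> vectorspace K V"
  by (simp add: vectorspace_def)

lemma module_abelian_group: "Module.module R M \<Longrightarrow> abelian_group M"
  by (simp add: Module.module_def)

lemma module_cring: "Module.module R M \<Longrightarrow> cring R"
  by (simp add: Module.module_def)

lemma (in Module.module) fun_vs_module: "Module.module R (fun_vs S M)"
proof -
  note A = module_abelian_group[OF module_axioms]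
  note neg = abelian_group.r_neg[OF A] abelian_group.a_inv_closed[OF A]
  have car: "f \<in> carrier (fun_vs S M) \<longleftrightarrow> (\<forall>s\<in>S. f s \<in> carrier M) \<and> f \<in> extensional S" for f
    by (auto simp: fun_vs_def PiE_iff)
  have eqI: "f = g" if "f \<in> extensional S" "g \<in> extensional S" "\<And>s. s \<in> S \<Longrightarrow> f s = g s"
    for f g :: "_ \<Rightarrow> 'c" using that by (rule extensionalityI)
  have ops: "\<zero>\<^bsub>fun_vs S M\<^esub> = restrict (\<lambda>_. \<zero>\<^bsub>M\<^esub>) S"
    "f \<oplus>\<^bsub>fun_vs S M\<^esub> g = restrict (\<lambda>s. f s \<oplus>\<^bsub>M\<^esub> g s) S"
    "c \<odot>\<^bsub>fun_vs S M\<^esub> f = restrict (\<lambda>s. c \<odot>\<^bsub>M\<^esub> f s) S" for f g c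
    by (simp_all add: fun_vs_def)
  show ?thesis
  proof (rule module_criteria)
    show "\<forall>v\<in>carrier (fun_vs S M). \<exists>w\<in>carrier (fun_vs S M). v \<oplus>\<^bsub>fun_vs S M\<^esub> w = \<zero>\<^bsub>fun_vs S M\<^esub>"
    proof
      fix f assume f: "f \<in> carrier (fun_vs S M)"
      have "restrict (\<lambda>s. \<ominus>\<^bsub>M\<^esub> f s) S \<in> carrier (fun_vs S M)" using f by (simp add: car neg)
      moreover have "f \<oplus>\<^bsub>fun_vs S M\<^esub> restrict (\<lambda>s. \<ominus>\<^bsub>M\<^esub> f s) S = \<zero>\<^bsub>fun_vs S M\<^esub>"
        using f unfolding car ops by (intro eqI) (simp_all add: neg)
      ultimately show "\<exists>w\<in>carrier (fun_vs S M). f \<oplus>\<^bsub>fun_vs S M\<^esub> w = \<zero>\<^bsub>fun_vs S M\<^esub>" by blast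
    qed
  next
    show "\<forall>v w. v \<in> carrier (fun_vs S M) \<and> w \<in> carrier (fun_vs S M) \<longrightarrow> v \<oplus>\<^bsub>fun_vs S M\<^esub> w = w \<oplus>\<^bsub>fun_vs S M\<^esub> v"
      unfolding car ops by (intro allI impI eqI) (simp_all add: M.a_comm)
    show "\<forall>v w x. v \<in> carrier (fun_vs S M) \<and> w \<in> carrier (fun_vs S M) \<and> x \<in> carrier (fun_vs S M) \<longrightarrow>
        v \<oplus>\<^bsub>fun_vs S M\<^esub> w \<oplus>\<^bsub>fun_vs S M\<^esub> x = v \<oplus>\<^bsub>fun_vs S M\<^esub> (w \<oplus>\<^bsub>fun_vs S M\<^esub> x)"
      unfolding car ops by (intro allI impI eqI) (simp_all add: M.a_assoc)
    show "\<forall>v\<in>carrier (fun_vs S M). v \<oplus>\<^bsub>fun_vs S M\<^esub> \<zero>\<^bsub>fun_vs S M\<^esub> = v"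
      unfolding ops Ball_def car by (intro allI impI eqI) simp_all
    show "\<forall>v\<in>carrier (fun_vs S M). \<one> \<odot>\<^bsub>fun_vs S M\<^esub> v = v"
      unfolding ops Ball_def car by (intro allI impI eqI) simp_all
    show "\<forall>a b v. a \<in> carrier R \<and> b \<in> carrier R \<and> v \<in> carrier (fun_vs S M) \<longrightarrow>
        (a \<otimes> b) \<odot>\<^bsub>fun_vs S M\<^esub> v = a \<odot>\<^bsub>fun_vs S M\<^esub> (b \<odot>\<^bsub>fun_vs S M\<^esub> v)"
      unfolding ops car by (intro allI impI eqI) (simp_all add: smult_assoc1)
    show "\<forall>a b v. a \<in> carrier R \<and> b \<in> carrier R \<and> v \<in> carrier (fun_vs S M) \<longrightarrow>
        (a \<oplus> b) \<odot>\<^bsub>fun_vs S M\<^esub> v = a \<odot>\<^bsub>fun_vs S M\<^esub> v \<oplus>\<^bsub>fun_vs S M\<^esub> b \<odot>\<^bsub>fun_vs S M\<^esub> v"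
      unfolding ops car by (intro allI impI eqI) (simp_all add: smult_l_distr)
    show "\<forall>a v w. a \<in> carrier R \<and> v \<in> carrier (fun_vs S M) \<and> w \<in> carrier (fun_vs S M) \<longrightarrow>
        a \<odot>\<^bsub>fun_vs S M\<^esub> (v \<oplus>\<^bsub>fun_vs S M\<^esub> w) = a \<odot>\<^bsub>fun_vs S M\<^esub> v \<oplus>\<^bsub>fun_vs S M\<^esub> a \<odot>\<^bsub>fun_vs S M\<^esub> w"
      unfolding ops car by (intro allI impI eqI) (simp_all add: smult_r_distr)
  qed (simp_all add: is_cring car ops)
qed

context Module.module begin

lemma submodule_neg:
  assumes N: "LinearCombinations.submodule R N M" and x: "x \<in> N"
  shows "\<ominus>\<^bsub>M\<^esub> x \<in> N"
proof -
  interpret N: LinearCombinations.submodule R N M by fact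
  have "x \<in> carrier M" using x N.subset by blast
  then have "\<ominus>\<^bsub>M\<^esub> x = (\<ominus>\<^bsub>R\<^esub> \<one>\<^bsub>R\<^esub>) \<odot>\<^bsub>M\<^esub> x"
    by (simp add: smult_l_minus)
  then show ?thesis using x N.smult_closed by simp
qed

lemma submodule_abelian_subgroup:
  assumes N: "LinearCombinations.submodule R N M"
  shows "abelian_subgroup N M"
proof (rule abelian_subgroupI3)
  interpret N: LinearCombinations.submodule R N M by fact
  show A: "abelian_group M" by (rule module_abelian_group[OF module_axioms])
  show "additive_subgroup N M"
  proof (intro additive_subgroupI group.subgroupI abelian_group.a_group A)
    show "N \<noteq> {}" using N.zero_closed by blast
  qed (use N.subset submodule_neg[OF N] in \<open>simp_all add: a_inv_def\<close>)
qed

lemma coset_smult: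
  assumes N: "LinearCombinations.submodule R N M" and x: "x \<in> carrier M" and c: "c \<in> carrier R"
  shows "c \<odot>\<^bsub>quot_vs M N\<^esub> (N +>\<^bsub>M\<^esub> x) = N +>\<^bsub>M\<^esub> (c \<odot>\<^bsub>M\<^esub> x)"
proof -
  interpret N: LinearCombinations.submodule R N M by fact
  note S = submodule_abelian_subgroup[OF N]
  have elem: "y \<in> N +>\<^bsub>M\<^esub> z \<longleftrightarrow> (\<exists>h\<in>N. y = h \<oplus>\<^bsub>M\<^esub> z)" for y z
    unfolding a_r_coset_def' by blast
  have sub: "subgroup N (add_monoid M)"
    using S unfolding abelian_subgroup_def additive_subgroup_def by blast
  have *: "N +>\<^bsub>M\<^esub> (c \<odot>\<^bsub>M\<^esub> y) = N +>\<^bsub>M\<^esub> (c \<odot>\<^bsub>M\<^esub> x)" if y: "y \<in> N +>\<^bsub>M\<^esub> x" for y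
  proof -
    obtain h where h: "h \<in> N" "y = h \<oplus>\<^bsub>M\<^esub> x" using elem[THEN iffD1, OF y] by (rule bexE)
    have "h \<in> carrier M" using h(1) N.subset by (rule rev_subsetD)
    then have "c \<odot>\<^bsub>M\<^esub> y = c \<odot>\<^bsub>M\<^esub> h \<oplus>\<^bsub>M\<^esub> c \<odot>\<^bsub>M\<^esub> x"
      unfolding h(2) using x c by (intro smult_r_distr)
    moreover have "c \<odot>\<^bsub>M\<^esub> h \<in> N" by (rule N.smult_closed[OF c h(1)])
    ultimately have "c \<odot>\<^bsub>M\<^esub> y \<in> N +>\<^bsub>M\<^esub> (c \<odot>\<^bsub>M\<^esub> x)"
      by (intro elem[THEN iffD2] bexI)
    from abelian_group.a_repr_independence[OF module_abelian_group[OF module_axioms] this smult_closed[OF c x] sub]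
    show ?thesis by (rule sym)
  qed
  have "x \<in> N +>\<^bsub>M\<^esub> x" by (rule abelian_subgroup.a_rcos_self[OF S x])
  then have "N +>\<^bsub>M\<^esub> x \<noteq> {}" by (metis empty_iff)
  then have "(\<Union>y\<in>N +>\<^bsub>M\<^esub> x. N +>\<^bsub>M\<^esub> (c \<odot>\<^bsub>M\<^esub> y)) = N +>\<^bsub>M\<^esub> (c \<odot>\<^bsub>M\<^esub> x)"
    using * by (rule SUP_eq_const)
  then show ?thesis unfolding quot_vs_def by (simp only: module.simps)
qed

lemma quot_vs_module:
  assumes N: "LinearCombinations.submodule R N M"
  shows "Module.module R (quot_vs M N)"
proof -
  interpret N: LinearCombinations.submodule R N M by fact
  interpret S: abelian_subgroup N M by (rule submodule_abelian_subgroup[OF N])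
  note A = module_abelian_group[OF module_axioms]
  have car: "X \<in> carrier (quot_vs M N) \<longleftrightarrow> (\<exists>x\<in>carrier M. X = N +>\<^bsub>M\<^esub> x)" for X
    by (auto simp: quot_vs_def A_RCOSETS_def RCOSETS_def a_r_coset_def)
  have add: "(N +>\<^bsub>M\<^esub> x) \<oplus>\<^bsub>quot_vs M N\<^esub> (N +>\<^bsub>M\<^esub> y) = N +>\<^bsub>M\<^esub> (x \<oplus>\<^bsub>M\<^esub> y)"
    if "x \<in> carrier M" "y \<in> carrier M" for x y
    using S.a_rcos_sum[OF that] by (simp add: quot_vs_def)
  have zero: "\<zero>\<^bsub>quot_vs M N\<^esub> = N +>\<^bsub>M\<^esub> \<zero>\<^bsub>M\<^esub>"
    using N.subset by (simp add: quot_vs_def)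
  have mem: "N +>\<^bsub>M\<^esub> x \<in> carrier (quot_vs M N)" if "x \<in> carrier M" for x
    using that car by blast
  have rep: "\<exists>x. x \<in> carrier M \<and> X = N +>\<^bsub>M\<^esub> x" if "X \<in> carrier (quot_vs M N)" for X
    using that car by blast
  note smul = coset_smult[OF N]
  show ?thesis
  proof (rule module_criteria)
    show "\<forall>v\<in>carrier (quot_vs M N). \<exists>neg_v\<in>carrier (quot_vs M N). v \<oplus>\<^bsub>quot_vs M N\<^esub> neg_v = \<zero>\<^bsub>quot_vs M N\<^esub>"
    proof
      fix X assume "X \<in> carrier (quot_vs M N)"
      then obtain x where x: "x \<in> carrier M" "X = N +>\<^bsub>M\<^esub> x" using car by auto
      then have "X \<oplus>\<^bsub>quot_vs M N\<^esub> (N +>\<^bsub>M\<^esub> (\<ominus>\<^bsub>M\<^esub> x)) = \<zero>\<^bsub>quot_vs M N\<^esub>"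
        by (simp add: add zero abelian_group.r_neg[OF A])
      moreover have "N +>\<^bsub>M\<^esub> (\<ominus>\<^bsub>M\<^esub> x) \<in> carrier (quot_vs M N)" using x car by auto
      ultimately show "\<exists>neg_v\<in>carrier (quot_vs M N). X \<oplus>\<^bsub>quot_vs M N\<^esub> neg_v = \<zero>\<^bsub>quot_vs M N\<^esub>" by blast
    qed
  next
    show "\<forall>v w. v \<in> carrier (quot_vs M N) \<and> w \<in> carrier (quot_vs M N) \<longrightarrow> v \<oplus>\<^bsub>quot_vs M N\<^esub> w = w \<oplus>\<^bsub>quot_vs M N\<^esub> v"
      by (intro allI impI, elim conjE; drule rep, drule rep; elim exE conjE; simp add: add M.a_comm)
    show "\<forall>v w x. v \<in> carrier (quot_vs M N) \<and> w \<in> carrier (quot_vs M N) \<and> x \<in> carrier (quot_vs M N) \<longrightarrow>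
        v \<oplus>\<^bsub>quot_vs M N\<^esub> w \<oplus>\<^bsub>quot_vs M N\<^esub> x = v \<oplus>\<^bsub>quot_vs M N\<^esub> (w \<oplus>\<^bsub>quot_vs M N\<^esub> x)"
      by (intro allI impI, elim conjE; drule rep, drule rep, drule rep; elim exE conjE; simp add: add M.a_assoc)
    show "\<forall>v\<in>carrier (quot_vs M N). v \<oplus>\<^bsub>quot_vs M N\<^esub> \<zero>\<^bsub>quot_vs M N\<^esub> = v"
      by (intro ballI, drule rep; elim exE conjE; simp add: add zero)
    show "\<forall>v\<in>carrier (quot_vs M N). \<one> \<odot>\<^bsub>quot_vs M N\<^esub> v = v"
      by (intro ballI, drule rep; elim exE conjE; simp add: smul)
    show "\<forall>a b v. a \<in> carrier R \<and> b \<in> carrier R \<and> v \<in> carrier (quot_vs M N) \<longrightarrow>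
        (a \<otimes> b) \<odot>\<^bsub>quot_vs M N\<^esub> v = a \<odot>\<^bsub>quot_vs M N\<^esub> (b \<odot>\<^bsub>quot_vs M N\<^esub> v)"
      by (intro allI impI, elim conjE; drule rep; elim exE conjE; simp add: smul smult_assoc1)
    show "\<forall>a b v. a \<in> carrier R \<and> b \<in> carrier R \<and> v \<in> carrier (quot_vs M N) \<longrightarrow>
        (a \<oplus> b) \<odot>\<^bsub>quot_vs M N\<^esub> v = a \<odot>\<^bsub>quot_vs M N\<^esub> v \<oplus>\<^bsub>quot_vs M N\<^esub> b \<odot>\<^bsub>quot_vs M N\<^esub> v"
      by (intro allI impI, elim conjE; drule rep; elim exE conjE; simp add: smul add smult_l_distr)
    show "\<forall>a v w. a \<in> carrier R \<and> v \<in> carrier (quot_vs M N) \<and> w \<in> carrier (quot_vs M N) \<longrightarrow>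
        a \<odot>\<^bsub>quot_vs M N\<^esub> (v \<oplus>\<^bsub>quot_vs M N\<^esub> w) = a \<odot>\<^bsub>quot_vs M N\<^esub> v \<oplus>\<^bsub>quot_vs M N\<^esub> a \<odot>\<^bsub>quot_vs M N\<^esub> w"
      by (intro allI impI, elim conjE; drule rep, drule rep; elim exE conjE; simp add: smul add smult_r_distr)
    show "\<forall>v w. v \<in> carrier (quot_vs M N) \<and> w \<in> carrier (quot_vs M N) \<longrightarrow> v \<oplus>\<^bsub>quot_vs M N\<^esub> w \<in> carrier (quot_vs M N)"
      by (intro allI impI, elim conjE; drule rep, drule rep; elim exE conjE; simp add: add mem)
    show "\<forall>c v. c \<in> carrier R \<and> v \<in> carrier (quot_vs M N) \<longrightarrow> c \<odot>\<^bsub>quot_vs M N\<^esub> v \<in> carrier (quot_vs M N)"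
      by (intro allI impI, elim conjE; drule rep; elim exE conjE; simp add: smul mem)
    show "\<zero>\<^bsub>quot_vs M N\<^esub> \<in> carrier (quot_vs M N)" by (simp add: zero mem)
  qed (rule is_cring)
qed

end

lemma self_vs_is_vs: "vectorspace class_ring (self_vs :: ('a::field, 'a) module)"
proof (rule vectorspaceI[OF class_field], rule module_criteria)
  show "\<forall>v\<in>carrier (self_vs :: ('a, 'a) module). \<exists>w\<in>carrier self_vs. v \<oplus>\<^bsub>self_vs\<^esub> w = \<zero>\<^bsub>self_vs\<^esub>"
  proof
    fix v :: 'a
    show "\<exists>w\<in>carrier self_vs. v \<oplus>\<^bsub>self_vs\<^esub> w = \<zero>\<^bsub>self_vs\<^esub>"
      by (rule bexI[of _ "- v"]) (simp_all add: self_vs_def)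
  qed
qed (simp_all add: self_vs_def class_cring.cring_axioms add.commute distrib_left distrib_right)

lemma tFt_is_vs: "vectorspace class_ring (tFt :: ('a::field, 'a poly) module)"
proof (rule vectorspaceI[OF class_field], rule module_criteria)
  have car: "p \<in> carrier (tFt :: ('a, 'a poly) module) \<longleftrightarrow> [:0, 1:] dvd p" for p
    by (auto simp: tFt_def dvd_def)
  show "\<forall>v\<in>carrier (tFt :: ('a, 'a poly) module). \<exists>w\<in>carrier tFt. v \<oplus>\<^bsub>tFt\<^esub> w = \<zero>\<^bsub>tFt\<^esub>"
  proof
    fix v assume "v \<in> carrier (tFt :: ('a, 'a poly) module)"
    then have "- v \<in> carrier (tFt :: ('a, 'a poly) module)" unfolding car by simp
    then show "\<exists>w\<in>carrier tFt. v \<oplus>\<^bsub>tFt\<^esub> w = \<zero>\<^bsub>tFt\<^esub>" by (rule bexI[rotated]) (simp add: tFt_def)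
  qed
  show "\<zero>\<^bsub>tFt\<^esub> \<in> carrier (tFt :: ('a, 'a poly) module)" unfolding car by (simp add: tFt_def)
  show "\<forall>v w. v \<in> carrier (tFt :: ('a, 'a poly) module) \<and> w \<in> carrier tFt \<longrightarrow> v \<oplus>\<^bsub>tFt\<^esub> w \<in> carrier tFt"
    unfolding car by (simp add: tFt_def dvd_add)
  show "\<forall>c v. c \<in> carrier (class_ring :: 'a ring) \<and> v \<in> carrier tFt \<longrightarrow> c \<odot>\<^bsub>tFt\<^esub> v \<in> carrier tFt"
    unfolding car by (simp add: tFt_def dvd_smult)
qed (simp_all add: tFt_def class_cring.cring_axioms smult_add_left smult_add_right add.commute)

lemma hom_vs_is_vs:
  assumes V: "vectorspace K V" and W_vs: "vectorspace K W"
  shows "vectorspace K (hom_vs K V W)"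
proof -
  interpret V: vectorspace K V by fact
  interpret W: vectorspace K W by fact
  interpret F: Module.module K "fun_vs (carrier V) W" by (rule W.fun_vs_module)
  note ac = W.M.a_ac
  have "LinearCombinations.submodule K (LinearCombinations.module_hom K V W \<inter> extensional (carrier V)) (fun_vs (carrier V) W)"
  proof
    show "LinearCombinations.module_hom K V W \<inter> extensional (carrier V) \<subseteq> carrier (fun_vs (carrier V) W)"
      by (auto simp: fun_vs_def LinearCombinations.module_hom_def PiE_def)
  next
    fix f g
    assume "f \<in> LinearCombinations.module_hom K V W \<inter> extensional (carrier V)"
      and "g \<in> LinearCombinations.module_hom K V W \<inter> extensional (carrier V)"
    then show "f \<oplus>\<^bsub>fun_vs (carrier V) W\<^esub> g \<in> LinearCombinations.module_hom K V W \<inter> extensional (carrier V)"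
      by (simp add: fun_vs_def LinearCombinations.module_hom_def Pi_iff W.smult_r_distr ac)
  next
    show "\<zero>\<^bsub>fun_vs (carrier V) W\<^esub> \<in> LinearCombinations.module_hom K V W \<inter> extensional (carrier V)"
      by (simp add: fun_vs_def LinearCombinations.module_hom_def Pi_iff)
  next
    fix c f
    assume c: "c \<in> carrier K" and f: "f \<in> LinearCombinations.module_hom K V W \<inter> extensional (carrier V)"
    have "c \<odot>\<^bsub>W\<^esub> (r \<odot>\<^bsub>W\<^esub> w) = r \<odot>\<^bsub>W\<^esub> (c \<odot>\<^bsub>W\<^esub> w)"
      if "r \<in> carrier K" "w \<in> carrier W" for r w
      using c that by (simp add: W.smult_assoc1[symmetric] comm_monoid.m_comm[OF cring.axioms(2)[OF module_cring[OF W.module_axioms]]])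
    then show "c \<odot>\<^bsub>fun_vs (carrier V) W\<^esub> f \<in> LinearCombinations.module_hom K V W \<inter> extensional (carrier V)"
      using c f by (simp add: fun_vs_def LinearCombinations.module_hom_def Pi_iff W.smult_r_distr)
  qed
  then show ?thesis
    unfolding hom_vs_def by (intro vectorspaceI vectorspace.axioms(2)[OF W_vs] F.submodule_is_module)
qed

lemma F_infinity_is_vs: "vectorspace class_ring F_infinity"
  unfolding F_infinity_def by (rule hom_vs_is_vs[OF tFt_is_vs self_vs_is_vs])

lemma sl_vs_is_vs: "vectorspace class_ring (sl_vs n :: ('a::field, 'a mat) module)"
proof -
  interpret M: vectorspace "class_ring :: 'a ring" "module_mat TYPE('a) n n" by (rule matrix_vs)
  have "LinearCombinations.submodule (class_ring :: 'a ring) {X \<in> carrier_mat n n. mat_trace X = 0} (module_mat TYPE('a) n n)"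
    by unfold_locales
     (auto simp: module_mat_simps mat_trace_def sum.distrib sum_distrib_left[symmetric])
  then show ?thesis
    unfolding sl_vs_def by (intro vectorspaceI class_field M.submodule_is_module)
qed

lemma group_SL: "group (SL n :: 'r::comm_ring_1 mat monoid)"
proof (rule groupI)
  fix A :: "'r mat" assume "A \<in> carrier (SL n)"
  then have A: "A \<in> carrier_mat n n" "det A = 1" by (auto simp: SL_def)
  have B: "adj_mat A \<in> carrier_mat n n" "adj_mat A * A = 1\<^sub>m n"
    using adj_mat[OF A(1)] A(2) by auto
  then have "det (adj_mat A) * det A = 1" using A(1) by (metis det_mult det_one)
  then have "det (adj_mat A) = 1" using A(2) by simp
  then show "\<exists>B\<in>carrier (SL n). B \<otimes>\<^bsub>SL n\<^esub> A = \<one>\<^bsub>SL n\<^esub>" using B by (auto simp: SL_def)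
qed (auto simp: SL_def det_mult)

lemma eval_at_0_hom: "eval_at_0 \<in> hom (SL n) (SL n)"
proof -
  interpret comm_ring_hom "\<lambda>p::'a poly. poly p 0" by unfold_locales auto
  show ?thesis
    by (auto simp: hom_def SL_def eval_at_0_def mat_hom_mult)
qed

lemma tuples_1: "gs \<in> tuples G 1 \<longleftrightarrow> (\<exists>g\<in>carrier G. gs = [g])"
  by (auto simp: tuples_def length_Suc_conv)

lemma tuples_2: "gs \<in> tuples G 2 \<longleftrightarrow> (\<exists>g\<in>carrier G. \<exists>h\<in>carrier G. gs = [g, h])"
  by (auto simp: tuples_def numeral_2_eq_2 length_Suc_conv)

context linear_rep begin

lemma rep_closed: "g \<in> carrier G \<Longrightarrow> v \<in> carrier V \<Longrightarrow> \<rho> g v \<in> carrier V"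
  using rep_hom[of g] unfolding LinearCombinations.module_hom_def by blast

lemma rep_add: "\<lbrakk>g \<in> carrier G; v \<in> carrier V; w \<in> carrier V\<rbrakk> \<Longrightarrow> \<rho> g (v \<oplus>\<^bsub>V\<^esub> w) = \<rho> g v \<oplus>\<^bsub>V\<^esub> \<rho> g w"
  using rep_hom[of g] unfolding LinearCombinations.module_hom_def by blast

lemma rep_smult: "\<lbrakk>g \<in> carrier G; c \<in> carrier K; v \<in> carrier V\<rbrakk> \<Longrightarrow> \<rho> g (c \<odot>\<^bsub>V\<^esub> v) = c \<odot>\<^bsub>V\<^esub> \<rho> g v"
  using rep_hom[of g] unfolding LinearCombinations.module_hom_def by blast

lemma cochain_1: "f \<in> carrier (cochains G V 1) \<Longrightarrow> g \<in> carrier G \<Longrightarrow> f [g] \<in> carrier V"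
  unfolding fun_vs_def by (auto simp: PiE_iff tuples_1[unfolded One_nat_def])

lemma coboundary_1:
  assumes f: "f \<in> carrier (cochains G V 1)" and g: "g \<in> carrier G" and h: "h \<in> carrier G"
  shows "coboundary G V \<rho> 1 f [g, h] = \<rho> g (f [h]) \<oplus>\<^bsub>V\<^esub> \<ominus>\<^bsub>V\<^esub> f [g \<otimes>\<^bsub>G\<^esub> h] \<oplus>\<^bsub>V\<^esub> f [g]"
proof -
  have "f [g \<otimes>\<^bsub>G\<^esub> h] \<in> carrier V" using f g h by (intro cochain_1) auto
  moreover have "[g, h] \<in> tuples G (1 + 1)" using g h by (simp add: tuples_def)
  ultimately show ?thesis
    by (simp add: coboundary_def signed_term_def merge_at_def)
qed

lemma cocycles_1:
  "cocycles G V \<rho> 1 = {f \<in> carrier (cochains G V 1).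
     \<forall>g\<in>carrier G. \<forall>h\<in>carrier G. f [g \<otimes>\<^bsub>G\<^esub> h] = f [g] \<oplus>\<^bsub>V\<^esub> \<rho> g (f [h])}"
proof -
  note A = module_abelian_group[OF module_axioms]
  have eq: "a \<oplus>\<^bsub>V\<^esub> \<ominus>\<^bsub>V\<^esub> b \<oplus>\<^bsub>V\<^esub> c = \<zero>\<^bsub>V\<^esub> \<longleftrightarrow> b = c \<oplus>\<^bsub>V\<^esub> a"
    if abc: "a \<in> carrier V" "b \<in> carrier V" "c \<in> carrier V" for a b c
  proof -
    have nb: "\<ominus>\<^bsub>V\<^esub> b \<in> carrier V" "b \<oplus>\<^bsub>V\<^esub> \<ominus>\<^bsub>V\<^esub> b = \<zero>\<^bsub>V\<^esub>" "\<ominus>\<^bsub>V\<^esub> b \<oplus>\<^bsub>V\<^esub> b = \<zero>\<^bsub>V\<^esub>"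
      using abc abelian_group.a_inv_closed[OF A] abelian_group.r_neg[OF A] abelian_group.l_neg[OF A]
      by simp_all
    have 1: "a \<oplus>\<^bsub>V\<^esub> \<ominus>\<^bsub>V\<^esub> b \<oplus>\<^bsub>V\<^esub> c = (c \<oplus>\<^bsub>V\<^esub> a) \<oplus>\<^bsub>V\<^esub> \<ominus>\<^bsub>V\<^esub> b"
      using abc nb(1) by (simp add: M.a_ac)
    have "c \<oplus>\<^bsub>V\<^esub> a = b" if 0: "(c \<oplus>\<^bsub>V\<^esub> a) \<oplus>\<^bsub>V\<^esub> \<ominus>\<^bsub>V\<^esub> b = \<zero>\<^bsub>V\<^esub>"
    proof -
      have "c \<oplus>\<^bsub>V\<^esub> a = (c \<oplus>\<^bsub>V\<^esub> a) \<oplus>\<^bsub>V\<^esub> (\<ominus>\<^bsub>V\<^esub> b \<oplus>\<^bsub>V\<^esub> b)" using abc nb(3) by simp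
      also have "\<dots> = ((c \<oplus>\<^bsub>V\<^esub> a) \<oplus>\<^bsub>V\<^esub> \<ominus>\<^bsub>V\<^esub> b) \<oplus>\<^bsub>V\<^esub> b" using abc nb(1) by (simp only: M.a_assoc M.a_closed)
      finally show ?thesis using abc unfolding 0 by simp
    qed
    then show ?thesis unfolding 1 using nb(2) by metis
  qed
  have "coboundary G V \<rho> 1 f = \<zero>\<^bsub>cochains G V (1 + 1)\<^esub> \<longleftrightarrow>
     (\<forall>g\<in>carrier G. \<forall>h\<in>carrier G. f [g \<otimes>\<^bsub>G\<^esub> h] = f [g] \<oplus>\<^bsub>V\<^esub> \<rho> g (f [h]))"
    if f: "f \<in> carrier (cochains G V 1)" for f
  proof -
    have "coboundary G V \<rho> 1 f \<in> extensional (tuples G 2)"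
      unfolding coboundary_def by (simp add: numeral_2_eq_2)
    then have "coboundary G V \<rho> 1 f = \<zero>\<^bsub>cochains G V 2\<^esub> \<longleftrightarrow>
        (\<forall>gs\<in>tuples G 2. coboundary G V \<rho> 1 f gs = \<zero>\<^bsub>V\<^esub>)"
      unfolding fun_vs_def by (auto intro: extensionalityI)
    also have "\<dots> \<longleftrightarrow> (\<forall>g\<in>carrier G. \<forall>h\<in>carrier G. coboundary G V \<rho> 1 f [g, h] = \<zero>\<^bsub>V\<^esub>)"
      unfolding Ball_def tuples_2 by blast
    also have "\<dots> \<longleftrightarrow> (\<forall>g\<in>carrier G. \<forall>h\<in>carrier G. f [g \<otimes>\<^bsub>G\<^esub> h] = f [g] \<oplus>\<^bsub>V\<^esub> \<rho> g (f [h]))"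
      by (intro ball_cong refl) (simp add: coboundary_1[OF f] eq rep_closed cochain_1[OF f] del: One_nat_def)
    finally show ?thesis by (simp only: one_add_one)
  qed
  then show ?thesis unfolding cocycles_def by (intro Collect_cong conj_cong refl)
qed

lemma coboundaries_1:
  "coboundaries G V \<rho> 1 = (\<lambda>v. restrict (\<lambda>gs. \<rho> (hd gs) v \<ominus>\<^bsub>V\<^esub> v) (tuples G 1)) ` carrier V"
proof -
  note A = module_abelian_group[OF module_axioms]
  have t0: "tuples G 0 = {[]}" by (auto simp: tuples_def)
  have d: "coboundary G V \<rho> 0 f = restrict (\<lambda>gs. \<rho> (hd gs) (f []) \<ominus>\<^bsub>V\<^esub> f []) (tuples G 1)"
    if f: "f [] \<in> carrier V" for f
    unfolding coboundary_def add_0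
  proof (rule restrict_ext)
    fix gs assume "gs \<in> tuples G 1"
    then obtain g where g: "g \<in> carrier G" "gs = [g]" unfolding tuples_1 by blast
    then show "\<rho> (hd gs) (f (tl gs)) \<oplus>\<^bsub>V\<^esub> (\<Oplus>\<^bsub>V\<^esub>i\<in>{1..0}. signed_term V i (f (merge_at G i gs)))
        \<oplus>\<^bsub>V\<^esub> signed_term V 1 (f (butlast gs)) = \<rho> (hd gs) (f []) \<ominus>\<^bsub>V\<^esub> f []"
      using f rep_closed[of g "f []"] by (simp add: signed_term_def abelian_group.minus_eq[OF A])
  qed
  have "coboundaries G V \<rho> 1 = coboundary G V \<rho> 0 ` carrier (cochains G V 0)"
    by (simp add: coboundaries_def)
  also have "\<dots> = (\<lambda>v. restrict (\<lambda>gs. \<rho> (hd gs) v \<ominus>\<^bsub>V\<^esub> v) (tuples G 1)) ` ((\<lambda>f. f []) ` carrier (cochains G V 0))"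
    unfolding image_image by (rule image_cong[OF refl], rule d) (auto simp: fun_vs_def t0)
  also have "(\<lambda>f. f []) ` carrier (cochains G V 0) = carrier V"
  proof
    show "(\<lambda>f. f []) ` carrier (cochains G V 0) \<subseteq> carrier V" by (auto simp: fun_vs_def t0)
    show "carrier V \<subseteq> (\<lambda>f. f []) ` carrier (cochains G V 0)"
    proof
      fix v assume "v \<in> carrier V"
      then show "v \<in> (\<lambda>f. f []) ` carrier (cochains G V 0)"
        by (intro image_eqI[of _ _ "restrict (\<lambda>_. v) {[]}"]) (auto simp: fun_vs_def t0)
    qed
  qed
  finally show ?thesis .
qed

lemma cocycles_1_submodule: "LinearCombinations.submodule K (cocycles G V \<rho> 1) (cochains G V 1)"
proof (intro LinearCombinations.submodule.intro)
  have car: "f \<in> carrier (cochains G V 1) \<longleftrightarrow>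
      (\<forall>g\<in>carrier G. f [g] \<in> carrier V) \<and> f \<in> extensional (tuples G 1)" for f
    unfolding fun_vs_def by (auto simp: PiE_iff tuples_1 simp del: One_nat_def)
  have t: "g \<in> carrier G \<Longrightarrow> [g] \<in> tuples G 1" for g by (simp add: tuples_def)
  have ops: "\<zero>\<^bsub>cochains G V 1\<^esub> = restrict (\<lambda>_. \<zero>\<^bsub>V\<^esub>) (tuples G 1)"
    "f \<oplus>\<^bsub>cochains G V 1\<^esub> f' = restrict (\<lambda>s. f s \<oplus>\<^bsub>V\<^esub> f' s) (tuples G 1)"
    "c \<odot>\<^bsub>cochains G V 1\<^esub> f = restrict (\<lambda>s. c \<odot>\<^bsub>V\<^esub> f s) (tuples G 1)" for f f' c
    by (simp_all add: fun_vs_def)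
  have rep_zero: "\<rho> g \<zero>\<^bsub>V\<^esub> = \<zero>\<^bsub>V\<^esub>" if g: "g \<in> carrier G" for g
    using rep_smult[OF g, of "\<zero>\<^bsub>K\<^esub>" "\<zero>\<^bsub>V\<^esub>"] rep_closed[OF g, of "\<zero>\<^bsub>V\<^esub>"] by simp
  show "Module.module K (cochains G V 1)" by (rule fun_vs_module)
  show "cocycles G V \<rho> 1 \<subseteq> carrier (cochains G V 1)" by (auto simp: cocycles_def)
  show "\<zero>\<^bsub>cochains G V 1\<^esub> \<in> cocycles G V \<rho> 1"
    unfolding cocycles_1 mem_Collect_eq car ops by (simp add: t rep_zero del: One_nat_def)
  show "f \<oplus>\<^bsub>cochains G V 1\<^esub> f' \<in> cocycles G V \<rho> 1"
    if "f \<in> cocycles G V \<rho> 1" "f' \<in> cocycles G V \<rho> 1" for f f'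
    using that unfolding cocycles_1 mem_Collect_eq car ops
    by (simp add: t rep_add rep_closed M.a_ac del: One_nat_def)
  show "c \<odot>\<^bsub>cochains G V 1\<^esub> f \<in> cocycles G V \<rho> 1"
    if "c \<in> carrier K" "f \<in> cocycles G V \<rho> 1" for c f
    using that unfolding cocycles_1 mem_Collect_eq car ops
    by (simp add: t rep_smult rep_closed smult_r_distr del: One_nat_def)
qed

lemma coboundaries_1_submodule:
  "LinearCombinations.submodule K (coboundaries G V \<rho> 1)
     ((cochains G V 1)\<lparr>carrier := cocycles G V \<rho> 1\<rparr>)"
proof (intro LinearCombinations.submodule.intro)
  interpret C: Module.module K "cochains G V 1" by (rule fun_vs_module)
  note A = module_abelian_group[OF module_axioms]
  note neg = abelian_group.minus_eq[OF A] abelian_group.a_inv_closed[OF A] abelian_group.minus_add[OF A]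
    smult_r_minus abelian_group.r_neg[OF A]
  have t: "g \<in> carrier G \<Longrightarrow> [g] \<in> tuples G 1" for g by (simp add: tuples_def)
  have ops: "\<zero>\<^bsub>cochains G V 1\<^esub> = restrict (\<lambda>_. \<zero>\<^bsub>V\<^esub>) (tuples G 1)"
    "f \<oplus>\<^bsub>cochains G V 1\<^esub> f' = restrict (\<lambda>s. f s \<oplus>\<^bsub>V\<^esub> f' s) (tuples G 1)"
    "c \<odot>\<^bsub>cochains G V 1\<^esub> f = restrict (\<lambda>s. c \<odot>\<^bsub>V\<^esub> f s) (tuples G 1)" for f f' c
    by (simp_all add: fun_vs_def)
  have rep_zero: "\<rho> g \<zero>\<^bsub>V\<^esub> = \<zero>\<^bsub>V\<^esub>" if g: "g \<in> carrier G" for g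
    using rep_smult[OF g, of "\<zero>\<^bsub>K\<^esub>" "\<zero>\<^bsub>V\<^esub>"] rep_closed[OF g, of "\<zero>\<^bsub>V\<^esub>"] by simp
  define \<delta> where "\<delta> v = restrict (\<lambda>gs. \<rho> (hd gs) v \<ominus>\<^bsub>V\<^esub> v) (tuples G 1)" for v
  have B: "coboundaries G V \<rho> 1 = \<delta> ` carrier V" unfolding coboundaries_1 \<delta>_def ..
  have hd: "hd gs \<in> carrier G" if "gs \<in> tuples G 1" for gs
    using that unfolding tuples_1 by auto
  show "Module.module K ((cochains G V 1)\<lparr>carrier := cocycles G V \<rho> 1\<rparr>)"
    by (rule C.submodule_is_module[OF cocycles_1_submodule])
  show "coboundaries G V \<rho> 1 \<subseteq> carrier ((cochains G V 1)\<lparr>carrier := cocycles G V \<rho> 1\<rparr>)"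
  proof
    fix f assume "f \<in> coboundaries G V \<rho> 1"
    then obtain v where v: "v \<in> carrier V" "f = \<delta> v" unfolding B by blast
    have fg: "f [g] = \<rho> g v \<oplus>\<^bsub>V\<^esub> \<ominus>\<^bsub>V\<^esub> v" if "g \<in> carrier G" for g
      using t[OF that] unfolding v(2) \<delta>_def by (simp add: neg(1) del: One_nat_def)
    have inv: "\<rho> g (\<ominus>\<^bsub>V\<^esub> v) = \<ominus>\<^bsub>V\<^esub> \<rho> g v" if g: "g \<in> carrier G" for g
    proof -
      have "\<rho> g (\<ominus>\<^bsub>V\<^esub> v) \<oplus>\<^bsub>V\<^esub> \<rho> g v = \<rho> g (\<ominus>\<^bsub>V\<^esub> v \<oplus>\<^bsub>V\<^esub> v)"
        using v g by (simp add: rep_add neg(2))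
      also have "\<dots> = \<zero>\<^bsub>V\<^esub>" using v g by (simp add: abelian_group.l_neg[OF A] rep_zero)
      finally show ?thesis
        using v g by (intro abelian_group.minus_equality[OF A, symmetric]) (simp_all add: rep_closed neg(2))
    qed
    have "f \<in> carrier (cochains G V 1)"
      unfolding v(2) \<delta>_def fun_vs_def
      using v(1) by (auto simp: neg(1,2) rep_closed hd simp del: One_nat_def)
    moreover have "f [g \<otimes>\<^bsub>G\<^esub> h] = f [g] \<oplus>\<^bsub>V\<^esub> \<rho> g (f [h])" if gh: "g \<in> carrier G" "h \<in> carrier G" for g h
    proof -
      have c: "\<rho> g v \<in> carrier V" "\<rho> h v \<in> carrier V" "\<rho> g (\<rho> h v) \<in> carrier V" "\<ominus>\<^bsub>V\<^esub> v \<in> carrier V"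
        "\<ominus>\<^bsub>V\<^esub> \<rho> g v \<in> carrier V"
        using gh v(1) by (simp_all add: rep_closed neg(2))
      have "f [g] \<oplus>\<^bsub>V\<^esub> \<rho> g (f [h])
          = (\<rho> g v \<oplus>\<^bsub>V\<^esub> \<ominus>\<^bsub>V\<^esub> v) \<oplus>\<^bsub>V\<^esub> (\<rho> g (\<rho> h v) \<oplus>\<^bsub>V\<^esub> \<ominus>\<^bsub>V\<^esub> \<rho> g v)"
        using gh v(1) c by (simp add: fg rep_add inv)
      also have "\<dots> = (\<rho> g v \<oplus>\<^bsub>V\<^esub> \<ominus>\<^bsub>V\<^esub> \<rho> g v) \<oplus>\<^bsub>V\<^esub> (\<rho> g (\<rho> h v) \<oplus>\<^bsub>V\<^esub> \<ominus>\<^bsub>V\<^esub> v)"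
        using c by (simp only: M.a_ac M.a_closed)
      also have "\<dots> = f [g \<otimes>\<^bsub>G\<^esub> h]"
        using gh v(1) c by (simp add: fg rep_mult neg(5))
      finally show ?thesis by (rule sym)
    qed
    ultimately show "f \<in> carrier ((cochains G V 1)\<lparr>carrier := cocycles G V \<rho> 1\<rparr>)"
      unfolding cocycles_1 by simp
  qed
  show "\<zero>\<^bsub>(cochains G V 1)\<lparr>carrier := cocycles G V \<rho> 1\<rparr>\<^esub> \<in> coboundaries G V \<rho> 1"
  proof -
    have "\<delta> \<zero>\<^bsub>V\<^esub> = \<zero>\<^bsub>cochains G V 1\<^esub>"
      unfolding \<delta>_def ops by (rule restrict_ext) (use hd neg(5)[OF M.zero_closed] in \<open>simp only: rep_zero neg(1)\<close>)
    moreover have "\<delta> \<zero>\<^bsub>V\<^esub> \<in> coboundaries G V \<rho> 1" unfolding B by simp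
    ultimately show ?thesis by simp
  qed
  show "f \<oplus>\<^bsub>(cochains G V 1)\<lparr>carrier := cocycles G V \<rho> 1\<rparr>\<^esub> f' \<in> coboundaries G V \<rho> 1"
    if ff: "f \<in> coboundaries G V \<rho> 1" "f' \<in> coboundaries G V \<rho> 1" for f f'
  proof -
    obtain v w where v: "v \<in> carrier V" "f = \<delta> v" and w: "w \<in> carrier V" "f' = \<delta> w"
      using ff unfolding B by blast
    have "\<delta> v \<oplus>\<^bsub>cochains G V 1\<^esub> \<delta> w = \<delta> (v \<oplus>\<^bsub>V\<^esub> w)"
      unfolding \<delta>_def ops
    proof (rule restrict_ext)
      fix gs assume gs: "gs \<in> tuples G 1"
      show "restrict (\<lambda>gs. \<rho> (hd gs) v \<ominus>\<^bsub>V\<^esub> v) (tuples G 1) gs \<oplus>\<^bsub>V\<^esub> restrict (\<lambda>gs. \<rho> (hd gs) w \<ominus>\<^bsub>V\<^esub> w) (tuples G 1) gs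
          = \<rho> (hd gs) (v \<oplus>\<^bsub>V\<^esub> w) \<ominus>\<^bsub>V\<^esub> (v \<oplus>\<^bsub>V\<^esub> w)"
        using gs hd[OF gs] v(1) w(1)
        by (simp add: neg(1,2,3) rep_add rep_closed M.a_ac del: One_nat_def)
    qed
    then show ?thesis using v w unfolding B by simp
  qed
  show "c \<odot>\<^bsub>(cochains G V 1)\<lparr>carrier := cocycles G V \<rho> 1\<rparr>\<^esub> f \<in> coboundaries G V \<rho> 1"
    if cf: "c \<in> carrier K" "f \<in> coboundaries G V \<rho> 1" for c f
  proof -
    obtain v where v: "v \<in> carrier V" "f = \<delta> v" using cf unfolding B by blast
    have "c \<odot>\<^bsub>cochains G V 1\<^esub> \<delta> v = \<delta> (c \<odot>\<^bsub>V\<^esub> v)"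
      unfolding \<delta>_def ops
    proof (rule restrict_ext)
      fix gs assume gs: "gs \<in> tuples G 1"
      show "c \<odot>\<^bsub>V\<^esub> restrict (\<lambda>gs. \<rho> (hd gs) v \<ominus>\<^bsub>V\<^esub> v) (tuples G 1) gs = \<rho> (hd gs) (c \<odot>\<^bsub>V\<^esub> v) \<ominus>\<^bsub>V\<^esub> (c \<odot>\<^bsub>V\<^esub> v)"
        using gs hd[OF gs] v(1) cf(1)
        by (simp add: neg(1,2,4) rep_smult rep_closed smult_r_distr del: One_nat_def)
    qed
    then show ?thesis using v cf unfolding B by simp
  qed
qed

lemma group_cohomology_1_is_vs: "vectorspace K (group_cohomology 1 G V \<rho>)"
proof -
  interpret C: Module.module K "cochains G V 1" by (rule fun_vs_module)
  interpret Z: Module.module K "(cochains G V 1)\<lparr>carrier := cocycles G V \<rho> 1\<rparr>"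
    by (rule C.submodule_is_module[OF cocycles_1_submodule])
  show ?thesis
    unfolding group_cohomology_def
    by (intro vectorspaceI vectorspace.axioms(2)[OF vectorspace_axioms] Z.quot_vs_module coboundaries_1_submodule)
qed

lemma linear_rep_comp:
  assumes H: "group H" and \<phi>: "\<phi> \<in> hom H G"
  shows "linear_rep H K V (\<rho> \<circ> \<phi>)"
proof -
  interpret H: group H by fact
  interpret h: group_hom H G \<phi> using \<phi> by unfold_locales
  show ?thesis
    by unfold_locales (simp_all add: rep_hom rep_mult rep_one)
qed

end

lemma mat_trace_commute:
  fixes A :: "'a::comm_semiring_0 mat"
  assumes "A \<in> carrier_mat n n" "B \<in> carrier_mat n n"
  shows "mat_trace (A * B) = mat_trace (B * A)"
proof -
  have "mat_trace (A * B) = (\<Sum>i<n. \<Sum>k<n. A $$ (i, k) * B $$ (k, i))"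
    using assms by (simp add: mat_trace_def scalar_prod_def lessThan_atLeast0)
  also have "\<dots> = (\<Sum>k<n. \<Sum>i<n. B $$ (k, i) * A $$ (i, k))"
    by (subst sum.swap) (simp add: mult.commute)
  also have "\<dots> = mat_trace (B * A)"
    using assms by (simp add: mat_trace_def scalar_prod_def lessThan_atLeast0)
  finally show ?thesis .
qed

lemma linear_rep_Ad: "linear_rep (SL n) class_ring (sl_vs n) (Ad n)"
proof -
  interpret G: group "SL n :: 'a mat monoid" by (rule group_SL)
  interpret V: vectorspace "class_ring :: 'a ring" "sl_vs n" by (rule sl_vs_is_vs)
  have inv: "inv\<^bsub>SL n\<^esub> A \<in> carrier_mat n n" "A \<in> carrier_mat n n" "inv\<^bsub>SL n\<^esub> A * A = 1\<^sub>m n"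
    if "A \<in> carrier (SL n)" for A :: "'a mat"
    using G.inv_closed[OF that] G.l_inv[OF that] that by (auto simp: SL_def)
  have tr: "mat_trace (Ad n A X) = mat_trace X"
    if A: "A \<in> carrier (SL n)" and X: "X \<in> carrier_mat n n" for A X :: "'a mat"
  proof -
    note i = inv[OF A]
    have "mat_trace (Ad n A X) = mat_trace (inv\<^bsub>SL n\<^esub> A * (A * X))"
      unfolding Ad_def by (rule mat_trace_commute) (use i X in auto)
    also have "inv\<^bsub>SL n\<^esub> A * (A * X) = inv\<^bsub>SL n\<^esub> A * A * X"
      using i X by (intro assoc_mult_mat[symmetric]) auto
    finally show ?thesis using i X by simp
  qed
  show ?thesis
  proof unfold_locales
    fix A :: "'a mat" assume A: "A \<in> carrier (SL n)"
    note i = inv[OF A]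
    show "Ad n A \<in> LinearCombinations.module_hom class_ring (sl_vs n) (sl_vs n)"
      unfolding LinearCombinations.module_hom_def
    proof (intro CollectI conjI allI impI)
      show "Ad n A \<in> carrier (sl_vs n) \<rightarrow> carrier (sl_vs n)"
        using i tr[OF A] by (auto simp: sl_vs_def Ad_def)
    next
      fix X Y :: "'a mat" assume "X \<in> carrier (sl_vs n) \<and> Y \<in> carrier (sl_vs n)"
      then have X: "X \<in> carrier_mat n n" "Y \<in> carrier_mat n n" by (auto simp: sl_vs_def)
      have "A * (X + Y) * inv\<^bsub>SL n\<^esub> A = (A * X + A * Y) * inv\<^bsub>SL n\<^esub> A"
        using X i by (subst mult_add_distrib_mat) auto
      also have "\<dots> = A * X * inv\<^bsub>SL n\<^esub> A + A * Y * inv\<^bsub>SL n\<^esub> A"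
        using X i by (subst add_mult_distrib_mat) auto
      finally show "Ad n A (X \<oplus>\<^bsub>sl_vs n\<^esub> Y) = Ad n A X \<oplus>\<^bsub>sl_vs n\<^esub> Ad n A Y"
        by (simp add: Ad_def sl_vs_def module_mat_simps)
    next
      fix c and X :: "'a mat" assume "c \<in> carrier (class_ring :: 'a ring) \<and> X \<in> carrier (sl_vs n)"
      then have X: "X \<in> carrier_mat n n" by (auto simp: sl_vs_def)
      have "A * (c \<cdot>\<^sub>m X) * inv\<^bsub>SL n\<^esub> A = c \<cdot>\<^sub>m (A * X * inv\<^bsub>SL n\<^esub> A)"
        using X i by (simp add: mult_smult_distrib mult_smult_assoc_mat[of _ n n])
      then show "Ad n A (c \<odot>\<^bsub>sl_vs n\<^esub> X) = c \<odot>\<^bsub>sl_vs n\<^esub> Ad n A X"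
        by (simp add: Ad_def sl_vs_def module_mat_simps)
    qed
  next
    fix A B X :: "'a mat"
    assume A: "A \<in> carrier (SL n)" and B: "B \<in> carrier (SL n)" and "X \<in> carrier (sl_vs n)"
    then have X: "X \<in> carrier_mat n n" by (auto simp: sl_vs_def)
    note i = inv[OF A] inv[OF B]
    have "inv\<^bsub>SL n\<^esub> (A \<otimes>\<^bsub>SL n\<^esub> B) = inv\<^bsub>SL n\<^esub> B * inv\<^bsub>SL n\<^esub> A"
      using G.inv_mult_group[OF A B] by (simp add: SL_def)
    then show "Ad n (A \<otimes>\<^bsub>SL n\<^esub> B) X = Ad n A (Ad n B X)"
      using i X by (simp add: Ad_def) (simp add: SL_def assoc_mult_mat[of _ n n _ n _ n])
  next
    fix X :: "'a mat" assume "X \<in> carrier (sl_vs n)"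
    then have "X \<in> carrier_mat n n" by (auto simp: sl_vs_def)
    moreover have "inv\<^bsub>SL n\<^esub> \<one>\<^bsub>SL n\<^esub> = (1\<^sub>m n :: 'a mat)" using G.inv_one by (simp add: SL_def)
    moreover have "\<one>\<^bsub>SL n\<^esub> = (1\<^sub>m n :: 'a mat)" by (simp add: SL_def)
    ultimately show "Ad n \<one>\<^bsub>SL n\<^esub> X = X" by (simp add: Ad_def)
  qed
qed
end

theory Submission
  imports Defs
begin

text \<open>
  The extension of \<open>SL\<^sub>n(F)\<close> by the kernel of \<open>t \<mapsto> 0\<close> splits, so \<open>H\<^sup>1(SL\<^sub>n(F[t]), V)\<close> is the sum of
  \<open>H\<^sup>1(SL\<^sub>n(F), V)\<close> and the space of cocycles vanishing on \<open>SL\<^sub>n(F)\<close>. As \<open>SL\<^sub>n(F[t])\<close> is generated by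
  elementary matrices, such a cocycle is determined by its values on the matrices \<open>1 + x p q\<^sup>T\<close> with
  \<open>x \<in> tF[t]\<close> and \<open>q\<^sup>T p = 0\<close>, which lie in the kernel. For fixed \<open>x\<close> these values are additive
  in \<open>p\<close> and \<open>q\<close> and equivariant; rationality of \<open>V\<close> makes the dependence on \<open>p\<close> and \<open>q\<close>
  bilinear, so that they come from an equivariant linear map \<open>sl\<^sub>n \<rightarrow> V\<close>. It vanishes unless
  \<open>V \<cong> Ad\<close>, and then it is a scalar \<open>\<lambda>(x)\<close>, where \<open>\<lambda>\<close> is a linear functional on \<open>tF[t]\<close>.

  If \<open>n \<ge> 3\<close>, then \<open>1 + xy E\<^sub>1\<^sub>m\<close> is the commutator of \<open>1 + x E\<^sub>1\<^sub>2\<close> and \<open>1 + y E\<^sub>2\<^sub>m\<close>, so \<open>\<lambda>\<close> vanishes on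
  \<open>t\<^sup>2F[t]\<close>, and \<open>A \<mapsto> A'(0) A(0)\<^sup>-\<^sup>1\<close> realises the remaining scalar. If \<open>n = 2\<close>, every \<open>\<lambda>\<close> occurs:
  summing \<open>\<lambda>\<close> of the partial quotients along the Euclidean algorithm for the columns of \<open>A\<close>,
  weighted by quadratic functions of the convergents at \<open>t = 0\<close>, gives a cocycle.
\<close>

section \<open>Elementary matrices generate \<open>SL\<^sub>n\<close> over a Euclidean ring\<close>

text \<open>The obstacle is that a cocycle of the abstract group is additive but has no reason to be
  linear over \<open>F\<close>, while rationality only controls \<open>\<rho> g v\<close> for
  constant \<open>g\<close>. Linearity is therefore extracted from conjugation by constant matrices.
  Diagonal ones multiply the parameter \<open>x\<close> by squares \<open>s\<^sup>2\<close>, and an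
  additive function with Laurent polynomial dependence on \<open>s\<close> along such a family is
  linear in characteristic zero. Unipotent ones move \<open>p q\<^sup>T\<close> along a curve whose
  behaviour at infinity bounds its degree by two. For \<open>n = 2\<close> the problem is existence,
  as a matrix is a product of elementary ones in many ways. Summing along the chain of columns of
  smallest degree leaves only constant quotients as an ambiguity, and these are killed once
  \<open>\<lambda>\<close> is extended by zero. What remains is the effect of column operations;
  invariance under the turn from columns \<open>(p, q)\<close> to \<open>(q, - p)\<close> reduces
  operations on the first column to those on the second.\<close>

inductive_set elementary_products :: "nat \<Rightarrow> 'r::comm_ring_1 mat set" for n :: nat where
  one: "1\<^sub>m n \<in> elementary_products n"
| mult: "\<lbrakk>A \<in> elementary_products n; k < n; l < n; k \<noteq> l\<rbrakk>
          \<Longrightarrow> addrow_mat n a k l * A \<in> elementary_products n"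

lemma elementary_products_carrier: "A \<in> elementary_products n \<Longrightarrow> A \<in> carrier_mat n n"
  by (induction rule: elementary_products.induct) auto

lemma elementary_products_mult_right:
  assumes "A \<in> elementary_products n" and kl: "k < n" "l < n" "k \<noteq> l"
  shows "A * addrow_mat n a k l \<in> elementary_products n"
  using assms(1)
proof (induction rule: elementary_products.induct)
  case one
  show ?case using elementary_products.mult[OF elementary_products.one kl, of a] by simp
next
  case (mult A k' l' b)
  have "addrow_mat n b k' l' * A * addrow_mat n a k l = addrow_mat n b k' l' * (A * addrow_mat n a k l)"
    using elementary_products_carrier[OF mult.hyps(1)] by (intro assoc_mult_mat) auto
  then show ?case using elementary_products.mult[OF mult.IH mult.hyps(2-4), of b] by simp
qed

text \<open>Row operations are inverted by operations of the same kind, so membership may be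
  established after applying one; the eliminations below use it in this direction.\<close>

lemma elementary_products_of_addrow:
  assumes A: "A \<in> carrier_mat n n" and kl: "k < n" "l < n" "k \<noteq> l"
    and "addrow a k l A \<in> elementary_products n"
  shows "A \<in> elementary_products n"
proof -
  have "addrow_mat n (- a) k l * addrow a k l A = addrow_mat n (- a) k l * (addrow_mat n (- (- a)) k l * A)"
    by (simp add: addrow_mat[OF A kl(2)])
  also have "\<dots> = addrow_mat n (- a) k l * addrow_mat n (- (- a)) k l * A"
    using A by (intro assoc_mult_mat[symmetric]) auto
  also have "\<dots> = A" using A addrow_mat_inv[OF kl, of "- a"] by simp
  finally show ?thesis using elementary_products.mult[OF assms(5) kl, of "- a"] by simp
qed

lemma elementary_products_of_addcol:
  assumes A: "A \<in> carrier_mat n n" and kl: "k < n" "l < n" "k \<noteq> l"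
    and "addcol a k l A \<in> elementary_products n"
  shows "A \<in> elementary_products n"
proof -
  have "addcol a k l A * addrow_mat n (- a) l k = A * addrow_mat n a l k * addrow_mat n (- a) l k"
    by (simp only: addcol_mat[OF A kl(2)])
  also have "\<dots> = A * (addrow_mat n a l k * addrow_mat n (- a) l k)"
    using A by (intro assoc_mult_mat) auto
  also have "\<dots> = A" using A addrow_mat_inv[OF kl(2,1) kl(3)[symmetric], of a] by simp
  finally show ?thesis
    using elementary_products_mult_right[OF assms(5) kl(2,1) kl(3)[symmetric], of "- a"] by simp
qed

text \<open>The invariant of the elimination: \<open>A\<close> is the block sum of an identity of
  size \<open>k\<close> and a matrix of determinant one.\<close>

definition cleared :: "nat \<Rightarrow> nat \<Rightarrow> 'r::comm_ring_1 mat \<Rightarrow> bool" where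
  "cleared n k A \<longleftrightarrow> A \<in> carrier_mat n n \<and> det A = 1 \<and>
     (\<forall>i<k. \<forall>j<n. A $$ (i, j) = (if i = j then 1 else 0) \<and> A $$ (j, i) = (if i = j then 1 else 0))"

lemma clearedI:
  assumes "A \<in> carrier_mat n n" "det A = 1" "k \<le> n"
    and "\<And>r c. r < k \<or> c < k \<Longrightarrow> r < n \<Longrightarrow> c < n \<Longrightarrow> A $$ (r, c) = (if r = c then 1 else 0)"
  shows "cleared n k A"
  using assms(1-3) by (auto simp: cleared_def assms(4))

lemma cleared_addrow:
  assumes "cleared n k A" "k \<le> i" "i < n" "k \<le> j" "j < n" "i \<noteq> j"
  shows "cleared n k (addrow a i j A)"
proof -
  have A: "A \<in> carrier_mat n n" and d: "det A = 1" using assms by (auto simp: cleared_def)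
  have "det (addrow a i j A) = 1"
    using A d assms by (simp add: addrow_mat[OF A] det_mult[of _ n] det_addrow_mat)
  moreover have E: "addrow a i j A $$ (r, c) = (if r = c then 1 else 0)"
    if "r < k \<or> c < k" "r < n" "c < n" for r c
  proof -
    have rc: "A $$ (r, c) = (if r = c then 1 else 0)" if "r < k \<or> c < k" "r < n" "c < n" for r c
      using assms(1) that by (auto simp: cleared_def)
    show ?thesis using rc[of r c] rc[of j c] that A assms(2-) by auto
  qed
  moreover have "addrow a i j A \<in> carrier_mat n n" using A by simp
  ultimately show ?thesis using assms(2,3) by (intro clearedI) simp_all
qed

lemma cleared_addcol:
  assumes "cleared n k A" "k \<le> i" "i < n" "k \<le> j" "j < n" "i \<noteq> j"
  shows "cleared n k (addcol a i j A)"
proof -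
  have A: "A \<in> carrier_mat n n" and d: "det A = 1" using assms by (auto simp: cleared_def)
  have "det (addcol a i j A) = 1"
    using A d assms by simp
  moreover have E: "addcol a i j A $$ (r, c) = (if r = c then 1 else 0)"
    if "r < k \<or> c < k" "r < n" "c < n" for r c
  proof -
    have rc: "A $$ (r, c) = (if r = c then 1 else 0)" if "r < k \<or> c < k" "r < n" "c < n" for r c
      using assms(1) that by (auto simp: cleared_def)
    show ?thesis using rc[of r c] rc[of r j] that A assms(2-) by auto
  qed
  moreover have "addcol a i j A \<in> carrier_mat n n" using A by (intro carrier_matI) simp_all
  ultimately show ?thesis using assms(2,3) by (intro clearedI) simp_all
qed

text \<open>With pivot 1, each operation kills one entry of column \<open>k\<close> or row
  \<open>k\<close> and leaves the other entries of both unchanged, so the number of nonzero entries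
  off the pivot decreases.\<close>

lemma elementary_products_clear_pivot:
  fixes A :: "'r::comm_ring_1 mat"
  assumes IH: "\<And>B :: 'r mat. cleared n (Suc k) B \<Longrightarrow> B \<in> elementary_products n" and k: "k < n"
  shows "cleared n k A \<Longrightarrow> A $$ (k, k) = 1 \<Longrightarrow> A \<in> elementary_products n"
proof (induction "card {i\<in>{Suc k..<n}. A $$ (i, k) \<noteq> 0} + card {j\<in>{Suc k..<n}. A $$ (k, j) \<noteq> 0}"
    arbitrary: A rule: less_induct)
  case less
  have A: "A \<in> carrier_mat n n" using less.prems by (auto simp: cleared_def)
  show ?case
  proof (cases "\<exists>i\<in>{Suc k..<n}. A $$ (i, k) \<noteq> 0")
    case True
    then obtain i where i: "i \<in> {Suc k..<n}" "A $$ (i, k) \<noteq> 0" by blast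
    let ?B = "addrow (- A $$ (i, k)) i k A"
    have "?B $$ (r, k) \<noteq> 0 \<longleftrightarrow> r \<noteq> i \<and> A $$ (r, k) \<noteq> 0" if "r \<in> {Suc k..<n}" for r
      using i A k less.prems(2) that by simp
    then have "{r\<in>{Suc k..<n}. ?B $$ (r, k) \<noteq> 0} = {i\<in>{Suc k..<n}. A $$ (i, k) \<noteq> 0} - {i}"
      by blast
    then have "{r\<in>{Suc k..<n}. ?B $$ (r, k) \<noteq> 0} \<subset> {i\<in>{Suc k..<n}. A $$ (i, k) \<noteq> 0}"
      using i by blast
    then have "card {r\<in>{Suc k..<n}. ?B $$ (r, k) \<noteq> 0} < card {i\<in>{Suc k..<n}. A $$ (i, k) \<noteq> 0}"
      by (intro psubset_card_mono) auto
    moreover have "{j\<in>{Suc k..<n}. ?B $$ (k, j) \<noteq> 0} = {j\<in>{Suc k..<n}. A $$ (k, j) \<noteq> 0}"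
      using i A k by auto
    ultimately have "?B \<in> elementary_products n"
      using i k A less.prems(2) by (intro less.hyps cleared_addrow[OF less.prems(1)]) simp_all
    from elementary_products_of_addrow[OF A _ _ _ this] show ?thesis using i k A by auto
  next
    case col: False
    show ?thesis
    proof (cases "\<exists>j\<in>{Suc k..<n}. A $$ (k, j) \<noteq> 0")
      case True
      then obtain i where i: "i \<in> {Suc k..<n}" "A $$ (k, i) \<noteq> 0" by blast
      let ?B = "addcol (- A $$ (k, i)) i k A"
      have "?B $$ (k, r) \<noteq> 0 \<longleftrightarrow> r \<noteq> i \<and> A $$ (k, r) \<noteq> 0" if "r \<in> {Suc k..<n}" for r
      using i A k less.prems(2) that by simp
    then have "{r\<in>{Suc k..<n}. ?B $$ (k, r) \<noteq> 0} = {i\<in>{Suc k..<n}. A $$ (k, i) \<noteq> 0} - {i}"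
      by blast
    then have "{r\<in>{Suc k..<n}. ?B $$ (k, r) \<noteq> 0} \<subset> {i\<in>{Suc k..<n}. A $$ (k, i) \<noteq> 0}"
      using i by blast
      then have "card {r\<in>{Suc k..<n}. ?B $$ (k, r) \<noteq> 0} < card {i\<in>{Suc k..<n}. A $$ (k, i) \<noteq> 0}"
        by (intro psubset_card_mono) auto
      moreover have "{j\<in>{Suc k..<n}. ?B $$ (j, k) \<noteq> 0} = {j\<in>{Suc k..<n}. A $$ (j, k) \<noteq> 0}"
        using i A k by auto
      ultimately have "?B \<in> elementary_products n"
        using i k A less.prems(2) by (intro less.hyps cleared_addcol[OF less.prems(1)]) simp_all
      from elementary_products_of_addcol[OF A _ _ _ this] show ?thesis using i k A by auto
    next
      case False
      have "cleared n (Suc k) A"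
        unfolding cleared_def
      proof (intro conjI allI impI)
        show "A \<in> carrier_mat n n" "det A = 1" using less.prems by (auto simp: cleared_def)
        fix i j assume ij: "i < Suc k" "j < n"
        have 1: "i < k \<Longrightarrow> A $$ (i, j) = (if i = j then 1 else 0) \<and> A $$ (j, i) = (if i = j then 1 else 0)"
          using less.prems(1) ij by (auto simp: cleared_def)
        have 2: "j < k \<Longrightarrow> A $$ (j, k) = 0 \<and> A $$ (k, j) = 0"
          using less.prems(1) k by (auto simp: cleared_def)
        have 3: "k < j \<Longrightarrow> A $$ (j, k) = 0 \<and> A $$ (k, j) = 0"
          using False col ij(2) by auto
        consider "i < k" | "i = k" "j < k" | "i = k" "j = k" | "i = k" "k < j" using ij(1) by linarith
        then have "A $$ (i, j) = (if i = j then 1 else 0) \<and> A $$ (j, i) = (if i = j then 1 else 0)"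
          using 1 2 3 less.prems(2) by cases auto
        then show "A $$ (i, j) = (if i = j then 1 else 0)" "A $$ (j, i) = (if i = j then 1 else 0)" by auto
      qed
      then show ?thesis by (rule IH)
    qed
  qed
qed

text \<open>The measure is the total Euclidean size of the column \<open>k\<close>; Euclidean division of one nonzero
  entry by another decreases it.\<close>

lemma elementary_products_euclid:
  fixes A :: "'r::euclidean_ring mat"
  assumes IH: "\<And>B :: 'r mat. cleared n (Suc k) B \<Longrightarrow> B \<in> elementary_products n" and k: "Suc k < n"
  shows "cleared n k A \<Longrightarrow> A \<in> elementary_products n"
proof (induction "\<Sum>i\<in>{k..<n}. if A $$ (i, k) = 0 then 0 else Suc (euclidean_size (A $$ (i, k)))"
    arbitrary: A rule: less_induct)
  case less
  have A: "A \<in> carrier_mat n n" using less.prems by (auto simp: cleared_def)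
  note pivot = elementary_products_clear_pivot[OF IH Suc_lessD[OF k]]
  show ?case
  proof (cases "\<exists>i\<in>{k..<n}. \<exists>j\<in>{k..<n}. i \<noteq> j \<and> A $$ (i, k) \<noteq> 0 \<and> A $$ (j, k) \<noteq> 0")
    case True
    then obtain i j where ij: "i \<in> {k..<n}" "j \<in> {k..<n}" "i \<noteq> j" "A $$ (i, k) \<noteq> 0" "A $$ (j, k) \<noteq> 0"
      and le: "euclidean_size (A $$ (i, k)) \<le> euclidean_size (A $$ (j, k))"
      by (metis nle_le)
    let ?q = "A $$ (j, k) div A $$ (i, k)"
    let ?B = "addrow (- ?q) j i A"
    let ?s = "\<lambda>A i. if A $$ (i, k) = 0 then 0 else Suc (euclidean_size (A $$ (i, k)))"
    have Bj: "?B $$ (j, k) = A $$ (j, k) mod A $$ (i, k)"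
      using ij A k by (simp add: minus_div_mult_eq_mod[symmetric])
    have "sum (?s ?B) {k..<n} < sum (?s A) {k..<n}"
    proof (rule sum_strict_mono_ex1)
      show "\<forall>r\<in>{k..<n}. ?s ?B r \<le> ?s A r"
      proof
        fix r assume r: "r \<in> {k..<n}"
        show "?s ?B r \<le> ?s A r"
        proof (cases "r = j")
          case True
          then show ?thesis using Bj ij le mod_size_less[of "A $$ (i, k)" "A $$ (j, k)"] by simp
        next
          case False
          then show ?thesis using r A k by simp
        qed
      qed
      show "\<exists>r\<in>{k..<n}. ?s ?B r < ?s A r"
        using Bj ij le mod_size_less[of "A $$ (i, k)" "A $$ (j, k)"] by (intro bexI[of _ j]) auto
    qed simp
    then have "?B \<in> elementary_products n"
      using ij k A by (intro less.hyps cleared_addrow[OF less.prems]) simp_all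
    from elementary_products_of_addrow[OF A _ _ _ this] show ?thesis using ij k A by auto
  next
    case False
    \<comment> \<open>At most one entry of column \<open>k\<close> is nonzero now. The
      \<open>(k, k)\<close> entry of \<open>adj_mat A * A\<close> equals \<open>det A = 1\<close>
      and exhibits that entry as a unit with inverse \<open>v\<close>.\<close>
    have "(adj_mat A * A) $$ (k, k) = 1"
      using adj_mat(3)[OF A] less.prems k by (simp add: cleared_def)
    then have sum1: "(\<Sum>i\<in>{0..<n}. adj_mat A $$ (k, i) * A $$ (i, k)) = 1"
      using A adj_mat(1)[OF A] k by (simp add: scalar_prod_def)
    have zero: "A $$ (i, k) = 0" if "i < k" for i
      using less.prems that k by (auto simp: cleared_def)
    have "\<exists>i\<in>{k..<n}. A $$ (i, k) \<noteq> 0"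
    proof (rule ccontr)
      assume "\<not> ?thesis"
      then have "(\<Sum>i\<in>{0..<n}. adj_mat A $$ (k, i) * A $$ (i, k)) = 0"
        using zero by (intro sum.neutral ballI) (metis atLeastLessThan_iff linorder_not_less mult_zero_right)
      then show False using sum1 by simp
    qed
    then obtain i where i: "i \<in> {k..<n}" "A $$ (i, k) \<noteq> 0" by blast
    then have other: "A $$ (j, k) = 0" if "j < n" "j \<noteq> i" for j
      using False zero that by (metis atLeastLessThan_iff linorder_not_less)
    have "(\<Sum>i\<in>{0..<n}. adj_mat A $$ (k, i) * A $$ (i, k)) = (\<Sum>j\<in>{i}. adj_mat A $$ (k, j) * A $$ (j, k))"
      using i other by (intro sum.mono_neutral_right) auto
    then obtain v where v: "v * A $$ (i, k) = 1" using sum1 by auto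
    show ?thesis
    proof (cases "i = k")
      case False
      have "addrow v k i A \<in> elementary_products n"
        using False i k A v other[of k] by (intro pivot cleared_addrow[OF less.prems]) simp_all
      from elementary_products_of_addrow[OF A _ _ _ this] show ?thesis using False i k A by auto
    next
      case True
      \<comment> \<open>A unit \<open>u\<close> at the pivot cannot be rescaled directly. The row
        below receives \<open>v u = 1\<close> in column \<open>k\<close>, and adding
        \<open>1 - u\<close> times that row turns \<open>u\<close> into 1; this is where
        \<open>Suc k < n\<close> enters.\<close>
      let ?B = "addrow v (Suc k) k A"
      let ?C = "addrow (1 - A $$ (k, k)) k (Suc k) ?B"
      have B: "cleared n k ?B" using k by (intro cleared_addrow[OF less.prems]) simp_all
      then have Bc: "?B \<in> carrier_mat n n" by (auto simp: cleared_def)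
      have "?C \<in> elementary_products n"
      proof (rule pivot)
        show "cleared n k ?C" by (rule cleared_addrow[OF B]) (use k in auto)
        have "?B $$ (Suc k, k) = v * A $$ (k, k) + A $$ (Suc k, k)" "?B $$ (k, k) = A $$ (k, k)"
          using k A by auto
        moreover have "A $$ (Suc k, k) = 0" using other[of "Suc k"] k True by auto
        moreover have "?C $$ (k, k) = (1 - A $$ (k, k)) * ?B $$ (Suc k, k) + ?B $$ (k, k)"
          using k A by auto
        ultimately show "?C $$ (k, k) = 1" using v unfolding True by simp
      qed
      from elementary_products_of_addrow[OF Bc _ _ _ this] have "?B \<in> elementary_products n" using k by auto
      from elementary_products_of_addrow[OF A _ _ _ this] show ?thesis using k by auto
    qed
  qed
qed

lemma elementary_products_cleared:
  assumes "k \<le> n" "cleared n k (A :: 'r::euclidean_ring mat)"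
  shows "A \<in> elementary_products n"
  using assms
proof (induction arbitrary: A rule: inc_induct)
  case base
  then have "A = 1\<^sub>m n" by (intro eq_matI) (auto simp: cleared_def)
  then show ?case by (simp add: elementary_products.one)
next
  case (step k)
  show ?case
  proof (cases "Suc k < n")
    case True
    then show ?thesis using elementary_products_euclid[OF step.IH _ step.prems] by blast
  next
    case False
    then have k: "n = Suc k" using step.hyps by simp
    have A: "A \<in> carrier_mat n n" and d: "det A = 1"
      and e: "i < k \<or> j < k \<Longrightarrow> i < n \<Longrightarrow> j < n \<Longrightarrow> A $$ (i, j) = (if i = j then 1 else 0)" for i j
      using step.prems by (auto simp: cleared_def)
    have "det A = prod_list (diag_mat A)"
      by (rule det_upper_triangular[OF _ A]) (use A e k in \<open>auto intro!: upper_triangularI\<close>)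
    also have "\<dots> = (\<Prod>i\<in>{0..<n}. A $$ (i, i))" using A by (simp add: prod_list_diag_prod)
    also have "\<dots> = A $$ (k, k)" using e k by simp
    finally have "cleared n (Suc k) A" unfolding cleared_def
      using A d e k by (auto simp: less_Suc_eq)
    then show ?thesis by (rule step.IH)
  qed
qed

lemma SL_elementary_products:
  "(A :: 'r::euclidean_ring mat) \<in> carrier (SL n) \<Longrightarrow> A \<in> elementary_products n"
  using elementary_products_cleared[of 0 n A] by (simp add: cleared_def SL_def)

section \<open>Sums along the Euclidean algorithm for polynomials\<close>

type_synonym 'a pvec = "'a poly \<times> 'a poly"

definition pdet :: "'a::field pvec \<Rightarrow> 'a pvec \<Rightarrow> 'a poly" where
  "pdet p q = fst p * snd q - fst q * snd p"

definition pdeg :: "'a::field pvec \<Rightarrow> nat" where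
  "pdeg p = max (degree (fst p)) (degree (snd p))"

definition paxpy :: "'a::field poly \<Rightarrow> 'a pvec \<Rightarrow> 'a pvec \<Rightarrow> 'a pvec" where
  "paxpy f p q = (fst q + f * fst p, snd q + f * snd p)"

definition pscale :: "'a::field \<Rightarrow> 'a pvec \<Rightarrow> 'a pvec" where
  "pscale a p = (Polynomial.smult a (fst p), Polynomial.smult a (snd p))"

text \<open>The columns of a matrix in \<open>SL\<^sub>2(F[t])\<close> are pairs \<open>p\<close>, \<open>q\<close> with \<open>pdet p q = 1\<close>. If \<open>p\<close> is not
  constant, its partner of smaller degree, the previous convergent, is unique.\<close>

definition parent_of :: "'a::field pvec \<Rightarrow> 'a pvec \<Rightarrow> bool" where
  "parent_of p q \<longleftrightarrow> pdet p q = 1 \<and> (if pdeg p = 0 then pdeg q = 0 else pdeg q < pdeg p)"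

lemma pdet_self: "pdet p p = 0" by (simp add: pdet_def)

lemma pdet_commute: "pdet q p = - pdet p q" by (simp add: pdet_def)

lemma pdet_pscale: "pdet (pscale a p) (pscale b q) = Polynomial.smult (a * b) (pdet p q)"
  by (simp add: pdet_def pscale_def smult_diff_right mult.commute)

lemma pdet_paxpy_right: "pdet p (paxpy f p q) = pdet p q"
  by (simp add: pdet_def paxpy_def algebra_simps)

lemma pdet_paxpy_left: "pdet (paxpy f p q) r = pdet q r + f * pdet p r"
  by (simp add: pdet_def paxpy_def algebra_simps)

lemma pdeg_pscale: "a \<noteq> 0 \<Longrightarrow> pdeg (pscale a p) = pdeg p"
  by (simp add: pdeg_def pscale_def)

lemma pscale_1 [simp]: "pscale 1 p = p" by (simp add: pscale_def)

lemma pscale_pscale: "pscale a (pscale b p) = pscale (a * b) p"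
  by (simp add: pscale_def)

lemma paxpy_0 [simp]: "paxpy 0 p q = q" by (simp add: paxpy_def)

lemma pdeg_le: "pdeg p \<le> m \<longleftrightarrow> degree (fst p) \<le> m \<and> degree (snd p) \<le> m"
  by (simp add: pdeg_def)

lemma pdeg_less: "m > 0 \<Longrightarrow> pdeg p < m \<longleftrightarrow> pdeg p \<le> m \<and> coeff (fst p) m = 0 \<and> coeff (snd p) m = 0"
proof -
  assume m: "m > 0"
  have "degree f < m \<longleftrightarrow> degree f \<le> m \<and> coeff f m = 0" for f :: "'a poly"
    using m by (metis coeff_eq_0 degree_0 le_neq_implies_less leading_coeff_0_iff less_imp_le)
  then show ?thesis unfolding pdeg_def by auto
qed

text \<open>Cramer's rule: columns \<open>p\<close>, \<open>q\<close> of determinant 1 form a basis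
  of \<open>F[t]^2\<close>, in which \<open>r\<close> has the coordinates \<open>pdet r q\<close>
  and \<open>pdet p r\<close>.\<close>

lemma basis_decomposition:
  assumes "pdet p q = 1"
  shows "r = paxpy (pdet r q) p (fst q * pdet p r, snd q * pdet p r)"
proof -
  have "fst r = fst r * (fst p * snd q - fst q * snd p)" "snd r = snd r * (fst p * snd q - fst q * snd p)"
    using assms by (simp_all add: pdet_def)
  then show ?thesis by (intro prod_eqI) (simp_all add: paxpy_def pdet_def algebra_simps)
qed

lemma basis_decomposition_1:
  assumes "pdet p q = 1" "pdet p r = 1"
  shows "r = paxpy (pdet r q) p q"
  using basis_decomposition[OF assms(1), of r] assms(2) by simp

lemma pdeg_mult:
  assumes "f \<noteq> 0" "p \<noteq> (0, 0)"
  shows "pdeg (f * fst p, f * snd p) = degree f + pdeg p"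
proof -
  obtain a b where p: "p = (a, b)" by (cases p)
  then show ?thesis using assms
    by (cases "a = 0"; cases "b = 0") (simp_all add: pdeg_def degree_mult_eq max_def)
qed

text \<open>Two partners differ by \<open>f p\<close> for a polynomial \<open>f\<close>, and for
  nonzero \<open>f\<close> the degree \<open>degree f + pdeg p\<close> is bounded by those of the
  partners. If \<open>p\<close> is not constant this leaves only \<open>f = 0\<close>; otherwise
  \<open>f\<close> is a constant.\<close>

lemma parent_of_const_unique:
  assumes "parent_of p q" "parent_of p r"
  shows "\<exists>s. r = paxpy [:s:] p q \<and> (pdeg p \<noteq> 0 \<longrightarrow> s = 0)"
proof -
  let ?f = "pdet r q"
  have r: "r = paxpy ?f p q" using assms by (intro basis_decomposition_1) (auto simp: parent_of_def)
  have p: "p \<noteq> (0, 0)" using assms(1) by (auto simp: parent_of_def pdet_def)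
  have d: "(?f * fst p, ?f * snd p) = (fst r - fst q, snd r - snd q)"
    using r by (simp add: paxpy_def prod_eq_iff)
  have le: "pdeg (fst r - fst q, snd r - snd q) \<le> max (pdeg r) (pdeg q)"
    unfolding pdeg_def by (auto intro: degree_diff_le)
  show ?thesis
  proof (cases "?f = 0")
    case True
    then show ?thesis using r by (intro exI[of _ 0]) (simp add: True)
  next
    case False
    have "degree ?f + pdeg p \<le> max (pdeg r) (pdeg q)"
      using pdeg_mult[OF False p] le d by metis
    then have "pdeg p = 0" "degree ?f = 0"
      using assms by (auto simp: parent_of_def split: if_splits)
    then show ?thesis using r by (metis degree_eq_zeroE)
  qed
qed

lemma parent_of_unique: "parent_of p q \<Longrightarrow> parent_of p r \<Longrightarrow> pdeg p \<noteq> 0 \<Longrightarrow> r = q"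
  using parent_of_const_unique[of p q r] by auto

text \<open>For nonconstant \<open>p\<close> a partner \<open>r\<close> of least degree works. If
  its degree were at least \<open>pdeg p\<close>, the top coefficient of \<open>pdet p r = 1\<close>
  would vanish, so the leading coefficient vectors would be proportional and a monomial multiple of
  \<open>p\<close> could be subtracted to lower the degree.\<close>

lemma parent_of_exists:
  assumes "pdet p q = 1"
  shows "\<exists>r. parent_of p r"
proof (cases "pdeg p = 0")
  case True
  then obtain a c where p: "p = ([:a:], [:c:])"
    by (cases p) (auto simp: pdeg_def elim!: degree_eq_zeroE)
  then have "a \<noteq> 0 \<or> c \<noteq> 0" using assms by (auto simp: pdet_def)
  then show ?thesis
  proof
    assume "a \<noteq> 0"
    then show ?thesis using True p
      by (intro exI[of _ "(0, [:inverse a:])"]) (simp add: parent_of_def pdet_def pdeg_def one_pCons)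
  next
    assume "c \<noteq> 0"
    then show ?thesis using True p
      by (intro exI[of _ "([:- inverse c:], 0)"]) (simp add: parent_of_def pdet_def pdeg_def one_pCons)
  qed
next
  case False
  obtain r where r: "pdet p r = 1" and min: "\<And>s. pdet p s = 1 \<Longrightarrow> pdeg r \<le> pdeg s"
    using ex_has_least_nat[of "\<lambda>r. pdet p r = 1" q pdeg] assms by blast
  have "pdeg r < pdeg p"
  proof (rule ccontr)
    assume ge: "\<not> pdeg r < pdeg p"
    let ?m = "pdeg p" and ?M = "pdeg r"
    have dp: "degree (fst p) \<le> ?m" "degree (snd p) \<le> ?m" and dr: "degree (fst r) \<le> ?M" "degree (snd r) \<le> ?M"
      using pdeg_le[of p ?m] pdeg_le[of r ?M] by auto
    \<comment> \<open>The ratio of the leading coefficient vectors of \<open>r\<close> and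
      \<open>p\<close>, read off in a component where that of \<open>p\<close> does not
      vanish.\<close>
    define s where "s = (if coeff (fst p) ?m \<noteq> 0 then coeff (fst r) ?M / coeff (fst p) ?m
                          else coeff (snd r) ?M / coeff (snd p) ?m)"
    have top: "coeff (x * y) (?m + ?M) = coeff x ?m * coeff y ?M"
      if x: "degree x \<le> ?m" and y: "degree y \<le> ?M" for x y :: "'a poly"
    proof (cases "degree x = ?m \<and> degree y = ?M")
      case True
      then show ?thesis using coeff_mult_degree_sum[of x y] by simp
    next
      case False
      then have "degree x + degree y < ?m + ?M" using x y by linarith
      then have "coeff (x * y) (?m + ?M) = 0"
        by (intro coeff_eq_0) (use degree_mult_le[of x y] in linarith)
      moreover have "coeff x ?m = 0 \<or> coeff y ?M = 0"
        using False x y by (metis coeff_eq_0 le_neq_implies_less)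
      ultimately show ?thesis by auto
    qed
    have "coeff (pdet p r) (?m + ?M) = 0" using r False by simp
    then have lead: "coeff (fst p) ?m * coeff (snd r) ?M = coeff (snd p) ?m * coeff (fst r) ?M"
      using dp dr top[of "fst p" "snd r"] top[of "snd p" "fst r"] by (simp add: pdet_def mult.commute)
    have "coeff (fst p) ?m \<noteq> 0 \<or> coeff (snd p) ?m \<noteq> 0"
      using pdeg_less[of ?m p] False by auto
    then have s: "coeff (fst r) ?M = s * coeff (fst p) ?m" "coeff (snd r) ?M = s * coeff (snd p) ?m"
      using lead by (auto simp: s_def field_simps)
    let ?r = "paxpy (monom (- s) (?M - ?m)) p r"
    have cf: "coeff (monom (- s) (?M - ?m) * x) ?M = - s * coeff x ?m" for x
      using ge by (simp add: coeff_monom_mult)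
    have dg: "degree (monom (- s) (?M - ?m) * x) \<le> ?M" if "degree x \<le> ?m" for x
      using degree_mult_le[of "monom (- s) (?M - ?m)" x] degree_monom_le[of "- s" "?M - ?m"] that ge by linarith
    have "pdeg ?r < ?M"
      using False ge s cf dp dr dg
      by (subst pdeg_less) (auto simp: paxpy_def pdeg_le intro!: degree_add_le)
    moreover have "?M \<le> pdeg ?r" by (rule min) (simp add: pdet_paxpy_right r)
    ultimately show False by simp
  qed
  then show ?thesis using r False by (intro exI[of _ r]) (simp add: parent_of_def)
qed

lemma parent_of_pscale:
  assumes "parent_of p q" "a \<noteq> 0"
  shows "parent_of (pscale a p) (pscale (inverse a) q)"
  using assms by (simp add: parent_of_def pdet_pscale pdeg_pscale)

definition parent :: "'a::field pvec \<Rightarrow> 'a pvec" where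
  "parent p = (SOME q. parent_of p q)"

lemma parent_of_parent: "pdet p q = 1 \<Longrightarrow> parent_of p (parent p)"
  unfolding parent_def by (rule someI_ex) (rule parent_of_exists)

lemma parent_eqI: "parent_of p q \<Longrightarrow> pdeg p \<noteq> 0 \<Longrightarrow> parent p = q"
  using parent_of_unique[of p q "parent p"] parent_of_parent[of p q] by (auto simp: parent_of_def)

section \<open>Sums over chains of partners\<close>

definition ev0 :: "'a::field pvec \<Rightarrow> 'a \<times> 'a" where
  "ev0 p = (poly (fst p) 0, poly (snd p) 0)"

text \<open>The partner of a constant \<open>p\<close> is unique only up to constant multiples of \<open>p\<close>, which \<open>ell\<close> kills.\<close>

locale farey_cocycle =
  fixes ell :: "'a::field poly \<Rightarrow> 'a" and P :: "'a \<times> 'a \<Rightarrow> 'a"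
  assumes ell_add: "ell (f + g) = ell f + ell g"
    and ell_smult: "ell (Polynomial.smult a f) = a * ell f"
    and ell_const: "ell [:a:] = 0"
    and P_scale: "P (a * x, a * y) = a\<^sup>2 * P (x, y)"
begin

text \<open>Let \<open>q\<close> be the parent of \<open>p\<close> and \<open>r\<close> that of
  \<open>q\<close>. By Cramer's rule \<open>- p = f q + r\<close>, where \<open>f\<close> is the
  determinant of \<open>- p\<close> and \<open>r\<close>. So \<open>f\<close> is a partial quotient
  of the Euclidean algorithm, and \<open>ell f\<close> is weighted by \<open>P\<close> at the column
  \<open>q\<close> that \<open>f\<close> multiplies. The value 0 for columns without a partner is a
  default.\<close>

function path_sum :: "'a pvec \<Rightarrow> 'a" where
  "path_sum p = (if pdeg p = 0 \<or> (\<nexists>q. pdet p q = 1) then 0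
     else path_sum (parent p) + ell (pdet (pscale (- 1) p) (parent (parent p))) * P (ev0 (parent p)))"
  by auto
termination
proof (relation "measure pdeg")
  fix p :: "'a pvec" assume "\<not> (pdeg p = 0 \<or> (\<nexists>q. pdet p q = 1))"
  then show "(parent p, p) \<in> measure pdeg"
    using parent_of_parent[of p] by (auto simp: parent_of_def)
qed simp

declare path_sum.simps [simp del]

text \<open>The sum for the matrix with columns \<open>p\<close>, \<open>q\<close>: the last step
  \<open>q = f p + parent p\<close> contributes its quotient \<open>f = pdet q (parent p)\<close>.
  Pairs of determinant 1 are the edges of a graph on columns, an analogue of the Farey
  graph.\<close>

definition edge_sum :: "'a pvec \<Rightarrow> 'a pvec \<Rightarrow> 'a" where
  "edge_sum p q = path_sum p + ell (pdet q (parent p)) * P (ev0 p)"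

lemma ell_0: "ell 0 = 0" using ell_const[of 0] by simp

lemma ell_minus: "ell (- f) = - ell f" using ell_smult[of "- 1" f] by simp

lemma path_sum_const: "pdeg p = 0 \<Longrightarrow> path_sum p = 0" by (simp add: path_sum.simps)

lemma P_ev0_pscale: "P (ev0 (pscale a p)) = a\<^sup>2 * P (ev0 p)"
  by (simp add: ev0_def pscale_def P_scale)

text \<open>Independence of the choice made in \<open>parent\<close>: two partners differ by a
  constant multiple of \<open>p\<close>, which changes the quotient by a constant, and
  \<open>ell\<close> kills constants.\<close>

lemma edge_sum_parent_of:
  assumes "parent_of p r" "pdet p q = 1"
  shows "edge_sum p q = path_sum p + ell (pdet q r) * P (ev0 p)"
proof -
  obtain s where s: "parent p = paxpy [:s:] p r"
    using parent_of_const_unique[OF assms(1) parent_of_parent[OF assms(2)]] by blast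
  have "pdet q (parent p) = - pdet (paxpy [:s:] p r) q" unfolding s by (rule pdet_commute)
  also have "\<dots> = pdet q r + [:- s:]"
    using assms(2) by (simp add: pdet_paxpy_left pdet_commute[of r q])
  finally show ?thesis by (simp add: edge_sum_def ell_add ell_const)
qed

text \<open>The recursion seen as a turn of edges: descending from \<open>p\<close> to its partner
  \<open>q\<close> replaces \<open>(p, q)\<close> by \<open>(q, - p)\<close>, again of determinant
  1.\<close>

lemma path_sum_parent:
  assumes "parent_of p q" "pdeg p \<noteq> 0"
  shows "path_sum p = edge_sum q (pscale (- 1) p)"
proof -
  have "\<exists>q. pdet p q = 1" using assms(1) unfolding parent_of_def by blast
  then show ?thesis
    using assms(2) by (subst path_sum.simps) (simp add: parent_eqI[OF assms] edge_sum_def)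
qed

text \<open>Scaling the columns by \<open>a\<close> and \<open>inverse a\<close> multiplies the last
  quotient by \<open>a^-2\<close> and the weight by \<open>a^2\<close>. This balance is the reason
  for the degree two in \<open>P_scale\<close>.\<close>

lemma edge_sum_pscale_aux:
  assumes "path_sum (pscale a p) = path_sum p" "pdet p q = 1" "a \<noteq> 0"
  shows "edge_sum (pscale a p) (pscale (inverse a) q) = edge_sum p q"
proof -
  note pr = parent_of_parent[OF assms(2)]
  have "edge_sum (pscale a p) (pscale (inverse a) q)
      = path_sum p + ell (pdet (pscale (inverse a) q) (pscale (inverse a) (parent p))) * P (ev0 (pscale a p))"
    using edge_sum_parent_of[OF parent_of_pscale[OF pr assms(3)], of "pscale (inverse a) q"] assms
    by (simp add: pdet_pscale)
  also have "\<dots> = edge_sum p q"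
    using assms(3) by (simp add: pdet_pscale ell_smult P_ev0_pscale edge_sum_def power2_eq_square field_simps)
  finally show ?thesis .
qed

lemma path_sum_pscale: "a \<noteq> 0 \<Longrightarrow> pdet p q = 1 \<Longrightarrow> path_sum (pscale a p) = path_sum p"
proof (induction "pdeg p" arbitrary: p q a rule: less_induct)
  case less
  show ?case
  proof (cases "pdeg p = 0")
    case True
    then show ?thesis using less.prems by (simp add: path_sum_const pdeg_pscale)
  next
    case False
    note pr = parent_of_parent[OF less.prems(2)]
    have d: "pdet (parent p) (pscale (- 1) p) = 1" "pdeg (parent p) < pdeg p"
      using pr False pdet_pscale[of 1 "parent p" "- 1" p] by (auto simp: parent_of_def pdet_commute[of "parent p" p])
    have "path_sum (pscale a p) = edge_sum (pscale (inverse a) (parent p)) (pscale (- 1) (pscale a p))"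
      by (rule path_sum_parent[OF parent_of_pscale[OF pr less.prems(1)]]) (simp add: pdeg_pscale less.prems False)

    also have "pscale (- 1) (pscale a p) = pscale (inverse (inverse a)) (pscale (- 1) p)"
      by (simp add: pscale_pscale)
    also have "edge_sum (pscale (inverse a) (parent p)) (pscale (inverse (inverse a)) (pscale (- 1) p))
        = edge_sum (parent p) (pscale (- 1) p)"
      using less.prems(1) d by (intro edge_sum_pscale_aux less.hyps[OF d(2) _ d(1)]) auto
    also have "\<dots> = path_sum p" by (rule path_sum_parent[OF pr False, symmetric])
    finally show ?thesis .
  qed
qed

lemma edge_sum_pscale:
  "pdet p q = 1 \<Longrightarrow> a \<noteq> 0 \<Longrightarrow> edge_sum (pscale a p) (pscale (inverse a) q) = edge_sum p q"
  by (rule edge_sum_pscale_aux) (auto intro: path_sum_pscale)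

lemma edge_sum_paxpy: "pdet p q = 1 \<Longrightarrow> edge_sum p (paxpy f p q) = edge_sum p q + ell f * P (ev0 p)"
  using parent_of_parent[of p q]
  by (simp add: edge_sum_def pdet_paxpy_left parent_of_def ell_add distrib_right)

lemma edge_sum_of_parent: "parent_of p q \<Longrightarrow> edge_sum p q = path_sum p"
  by (subst edge_sum_parent_of[of p q]) (auto simp: parent_of_def pdet_self ell_0)

lemma edge_sum_const: "pdeg p = 0 \<Longrightarrow> pdeg q = 0 \<Longrightarrow> pdet p q = 1 \<Longrightarrow> edge_sum p q = 0"
  by (subst edge_sum_of_parent) (auto simp: parent_of_def path_sum_const)

text \<open>Passing from columns \<open>p\<close>, \<open>q\<close> to \<open>q\<close>,
  \<open>- p\<close> is right multiplication by a constant matrix, on which the cocycle has to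
  vanish. If the degrees differ, one column is the partner of the other up to sign and the claim is
  the recursion; equal positive degrees are the case with content.\<close>

lemma edge_sum_swap:
  assumes pq: "pdet p q = 1"
  shows "edge_sum q (pscale (- 1) p) = edge_sum p q"
proof -
  have qp: "pdet q (pscale (- 1) p) = 1"
    using pq pdet_pscale[of 1 q "- 1" p] by (simp add: pdet_commute[of q p])
  consider "pdeg q < pdeg p" | "pdeg p < pdeg q" | "pdeg p = 0" "pdeg q = 0" | "pdeg p = pdeg q" "pdeg p \<noteq> 0"
    by linarith
  then show ?thesis
  proof cases
    case 1
    then have "parent_of p q" "pdeg p \<noteq> 0" using pq by (auto simp: parent_of_def)
    then show ?thesis by (simp add: edge_sum_of_parent path_sum_parent)
  next
    case 2
    then have *: "parent_of q (pscale (- 1) p)" "pdeg q \<noteq> 0"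
      using qp by (auto simp: parent_of_def pdeg_pscale)
    then have "edge_sum q (pscale (- 1) p) = edge_sum (pscale (- 1) p) (pscale (- 1) q)"
      by (simp add: edge_sum_of_parent path_sum_parent)
    then show ?thesis using edge_sum_pscale[OF pq, of "- 1"] by simp
  next
    case 3
    then show ?thesis using pq qp by (simp add: edge_sum_const pdeg_pscale)
  next
    case 4
    \<comment> \<open>Here \<open>q = a p + r\<close> with a nonzero constant \<open>a\<close>, so
      \<open>inverse a\<close> times \<open>r\<close> is the partner of \<open>q\<close>: both
      columns descend to the same \<open>r\<close> up to scaling.\<close>
    let ?r = "parent p"
    note pr = parent_of_parent[OF pq]
    have r: "pdeg ?r < pdeg p" "pdet p ?r = 1" using pr 4 by (auto simp: parent_of_def)
    have q: "q = paxpy (pdet q ?r) p ?r" by (rule basis_decomposition_1[OF r(2) pq])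
    have p0: "p \<noteq> (0, 0)" using pq by (auto simp: pdet_def)
    have f0: "pdet q ?r \<noteq> 0"
    proof
      assume "pdet q ?r = 0"
      then have "q = ?r" using q by (simp add: paxpy_def)
      then show False using r 4 by simp
    qed
    have "pdeg (pdet q ?r * fst p, pdet q ?r * snd p) \<le> pdeg p"
    proof -
      have "(pdet q ?r * fst p, pdet q ?r * snd p) = (fst q - fst ?r, snd q - snd ?r)"
        using arg_cong[OF q, of fst] arg_cong[OF q, of snd] by (simp add: paxpy_def)
      moreover have "pdeg (fst q - fst ?r, snd q - snd ?r) \<le> max (pdeg q) (pdeg ?r)"
        unfolding pdeg_def by (auto intro: degree_diff_le)
      ultimately show ?thesis using r 4 by simp
    qed
    then have "degree (pdet q ?r) = 0" using pdeg_mult[OF f0 p0] by simp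
    then obtain a where a: "pdet q ?r = [:a:]" "a \<noteq> 0" using f0 by (metis degree_eq_zeroE pCons_0_0)
    have par: "parent_of q (pscale (inverse a) ?r)"
      using a r 4 pdet_pscale[of 1 q "inverse a" ?r] by (simp add: parent_of_def pdeg_pscale one_pCons)
    have rp: "pdet ?r (pscale (- 1) p) = 1"
      using r(2) pdet_pscale[of 1 ?r "- 1" p] by (simp add: pdet_commute[of ?r p])
    \<comment> \<open>\<open>- q = a (- p - r / a)\<close>: up to scaling, the edges from
      \<open>r\<close> to \<open>- q\<close> and to \<open>- p\<close> differ by a constant
      quotient, which \<open>ell\<close> does not see.\<close>
    have eq: "pscale (- 1) q = pscale a (paxpy [:- inverse a:] ?r (pscale (- 1) p))"
      unfolding arg_cong[OF q, of "pscale (- 1)"] a(1) using a(2)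
      by (simp add: pscale_def paxpy_def smult_add_right smult_diff_right)
    have "edge_sum q (pscale (- 1) p)
        = path_sum q + ell (pdet (pscale (- 1) p) (pscale (inverse a) ?r)) * P (ev0 q)"
      by (rule edge_sum_parent_of[OF par qp])
    also have "pdet (pscale (- 1) p) (pscale (inverse a) ?r) = [:- inverse a:]"
      by (simp add: pdet_pscale r(2) one_pCons)
    also have "path_sum q = edge_sum (pscale (inverse a) ?r) (pscale (- 1) q)"
      using 4 by (intro path_sum_parent[OF par]) simp
    also have "\<dots> = edge_sum ?r (paxpy [:- inverse a:] ?r (pscale (- 1) p))"
      using edge_sum_pscale[of ?r "paxpy [:- inverse a:] ?r (pscale (- 1) p)" "inverse a"] rp a(2)
      unfolding eq by (simp add: pdet_paxpy_right)
    also have "\<dots> = edge_sum ?r (pscale (- 1) p)" using rp by (simp add: edge_sum_paxpy ell_const)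
    also have "\<dots> = path_sum p" using path_sum_parent[OF pr] 4 by simp
    also have "path_sum p + ell [:- inverse a:] * P (ev0 q) = edge_sum p q"
      by (simp add: edge_sum_def a(1) ell_const)
    finally show ?thesis .
  qed
qed

text \<open>The turn from \<open>(p, q)\<close> to \<open>(q, - p)\<close> carries an operation on
  the first column to one on the second and changes \<open>f\<close> into
  \<open>- f\<close>.\<close>

lemma edge_sum_paxpy_left:
  assumes "pdet p q = 1"
  shows "edge_sum (paxpy f q p) q = edge_sum p q - ell f * P (ev0 q)"
proof -
  have 1: "pdet (paxpy f q p) q = 1" using assms by (simp add: pdet_paxpy_left pdet_self)
  have qp: "pdet q (pscale (- 1) p) = 1"
    using assms pdet_pscale[of 1 q "- 1" p] by (simp add: pdet_commute[of q p])
  have "edge_sum (paxpy f q p) q = edge_sum q (pscale (- 1) (paxpy f q p))"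
    by (rule edge_sum_swap[OF 1, symmetric])
  also have "pscale (- 1) (paxpy f q p) = paxpy (- f) q (pscale (- 1) p)"
    by (simp add: pscale_def paxpy_def)
  finally show ?thesis using edge_sum_paxpy[OF qp, of "- f"] edge_sum_swap[OF assms] by (simp add: ell_minus)
qed

end

section \<open>The cocycle of \<open>SL\<^sub>2(F[t])\<close> attached to a functional\<close>

lemma mat_2_eqI:
  assumes "A \<in> carrier_mat 2 2" "B \<in> carrier_mat 2 2"
    "A $$ (0, 0) = B $$ (0, 0)" "A $$ (0, 1) = B $$ (0, 1)" "A $$ (1, 0) = B $$ (1, 0)" "A $$ (1, 1) = B $$ (1, 1)"
  shows "A = B"
  using assms by (intro eq_matI) (auto simp: less_2_cases_iff)

lemma index_mult_mat_2:
  assumes "A \<in> carrier_mat 2 2" "B \<in> carrier_mat 2 2" "i < 2" "j < 2"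
  shows "(A * B) $$ (i, j) = A $$ (i, 0) * B $$ (0, j) + A $$ (i, 1) * B $$ (1, j)"
  using assms by (simp add: scalar_prod_def numeral_2_eq_2)

lemma det_2:
  assumes A: "(A :: 'r::comm_ring_1 mat) \<in> carrier_mat 2 2"
  shows "det A = A $$ (0, 0) * A $$ (1, 1) - A $$ (0, 1) * A $$ (1, 0)"
proof -
  have s: "det (mat (Suc 0) (Suc 0) f) = f (0, 0)" for f :: "nat \<times> nat \<Rightarrow> 'r"
    by (subst det_single) auto
  have "det A = (\<Sum>i<2. A $$ (i, 0) * cofactor A i 0)"
    by (rule laplace_expansion_column[OF A]) simp
  then show ?thesis
    using A by (simp add: numeral_2_eq_2 cofactor_def s mat_delete_def)
qed

lemma Ad_closed:
  assumes "A \<in> carrier (SL n)" "X \<in> carrier_mat n n"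
  shows "Ad n A X \<in> carrier_mat n n"
  using group.inv_closed[OF group_SL assms(1)] assms by (auto simp: Ad_def SL_def)

lemma Ad_mult:
  assumes A: "A \<in> carrier (SL n)" and B: "B \<in> carrier (SL n)" and X: "X \<in> carrier_mat n n"
  shows "Ad n (A * B) X = Ad n A (Ad n B X)"
proof -
  interpret G: group "SL n :: 'a mat monoid" by (rule group_SL)
  have "inv\<^bsub>SL n\<^esub> (A * B) = inv\<^bsub>SL n\<^esub> B * inv\<^bsub>SL n\<^esub> A"
    using G.inv_mult_group[OF A B] by (simp add: SL_def)
  moreover have "A \<in> carrier_mat n n" "B \<in> carrier_mat n n" "inv\<^bsub>SL n\<^esub> A \<in> carrier_mat n n" "inv\<^bsub>SL n\<^esub> B \<in> carrier_mat n n"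
    using A B G.inv_closed[OF A] G.inv_closed[OF B] by (auto simp: SL_def)
  ultimately show ?thesis using X by (simp add: Ad_def assoc_mult_mat[of _ n n _ n _ n])
qed

lemma Ad_add:
  assumes A: "A \<in> carrier (SL n)" and X: "X \<in> carrier_mat n n" "Y \<in> carrier_mat n n"
  shows "Ad n A (X + Y) = Ad n A X + Ad n A Y"
proof -
  have i: "A \<in> carrier_mat n n" "inv\<^bsub>SL n\<^esub> A \<in> carrier_mat n n"
    using A group.inv_closed[OF group_SL A] by (auto simp: SL_def)
  show ?thesis
    using X i by (simp add: Ad_def mult_add_distrib_mat[of _ n n] add_mult_distrib_mat[of _ n n])
qed

lemma Ad_zero:
  assumes "A \<in> carrier (SL n)"
  shows "Ad n A (0\<^sub>m n n) = 0\<^sub>m n n"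
  using assms group.inv_closed[OF group_SL assms] by (auto simp: Ad_def SL_def)

lemma inv_SL_2:
  assumes A: "A \<in> carrier (SL 2)"
  shows "inv\<^bsub>SL 2\<^esub> A = mat 2 2 (\<lambda>(i, j). if i = j then A $$ (1 - i, 1 - j) else - A $$ (i, j))"
    (is "_ = ?B")
proof -
  interpret G: group "SL 2 :: 'a mat monoid" by (rule group_SL)
  have A': "A \<in> carrier_mat 2 2" "det A = 1" using A by (auto simp: SL_def)
  have B: "?B \<in> carrier_mat 2 2" by simp
  have d: "A $$ (0, 0) * A $$ (1, 1) - A $$ (0, 1) * A $$ (1, 0) = 1" using det_2[OF A'(1)] A'(2) by simp
  have "?B * A = 1\<^sub>m 2"
    by (rule mat_2_eqI[OF mult_carrier_mat[OF B A'(1)] one_carrier_mat])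
      (use A' B d in \<open>simp_all add: index_mult_mat_2 algebra_simps del: index_mult_mat\<close>)
  moreover have "det ?B = 1" unfolding det_2[OF B] using d by (simp add: algebra_simps)
  ultimately show ?thesis using A by (intro G.inv_equality) (auto simp: SL_def)
qed

lemma eval_at_0_SL: "A \<in> carrier (SL n) \<Longrightarrow> eval_at_0 A \<in> carrier (SL n)"
  using eval_at_0_hom by (auto simp: hom_def)

lemma eval_at_0_mult:
  "A \<in> carrier (SL n) \<Longrightarrow> B \<in> carrier (SL n) \<Longrightarrow> eval_at_0 (A * B) = eval_at_0 A * eval_at_0 B"
  using eval_at_0_hom[of n] by (auto simp: hom_def SL_def)

lemma addrow_mat_SL: "k \<noteq> l \<Longrightarrow> addrow_mat n a k l \<in> carrier (SL n)"
  by (simp add: SL_def det_addrow_mat)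

lemma mult_SL: "A \<in> carrier (SL n) \<Longrightarrow> B \<in> carrier (SL n) \<Longrightarrow> A * B \<in> carrier (SL n)"
  by (auto simp: SL_def det_mult)

lemma elementary_products_SL: "A \<in> elementary_products n \<Longrightarrow> A \<in> carrier (SL n)"
proof (induction rule: elementary_products.induct)
  case one
  then show ?case by (simp add: SL_def)
next
  case (mult A k l a)
  then show ?case by (intro mult_SL addrow_mat_SL)
qed

text \<open>Induction over a factorisation of \<open>B\<close> with \<open>A\<close> arbitrary:
  writing \<open>A (e B) = (A e) B\<close>, the rule for \<open>e B\<close> follows from that for
  \<open>B\<close> and for right multiplication by the elementary matrix \<open>e\<close>. Only the
  latter has to be checked for a candidate.\<close>

lemma Ad_cocycleI:
  fixes d :: "'a::field poly mat \<Rightarrow> 'a mat"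
  assumes d: "\<And>A. A \<in> carrier (SL n) \<Longrightarrow> d A \<in> carrier_mat n n"
    and one: "d (1\<^sub>m n) = 0\<^sub>m n n"
    and elem: "\<And>A f k l. \<lbrakk>A \<in> carrier (SL n); k < n; l < n; k \<noteq> l\<rbrakk> \<Longrightarrow>
      d (A * addrow_mat n f k l) = d A + Ad n (eval_at_0 A) (d (addrow_mat n f k l))"
    and A: "A \<in> carrier (SL n)" and B: "B \<in> carrier (SL n)"
  shows "d (A * B) = d A + Ad n (eval_at_0 A) (d B)"
  using SL_elementary_products[OF B] A
proof (induction arbitrary: A rule: elementary_products.induct)
  case one
  then show ?case using d[OF one] eval_at_0_SL[OF one] by (auto simp: assms(2) Ad_zero SL_def)
next
  case (mult B k l f A)
  let ?e = "addrow_mat n f k l"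
  have B: "B \<in> carrier (SL n)" by (rule elementary_products_SL[OF mult.hyps(1)])
  have e: "?e \<in> carrier (SL n)" using mult.hyps by (intro addrow_mat_SL)
  note A = mult.prems
  have m: "A \<in> carrier_mat n n" "B \<in> carrier_mat n n" "?e \<in> carrier_mat n n"
    using A B e by (auto simp: SL_def)
  have E: "eval_at_0 A \<in> carrier (SL n)" "eval_at_0 ?e \<in> carrier (SL n)"
    using eval_at_0_SL A e by auto
  have "d (A * (?e * B)) = d (A * ?e * B)" using m by (simp add: assoc_mult_mat[of _ n n _ n _ n])
  also have "\<dots> = d (A * ?e) + Ad n (eval_at_0 (A * ?e)) (d B)"
    by (rule mult.IH) (intro mult_SL A e)
  also have "\<dots> = d A + Ad n (eval_at_0 A) (d ?e) + Ad n (eval_at_0 A) (Ad n (eval_at_0 ?e) (d B))"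
    using A e B mult.hyps by (simp add: elem eval_at_0_mult Ad_mult eval_at_0_SL d)
  also have "\<dots> = d A + (Ad n (eval_at_0 A) (d ?e) + Ad n (eval_at_0 A) (Ad n (eval_at_0 ?e) (d B)))"
    using A e B by (intro assoc_add_mat[of _ n n] Ad_closed d E)
  also have "\<dots> = d A + Ad n (eval_at_0 A) (d ?e + Ad n (eval_at_0 ?e) (d B))"
    using A e B by (simp add: Ad_add E Ad_closed d)
  also have "d ?e + Ad n (eval_at_0 ?e) (d B) = d (?e * B)" by (rule mult.IH[OF e, symmetric])
  finally show ?case .
qed

definition pcol :: "'a poly mat \<Rightarrow> nat \<Rightarrow> 'a::field pvec" where
  "pcol A j = (A $$ (0, j), A $$ (1, j))"

lemma pcol_sel: "fst (pcol A j) = A $$ (0, j)" "snd (pcol A j) = A $$ (1, j)"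
  by (simp_all add: pcol_def)

text \<open>A functional on \<open>tF[t]\<close>, extended by zero to the constants so that it
  applies to the quotients of the Euclidean algorithm.\<close>

locale vanishing_functional =
  fixes ell :: "'a::field poly \<Rightarrow> 'a"
  assumes ell_add: "ell (f + g) = ell f + ell g"
    and ell_smult: "ell (Polynomial.smult a f) = a * ell f"
    and ell_const: "ell [:a:] = 0"
begin

sublocale xx: farey_cocycle ell "\<lambda>(x, y). x\<^sup>2"
  by unfold_locales (simp_all add: ell_add ell_smult ell_const power_mult_distrib)

sublocale xy: farey_cocycle ell "\<lambda>(x, y). x * y"
  by unfold_locales (simp_all add: ell_add ell_smult ell_const power2_eq_square)

sublocale yy: farey_cocycle ell "\<lambda>(x, y). y\<^sup>2"
  by unfold_locales (simp_all add: ell_add ell_smult ell_const power_mult_distrib)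

text \<open>With \<open>p = (x, y)\<close> the first column of \<open>A\<close> at \<open>t = 0\<close>, adding \<open>f\<close> times the first column of \<open>A\<close> to
  the second must change the value by \<open>Ad (A(0)) (ell f E\<^sub>1\<^sub>2) = ell f [[-xy, x\<^sup>2], [-y\<^sup>2, xy]]\<close>.\<close>

definition sl2_cocycle :: "'a poly mat \<Rightarrow> 'a mat" where
  "sl2_cocycle A = mat 2 2 (\<lambda>(i, j).
     if i = 0 then (if j = 0 then - xy.edge_sum (pcol A 0) (pcol A 1) else xx.edge_sum (pcol A 0) (pcol A 1))
     else (if j = 0 then - yy.edge_sum (pcol A 0) (pcol A 1) else xy.edge_sum (pcol A 0) (pcol A 1)))"

lemma sl2_cocycle_const:
  assumes "A \<in> carrier (SL 2)" "\<And>i j. i < 2 \<Longrightarrow> j < 2 \<Longrightarrow> degree (A $$ (i, j)) = 0"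
  shows "sl2_cocycle A = 0\<^sub>m 2 2"
proof -
  have "A \<in> carrier_mat 2 2" "det A = 1" using assms(1) by (auto simp: SL_def)
  then have "pdet (pcol A 0) (pcol A 1) = 1" by (simp add: det_2 pdet_def pcol_def)
  moreover have "pdeg (pcol A 0) = 0" "pdeg (pcol A 1) = 0" using assms(2) by (simp_all add: pdeg_def pcol_def)
  ultimately show ?thesis
    by (intro eq_matI) (simp_all add: sl2_cocycle_def xx.edge_sum_const xy.edge_sum_const yy.edge_sum_const)
qed

lemma pcol_addrow_mat:
  assumes "A \<in> carrier_mat 2 2" "k < 2" "l < 2" "k \<noteq> l" "j < 2"
  shows "pcol (A * addrow_mat 2 f k l) j = (if j = l then paxpy f (pcol A k) (pcol A l) else pcol A j)"
proof -
  have "A * addrow_mat 2 f k l = addcol f l k A" using assms by (simp add: addcol_mat)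
  then show ?thesis using assms by (auto simp: pcol_def paxpy_def add.commute)
qed

lemma sl2_cocycle_addrow_mat:
  assumes A: "A \<in> carrier (SL 2)" and kl: "k < 2" "l < 2" "k \<noteq> l"
  shows "sl2_cocycle (A * addrow_mat 2 f k l)
    = sl2_cocycle A + Ad 2 (eval_at_0 A) (mat 2 2 (\<lambda>(i, j). if i = k \<and> j = l then ell f else 0))"
proof -
  have A': "A \<in> carrier_mat 2 2" "det A = 1" using A by (auto simp: SL_def)
  then have p: "pdet (pcol A 0) (pcol A 1) = 1" by (simp add: det_2 pdet_def pcol_def)
  have E: "eval_at_0 A \<in> carrier (SL 2)" "eval_at_0 A \<in> carrier_mat 2 2"
    using eval_at_0_SL[OF A] by (auto simp: SL_def)
  let ?X = "mat 2 2 (\<lambda>(i, j). if i = k \<and> j = l then ell f else 0)"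
  have X: "?X \<in> carrier_mat 2 2" by simp
  have ent: "eval_at_0 A $$ (i, j) = poly (A $$ (i, j)) 0" if "i < 2" "j < 2" for i j
    using A' that by (simp add: eval_at_0_def)
  let ?I = "mat 2 2 (\<lambda>(i, j). if i = j then eval_at_0 A $$ (1 - i, 1 - j) else - eval_at_0 A $$ (i, j))"
  have I: "?I \<in> carrier_mat 2 2" by simp
  have Ad: "Ad 2 (eval_at_0 A) ?X = eval_at_0 A * ?X * ?I" by (simp add: Ad_def inv_SL_2[OF E(1)])
  have kl': "k = 0 \<and> l = 1 \<or> k = 1 \<and> l = 0" using kl by (auto simp: less_2_cases_iff)
  define B where "B = A * addrow_mat 2 f k l"
  define x where "x = eval_at_0 A $$ (0, k)"
  define y where "y = eval_at_0 A $$ (1, k)"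
  \<comment> \<open>With \<open>(x, y)\<close> the column \<open>k\<close> of \<open>A\<close> at 0,
    the conjugate of \<open>E_12\<close> is \<open>(x, y)^T (- y, x)\<close> and that of
    \<open>E_21\<close> is the negative of this expression. The same sign separates operations on
    the second column from those on the first.\<close>
  let ?s = "if k = 0 then 1 else - 1 :: 'a"
  have es: "xx.edge_sum (pcol (A * addrow_mat 2 f k l) 0) (pcol (A * addrow_mat 2 f k l) 1) = xx.edge_sum (pcol A 0) (pcol A 1) + ?s * ell f * x\<^sup>2"
    "xy.edge_sum (pcol (A * addrow_mat 2 f k l) 0) (pcol (A * addrow_mat 2 f k l) 1) = xy.edge_sum (pcol A 0) (pcol A 1) + ?s * ell f * (x * y)"
    "yy.edge_sum (pcol (A * addrow_mat 2 f k l) 0) (pcol (A * addrow_mat 2 f k l) 1) = yy.edge_sum (pcol A 0) (pcol A 1) + ?s * ell f * y\<^sup>2"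
    using kl' by (auto simp: pcol_addrow_mat[OF A'(1)] xx.edge_sum_paxpy[OF p] xy.edge_sum_paxpy[OF p] yy.edge_sum_paxpy[OF p]
        xx.edge_sum_paxpy_left[OF p] xy.edge_sum_paxpy_left[OF p] yy.edge_sum_paxpy_left[OF p]
        ev0_def ent x_def y_def pcol_sel simp del: One_nat_def)
  have less_2: "1 < (2::nat)" by simp
  have Z: "(eval_at_0 A * ?X * ?I) $$ (i, j) =
      ?s * ell f * (if i = 0 then (if j = 0 then - (x * y) else x\<^sup>2) else (if j = 0 then - (y\<^sup>2) else x * y))"
    if "i < 2" "j < 2" for i j
    unfolding index_mult_mat_2[OF mult_carrier_mat[OF E(2) X] I that]
      index_mult_mat_2[OF E(2) X that(1) pos2] index_mult_mat_2[OF E(2) X that(1) less_2]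
    using kl' that by (auto simp: less_2_cases_iff x_def y_def power2_eq_square algebra_simps)
  show ?thesis
    by (rule eq_matI) (use E X I in \<open>auto simp: sl2_cocycle_def Ad Z es[folded B_def] less_2_cases_iff
        algebra_simps B_def[symmetric] simp del: index_mult_mat(1) One_nat_def\<close>)
qed

lemma sl2_cocycle_one: "sl2_cocycle (1\<^sub>m 2) = 0\<^sub>m 2 2"
  by (rule sl2_cocycle_const) (auto simp: SL_def)

lemma sl2_cocycle_elementary:
  assumes "k < 2" "l < 2" "k \<noteq> l"
  shows "sl2_cocycle (addrow_mat 2 f k l) = mat 2 2 (\<lambda>(i, j). if i = k \<and> j = l then ell f else 0)"
proof -
  have one: "(1\<^sub>m 2 :: 'a poly mat) \<in> carrier (SL 2)" by (simp add: SL_def)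
  have e1: "eval_at_0 (1\<^sub>m 2) = (\<one>\<^bsub>SL 2\<^esub> :: 'a mat)" by (intro eq_matI) (auto simp: SL_def eval_at_0_def)
  have "Ad 2 (eval_at_0 (1\<^sub>m 2)) X = X" if "X \<in> carrier_mat 2 2" for X :: "'a mat"
    unfolding e1 Ad_def monoid.inv_one[OF group.is_monoid[OF group_SL]] using that by (simp add: SL_def)
  then show ?thesis
    using sl2_cocycle_addrow_mat[OF one assms, of f] left_mult_one_mat[OF addrow_mat_carrier, of 2 f k l]
    by (simp add: sl2_cocycle_one)
qed

lemma sl2_cocycle_mult:
  assumes "A \<in> carrier (SL 2)" "B \<in> carrier (SL 2)"
  shows "sl2_cocycle (A * B) = sl2_cocycle A + Ad 2 (eval_at_0 A) (sl2_cocycle B)"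
proof (rule Ad_cocycleI[where d = sl2_cocycle and n = 2])
  show "sl2_cocycle C \<in> carrier_mat 2 2" for C by (simp add: sl2_cocycle_def)
qed (simp_all add: sl2_cocycle_addrow_mat sl2_cocycle_elementary sl2_cocycle_one assms)

lemma mat_trace_sl2_cocycle: "mat_trace (sl2_cocycle A) = 0"
  by (simp add: mat_trace_def sl2_cocycle_def numeral_2_eq_2)

end

section \<open>Additive functions with polynomial dependence\<close>

definition unitv :: "nat \<Rightarrow> nat \<Rightarrow> 'a::zero_neq_one" where
  "unitv i = (\<lambda>k. if k = i then 1 else 0)"

definition orth :: "nat \<Rightarrow> (nat \<Rightarrow> 'a::comm_ring_1) \<Rightarrow> (nat \<Rightarrow> 'a) \<Rightarrow> bool" where
  "orth n p q \<longleftrightarrow> (\<Sum>i<n. p i * q i) = 0"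

lemma sum_unitv [simp]:
  "i < n \<Longrightarrow> (\<Sum>k<n. unitv i k * f k) = (f i :: 'a::comm_ring_1)"
  "i < n \<Longrightarrow> (\<Sum>k<n. f k * unitv i k) = f i"
  by (simp_all add: unitv_def if_distrib[of "\<lambda>x. x * _"] if_distrib[of "\<lambda>x. _ * x"] cong: if_cong)

lemma sum_two_units:
  assumes "i < n" "j < n" "i \<noteq> j"
  shows "(\<Sum>k<n. (a * unitv i k + b * unitv j k) * f k) = a * f i + b * (f j :: 'a::comm_ring_1)"
  using assms by (simp add: distrib_right sum.distrib mult.assoc sum_distrib_left[symmetric])

text \<open>A function on the pairs of orthogonal vectors, additive in both arguments, is determined by
  its values on the pairs supported on two coordinates: for \<open>p\<^sub>i \<noteq> 0\<close> the hyperplane orthogonal to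
  \<open>p\<close> is spanned by the vectors \<open>p\<^sub>i e\<^sub>j - p\<^sub>j e\<^sub>i\<close>.\<close>

lemma biadditive_on_orthogonal_zero:
  fixes D :: "(nat \<Rightarrow> 'a::field_char_0) \<Rightarrow> (nat \<Rightarrow> 'a) \<Rightarrow> 'a"
  assumes cong: "\<And>p q p' q'. (\<And>i j. i < n \<Longrightarrow> j < n \<Longrightarrow> p i * q j = p' i * q' j) \<Longrightarrow> D p q = D p' q'"
    and add_right: "\<And>p q q'. orth n p q \<Longrightarrow> orth n p q' \<Longrightarrow> D p (\<lambda>i. q i + q' i) = D p q + D p q'"
    and add_left: "\<And>p p' q. orth n p q \<Longrightarrow> orth n p' q \<Longrightarrow> D (\<lambda>i. p i + p' i) q = D p q + D p' q"
    and units: "\<And>i j a. i < n \<Longrightarrow> j < n \<Longrightarrow> i \<noteq> j \<Longrightarrow> D (\<lambda>k. a * unitv i k) (unitv j) = 0"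
    and pairs: "\<And>i j a s. i < n \<Longrightarrow> j < n \<Longrightarrow> i \<noteq> j \<Longrightarrow>
        D (\<lambda>k. a * (unitv i k + s * unitv j k)) (\<lambda>k. unitv j k - s * unitv i k) = 0"
    and pq: "orth n p q"
  shows "D p q = 0"
proof -
  have zero_right: "D p (\<lambda>i. 0) = 0" for p
    using add_right[of p "\<lambda>i. 0" "\<lambda>i. 0"] by (simp add: orth_def)
  have zero_left: "D (\<lambda>i. 0) q = 0" for q
    using add_left[of "\<lambda>i. 0" q "\<lambda>i. 0"] by (simp add: orth_def)
  have orth_sum_right: "orth n p (\<lambda>i. \<Sum>k\<in>S. f k i)" if "\<And>k. k \<in> S \<Longrightarrow> orth n p (f k)" for S p and f :: "nat \<Rightarrow> nat \<Rightarrow> 'a"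
    unfolding orth_def sum_distrib_left
    by (subst sum.swap) (use that in \<open>simp add: orth_def\<close>)
  have orth_sum_left: "orth n (\<lambda>i. \<Sum>k\<in>S. f k i) p" if "\<And>k. k \<in> S \<Longrightarrow> orth n (f k) p" for S p and f :: "nat \<Rightarrow> nat \<Rightarrow> 'a"
    unfolding orth_def sum_distrib_right
    by (subst sum.swap) (use that in \<open>simp add: orth_def\<close>)
  have sum_right: "D p (\<lambda>i. \<Sum>k\<in>S. f k i) = (\<Sum>k\<in>S. D p (f k))"
    if "finite S" "\<And>k. k \<in> S \<Longrightarrow> orth n p (f k)" for S p and f :: "nat \<Rightarrow> nat \<Rightarrow> 'a"
    using that by (induction S rule: finite_induct) (simp_all add: zero_right add_right orth_sum_right)
  have sum_left: "D (\<lambda>i. \<Sum>k\<in>S. f k i) q = (\<Sum>k\<in>S. D (f k) q)"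
    if "finite S" "\<And>k. k \<in> S \<Longrightarrow> orth n (f k) q" for S q and f :: "nat \<Rightarrow> nat \<Rightarrow> 'a"
    using that by (induction S rule: finite_induct) (simp_all add: zero_left add_left orth_sum_left)
  have units': "D (\<lambda>k. a * unitv i k) (\<lambda>k. b * unitv j k) = 0" if "i < n" "j < n" "i \<noteq> j" for i j a b
    using units[OF that, of "a * b"] cong[of "\<lambda>k. a * unitv i k" "\<lambda>k. b * unitv j k" "\<lambda>k. a * b * unitv i k" "unitv j"]
    by simp
  show ?thesis
  proof (cases "\<exists>i<n. p i \<noteq> 0")
    case False
    then have "D p q = D (\<lambda>i. 0) q" by (intro cong) auto
    then show ?thesis by (simp add: zero_left)
  next
    case True
    then obtain i where i: "i < n" "p i \<noteq> 0" by blast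
    let ?f = "\<lambda>j k. q j / p i * (p i * unitv j k - p j * unitv i k)"
    have orth_f: "orth n r (?f j)" if "j < n" "j \<noteq> i" "r i * p j = r j * p i" for j r
    proof -
      have "(\<Sum>k<n. r k * ?f j k) = q j / p i * (\<Sum>k<n. (p i * unitv j k + (- p j) * unitv i k) * r k)"
        unfolding sum_distrib_left by (rule sum.cong[OF refl]) (simp add: i(2) field_simps)
      also have "\<dots> = q j / p i * (p i * r j + (- p j) * r i)"
        using that i by (subst sum_two_units) auto
      also have "\<dots> = 0" using that by (simp add: mult.commute)
      finally show ?thesis by (simp only: orth_def)
    qed
    have q: "q k = (\<Sum>j\<in>{..<n} - {i}. ?f j k)" if k: "k < n" for k
    proof (cases "k = i")
      case False
      then have "(\<Sum>j\<in>{..<n} - {i}. ?f j k) = (\<Sum>j\<in>{..<n} - {i}. if j = k then q j else 0)"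
        using i by (intro sum.cong) (auto simp: unitv_def)
      then show ?thesis using False k by simp
    next
      case True
      have "(\<Sum>j<n. p j * q j) = p i * q i + (\<Sum>j\<in>{..<n} - {i}. p j * q j)"
        using i by (subst sum.remove[of _ i]) auto
      then have "p i * q i = - (\<Sum>j\<in>{..<n} - {i}. p j * q j)"
        using pq by (simp add: orth_def eq_neg_iff_add_eq_0)
      then have "q i = - (\<Sum>j\<in>{..<n} - {i}. p j * q j) / p i"
        using i(2) by (metis nonzero_mult_div_cancel_left)
      also have "\<dots> = (\<Sum>j\<in>{..<n} - {i}. ?f j i)"
        unfolding sum_negf[symmetric] sum_divide_distrib by (intro sum.cong) (auto simp: unitv_def)
      finally show ?thesis using True by simp
    qed
    have "D p q = D p (\<lambda>k. \<Sum>j\<in>{..<n} - {i}. ?f j k)"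
      by (rule cong, rule arg_cong2[of _ _ _ _ "(*)"], rule refl, rule q)
    also have "\<dots> = (\<Sum>j\<in>{..<n} - {i}. D p (?f j))"
      by (intro sum_right orth_f) auto
    also have "\<dots> = 0"
    proof (intro sum.neutral ballI)
      fix j assume "j \<in> {..<n} - {i}"
      then have j: "j < n" "j \<noteq> i" by auto
      \<comment> \<open>\<open>p\<close> is cut into its part on the coordinates \<open>i\<close>,
        \<open>j\<close> and the rest. The rest only meets disjoint unit vectors; the first part is,
        after moving scalars with \<open>cong\<close>, the case of \<open>pairs\<close> with
        \<open>s = p j / p i\<close>.\<close>
      let ?p = "\<lambda>k. p i * unitv i k + p j * unitv j k"
      let ?r = "\<lambda>k. \<Sum>l\<in>{..<n} - {i, j}. p l * unitv l k"
      have p: "p k = ?p k + ?r k" if k: "k < n" for k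
      proof (cases "k = i \<or> k = j")
        case True
        then have "?r k = 0" by (intro sum.neutral) (auto simp: unitv_def)
        then show ?thesis using True j by (auto simp: unitv_def)
      next
        case False
        have "?r k = (\<Sum>l\<in>{..<n} - {i, j}. if l = k then p l else 0)"
          by (intro sum.cong) (auto simp: unitv_def)
        then show ?thesis using False k by (simp add: unitv_def)
      qed
      have o1: "orth n ?p (?f j)" by (rule orth_f) (use j in \<open>auto simp: unitv_def\<close>)
      have o2: "orth n (\<lambda>k. p l * unitv l k) (?f j)" if "l \<in> {..<n} - {i, j}" for l
        by (rule orth_f) (use j that in \<open>auto simp: unitv_def\<close>)
      have "D p (?f j) = D (\<lambda>k. ?p k + ?r k) (?f j)" by (rule cong, rule arg_cong2[of _ _ _ _ "(*)"], rule p)  simp_all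
      also have "\<dots> = D ?p (?f j) + D ?r (?f j)"
        by (intro add_left o1 orth_sum_left o2)
      also have "D ?r (?f j) = (\<Sum>l\<in>{..<n} - {i, j}. D (\<lambda>k. p l * unitv l k) (?f j))"
        by (intro sum_left o2) auto
      also have "\<dots> = 0"
      proof (intro sum.neutral ballI)
        fix l assume l: "l \<in> {..<n} - {i, j}"
        have "?f j = (\<lambda>k. q j * unitv j k + (- (q j / p i * p j)) * unitv i k)"
          using i by (auto simp: fun_eq_iff field_simps)
        then have "D (\<lambda>k. p l * unitv l k) (?f j) = D (\<lambda>k. p l * unitv l k) (\<lambda>k. q j * unitv j k)
            + D (\<lambda>k. p l * unitv l k) (\<lambda>k. (- (q j / p i * p j)) * unitv i k)"
          using l i j by (simp only:, intro add_right)
            (auto simp: orth_def unitv_def intro!: sum.neutral)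
        then show "D (\<lambda>k. p l * unitv l k) (?f j) = 0"
          using l i j by (simp add: units' del: mult_minus_left)
      qed
      also have "D ?p (?f j) = D (\<lambda>k. q j * p i * (unitv i k + p j / p i * unitv j k)) (\<lambda>k. unitv j k - p j / p i * unitv i k)"
        by (rule cong) (use i in \<open>simp add: field_simps\<close>)
      also have "\<dots> = 0" using pairs[OF i(1) j(1) j(2)[symmetric]] .
      finally show "D p (?f j) = 0" by simp
    qed
    finally show ?thesis .
  qed
qed

section \<open>Polynomial and Laurent dependence on one parameter\<close>

lemma poly_eqI_infinite:
  fixes P Q :: "'a::idom poly"
  assumes "infinite S" "\<And>x. x \<in> S \<Longrightarrow> poly P x = poly Q x"
  shows "P = Q"
proof (rule ccontr)
  assume "P \<noteq> Q"
  then have "finite {x. poly (P - Q) x = 0}" by (intro poly_roots_finite) simp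
  moreover have "S \<subseteq> {x. poly (P - Q) x = 0}" using assms(2) by auto
  ultimately show False using assms(1) finite_subset by blast
qed

text \<open>On the integers \<open>a\<close> the function \<open>\<psi> (a\<^sup>2)\<close> is \<open>a\<^sup>2 \<psi> 1\<close> by additivity, hence for all \<open>a\<close> by the
  polynomial dependence; and every element of the field is a difference of squares.\<close>

lemma additive_homogeneous:
  fixes \<psi> :: "'a::field_char_0 \<Rightarrow> 'a"
  assumes add: "\<And>a b. \<psi> (a + b) = \<psi> a + \<psi> b"
    and P: "\<And>a. a \<noteq> 0 \<Longrightarrow> a ^ N * \<psi> (a\<^sup>2) = poly P a"
  shows "\<psi> a = a * \<psi> 1"
proof -
  have zero: "\<psi> 0 = 0" using add[of 0 0] by simp
  have nat: "\<psi> (of_nat k * a) = of_nat k * \<psi> a" for k a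
    by (induction k) (simp_all add: zero add distrib_right)
  have "P = monom (\<psi> 1) (N + 2)"
  proof (rule poly_eqI_infinite)
    show "infinite (of_nat ` {0<..} :: 'a set)"
      by (subst finite_image_iff) (auto intro: inj_on_subset[OF inj_of_nat] simp: infinite_Ioi)
    fix x :: 'a assume "x \<in> of_nat ` {0<..}"
    then obtain k where k: "k > 0" "x = of_nat k" by blast
    have "poly P x = x ^ N * \<psi> (of_nat (k\<^sup>2) * 1)" using P[of x] k by simp
    also have "\<dots> = poly (monom (\<psi> 1) (N + 2)) x" unfolding nat using k by (simp add: poly_monom power_add power2_eq_square)
    finally show "poly P x = poly (monom (\<psi> 1) (N + 2)) x" .
  qed
  then have sq: "\<psi> (a\<^sup>2) = a\<^sup>2 * \<psi> 1" for a
    using P[of a] zero by (cases "a = 0") (simp_all add: poly_monom power2_eq_square mult.assoc)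
  have "\<psi> ((a / 2 + 1)\<^sup>2) = \<psi> ((a / 2)\<^sup>2) + \<psi> a + \<psi> 1"
    by (simp add: add[symmetric] power2_eq_square algebra_simps)
  then show ?thesis unfolding sq by (simp add: power2_eq_square algebra_simps)
qed

text \<open>Up to sign, \<open>f\<close> and \<open>g\<close> are the two charts of a section of
  \<open>O(2)\<close> on the projective line. Hence \<open>f = a + b s + c s^2\<close> and
  \<open>g = - (c + b s + a s^2)\<close>, and the coefficients are recovered from the values of
  \<open>f\<close> at 0 and 1 and of \<open>g\<close> at 0.\<close>

lemma quadratic_of_inversion:
  fixes f g :: "'a::field_char_0 poly"
  assumes fg: "\<And>s. s \<noteq> 0 \<Longrightarrow> poly f s = - (s\<^sup>2) * poly g (1 / s)"
  shows "poly f s = poly f 0 + s * (poly f 1 - poly f 0 + poly g 0) - s\<^sup>2 * poly g 0"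
proof -
  let ?d = "degree g"
  have inf: "infinite (UNIV - {0} :: 'a set)" by (simp add: infinite_UNIV_char_0)
  have "monom 1 ?d * f = - monom 1 2 * reflect_poly g"
    by (rule poly_eqI_infinite[OF inf])
      (auto simp: poly_monom fg poly_reflect_poly_nz inverse_eq_divide algebra_simps)
  then have eq: "monom 1 ?d * f = - (monom 1 2 * reflect_poly g)" by simp
  have deg: "degree f \<le> 2"
  proof (cases "f = 0")
    case False
    have m: "monom 1 k \<noteq> (0 :: 'a poly)" for k by simp
    have "?d + degree f = degree (monom 1 ?d * f)"
      using degree_mult_eq[OF m[of ?d] False] by (simp add: degree_monom_eq)
    also have "\<dots> \<le> degree (monom 1 2 :: 'a poly) + degree (reflect_poly g)"
      unfolding eq degree_minus by (rule degree_mult_le)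
    also have "\<dots> \<le> 2 + ?d" using degree_reflect_poly_le[of g] by (simp add: degree_monom_eq)
    finally show ?thesis by simp
  qed simp
  define a b c where "a = coeff f 0" and "b = coeff f 1" and "c = coeff f 2"
  have f: "poly f s = a + b * s + c * s\<^sup>2" for s
  proof -
    have "poly f s = (\<Sum>i\<le>2. coeff f i * s ^ i)"
      unfolding poly_altdef by (rule sum.mono_neutral_left) (use deg in \<open>auto simp: coeff_eq_0\<close>)
    then show ?thesis by (simp add: numeral_2_eq_2 a_def b_def c_def)
  qed
  have "g = [:- c, - b, - a:]"
  proof (rule poly_eqI_infinite[OF inf])
    fix r :: 'a assume "r \<in> UNIV - {0}"
    then have r: "r \<noteq> 0" by simp
    have "poly g r = - (r\<^sup>2) * poly f (1 / r)" using fg[of "1 / r"] r by (simp add: power_divide)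
    also have "\<dots> = poly [:- c, - b, - a:] r"
      unfolding f using r by (simp add: power2_eq_square field_simps)
    finally show "poly g r = poly [:- c, - b, - a:] r" .
  qed
  then have "poly g 0 = - c" by simp
  then show ?thesis by (simp add: f)
qed

text \<open>A regular function is a Laurent polynomial along a curve with Laurent polynomial
  entries, such as a torus. A pole at 0 is encoded by the power \<open>s ^ N\<close> that clears
  it.\<close>

lemma entry_polys_laurent_curve:
  fixes A :: "'a::field \<Rightarrow> 'a mat"
  assumes p: "p \<in> entry_polys n"
    and A: "\<And>i j. i < n \<Longrightarrow> j < n \<Longrightarrow> \<exists>N P. \<forall>s. s \<noteq> 0 \<longrightarrow> s ^ N * A s $$ (i, j) = poly P s"
  shows "\<exists>N P. \<forall>s. s \<noteq> 0 \<longrightarrow> s ^ N * p (A s) = poly P s"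
  using p
proof induction
  case (const c)
  show ?case by (intro exI[of _ 0] exI[of _ "[:c:]"]) simp
next
  case (entry i j)
  then show ?case using A by blast
next
  case (add p q)
  then obtain N P M Q where "\<forall>s. s \<noteq> 0 \<longrightarrow> s ^ N * p (A s) = poly P s" "\<forall>s. s \<noteq> 0 \<longrightarrow> s ^ M * q (A s) = poly Q s"
    by blast
  then have "\<forall>s. s \<noteq> 0 \<longrightarrow> s ^ (N + M) * (p (A s) + q (A s)) = poly (monom 1 M * P + monom 1 N * Q) s"
    by (simp add: poly_monom power_add distrib_left mult.assoc mult.left_commute)
  then show ?case by blast
next
  case (mult p q)
  then obtain N P M Q where "\<forall>s. s \<noteq> 0 \<longrightarrow> s ^ N * p (A s) = poly P s" "\<forall>s. s \<noteq> 0 \<longrightarrow> s ^ M * q (A s) = poly Q s"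
    by blast
  then have "\<forall>s. s \<noteq> 0 \<longrightarrow> s ^ (N + M) * (p (A s) * q (A s)) = poly (P * Q) s"
    by (simp add: power_add) (metis mult.assoc mult.left_commute)
  then show ?case by blast
qed

lemma entry_polys_polynomial_curve:
  fixes A :: "'a::field \<Rightarrow> 'a mat"
  assumes p: "p \<in> entry_polys n"
    and A: "\<And>i j. i < n \<Longrightarrow> j < n \<Longrightarrow> \<exists>P. \<forall>s. A s $$ (i, j) = poly P s"
  shows "\<exists>P. \<forall>s. p (A s) = poly P s"
  using p
proof induction
  case (const c)
  show ?case by (intro exI[of _ "[:c:]"]) simp
next
  case (entry i j)
  then show ?case using A by blast
next
  case (add p q)
  then show ?case by (metis poly_add)
next
  case (mult p q)
  then show ?case by (metis poly_mult)
qed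

section \<open>Rational representations and the matrices \<open>1 + x p q\<^sup>T\<close>\<close>

abbreviation dual :: "('a::field, 'v, 'e) module_scheme \<Rightarrow> ('v \<Rightarrow> 'a) set" where
  "dual V \<equiv> LinearCombinations.module_hom class_ring V self_vs"

lemma dual_iff:
  "l \<in> dual V \<longleftrightarrow> (\<forall>v\<in>carrier V. \<forall>w\<in>carrier V. l (v \<oplus>\<^bsub>V\<^esub> w) = l v + l w) \<and>
     (\<forall>c. \<forall>v\<in>carrier V. l (c \<odot>\<^bsub>V\<^esub> v) = c * l v)"
  by (auto simp: LinearCombinations.module_hom_def self_vs_def)

lemma dual_add: "l \<in> dual V \<Longrightarrow> v \<in> carrier V \<Longrightarrow> w \<in> carrier V \<Longrightarrow> l (v \<oplus>\<^bsub>V\<^esub> w) = l v + l w"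
  and dual_smult: "l \<in> dual V \<Longrightarrow> v \<in> carrier V \<Longrightarrow> l (c \<odot>\<^bsub>V\<^esub> v) = c * l v"
  by (simp_all add: dual_iff)

text \<open>The coordinate functions of a finite basis separate vectors. Identities in
  \<open>V\<close> can thus be tested by functionals, which turn them into identities in the field
  and bring in the regular matrix coefficients of a rational representation.\<close>

lemma dual_separates:
  fixes V :: "('k::field, 'v, 'e) module_scheme"
  assumes V: "vectorspace class_ring V" and fin_V: "vectorspace.fin_dim class_ring V"
    and v: "v \<in> carrier V" "v \<noteq> \<zero>\<^bsub>V\<^esub>"
  shows "\<exists>l\<in>dual V. l v \<noteq> 0"
proof -
  interpret vectorspace class_ring V by (rule V)
  obtain \<beta> where \<beta>: "finite \<beta>" "basis \<beta>" using finite_basis_exists[OF fin_V] by blast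
  have sub: "\<beta> \<subseteq> carrier V" using \<beta>(2) by (simp add: basis_def)
  have ex: "\<exists>!a. a \<in> \<beta> \<rightarrow>\<^sub>E UNIV \<and> lincomb a \<beta> = w" if "w \<in> carrier V" for w
    using basis_criterion[OF \<beta>(1) sub] \<beta>(2) that by simp
  define co where "co w = (THE a. a \<in> \<beta> \<rightarrow>\<^sub>E UNIV \<and> lincomb a \<beta> = w)" for w
  have co: "co w \<in> \<beta> \<rightarrow>\<^sub>E UNIV" "lincomb (co w) \<beta> = w" if "w \<in> carrier V" for w
    using theI'[OF ex[OF that]] by (simp_all add: co_def)
  have coI: "co w b = a b" if "w \<in> carrier V" "lincomb a \<beta> = w" "b \<in> \<beta>" for w a b
  proof -
    have "lincomb (restrict a \<beta>) \<beta> = lincomb a \<beta>"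
      using sub by (intro lincomb_cong) auto
    then have "co w = restrict a \<beta>"
      using ex[OF that(1)] co[OF that(1)] that(2) by (metis UNIV_I restrict_PiE_iff)
    then show ?thesis using that(3) by simp
  qed
  have co_dual: "(\<lambda>w. co w b) \<in> dual V" if b: "b \<in> \<beta>" for b
    unfolding dual_iff
  proof (intro conjI ballI allI)
    fix w z assume wz: "w \<in> carrier V" "z \<in> carrier V"
    show "co (w \<oplus>\<^bsub>V\<^esub> z) b = co w b + co z b"
      using lincomb_sum[OF \<beta>(1) sub, of "co w" "co z"] wz b co(2)
      by (intro coI[of "w \<oplus>\<^bsub>V\<^esub> z" "\<lambda>b. co w b + co z b" b]) simp_all
  next
    fix c w assume w: "w \<in> carrier V"
    show "co (c \<odot>\<^bsub>V\<^esub> w) b = c * co w b"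
      using lincomb_smult[OF sub, of "co w" c] w b co(2) smult_closed[of c w]
      by (intro coI[of "c \<odot>\<^bsub>V\<^esub> w" "\<lambda>b. c * co w b" b]) simp_all
  qed
  have "\<exists>b\<in>\<beta>. co v b \<noteq> 0"
  proof (rule ccontr)
    assume "\<not> ?thesis"
    then have "lincomb (co v) \<beta> = lincomb (\<lambda>b. 0) \<beta>"
      using sub by (intro lincomb_cong) auto
    also have "\<dots> = \<zero>\<^bsub>V\<^esub>"
      using lincomb_zero[OF sub, of "\<lambda>b. 0"] by simp
    finally show False using co(2)[OF v(1)] v(2) by simp
  qed
  then obtain b where "b \<in> \<beta>" "co v b \<noteq> 0" ..
  then show ?thesis by (intro bexI[of _ "\<lambda>w. co w b"] co_dual)
qed

section \<open>Constant matrices and transvections\<close>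

definition const_mat :: "'a::comm_ring_1 mat \<Rightarrow> 'a poly mat" where
  "const_mat = map_mat (\<lambda>a. [:a:])"

lemma const_mat_hom: "const_mat \<in> hom (SL n) (SL n)"
proof -
  interpret h: comm_ring_hom "\<lambda>a::'a. [:a:]"
    by unfold_locales (simp_all only: pCons_one add_pCons mult_pCons_left smult_pCons smult_0_right pCons_0_0 add_0_right add_0_left mult_zero_left)
  show ?thesis unfolding hom_def
  proof (intro CollectI conjI funcsetI ballI)
    fix A B :: "'a mat" assume A: "A \<in> carrier (SL n)"
    then show "const_mat A \<in> carrier (SL n)"
      using h.hom_det[of A] by (simp add: SL_def const_mat_def)
    assume "B \<in> carrier (SL n)"
    then show "const_mat (A \<otimes>\<^bsub>SL n\<^esub> B) = const_mat A \<otimes>\<^bsub>SL n\<^esub> const_mat B"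
      using A h.mat_hom_mult[of A n n B n] by (simp add: SL_def const_mat_def)
  qed
qed

lemma const_mat_SL: "g \<in> carrier (SL n) \<Longrightarrow> const_mat g \<in> carrier (SL n)"
  using const_mat_hom by (auto simp: hom_def)

lemma eval_const_mat [simp]: "eval_at_0 (const_mat g) = g"
  by (intro eq_matI) (simp_all add: eval_at_0_def const_mat_def)

text \<open>The transvection \<open>1 + x p q^T\<close>. Only the matrix \<open>x p q^T\<close>
  enters, so scalars move freely among the three arguments.\<close>

definition tv :: "nat \<Rightarrow> 'a::field poly \<Rightarrow> (nat \<Rightarrow> 'a) \<Rightarrow> (nat \<Rightarrow> 'a) \<Rightarrow> 'a poly mat" where
  "tv n x p q = mat n n (\<lambda>(i, j). (if i = j then 1 else 0) + Polynomial.smult (p i * q j) x)"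

lemma tv_carrier [simp]: "tv n x p q \<in> carrier_mat n n" by (simp add: tv_def)

lemma tv_cong:
  "(\<And>i j. i < n \<Longrightarrow> j < n \<Longrightarrow> Polynomial.smult (p i * q j) x = Polynomial.smult (p' i * q' j) x') \<Longrightarrow> tv n x p q = tv n x' p' q'"
  by (intro eq_matI) (auto simp: tv_def)

text \<open>\<open>p q^T p' q'^T = (q^T p') p q'^T\<close>, so orthogonality removes the cross term.
  The three addition rules for \<open>tv\<close> below are special cases.\<close>

lemma tv_mult:
  assumes "(\<Sum>k<n. q k * p' k) = 0"
  shows "tv n x p q * tv n y p' q' = mat n n (\<lambda>(i, j).
    (if i = j then 1 else 0) + Polynomial.smult (p i * q j) x + Polynomial.smult (p' i * q' j) y)"
proof (rule eq_matI)
  fix i j assume "i < dim_row (mat n n (\<lambda>(i, j). (if i = j then 1 else 0) + Polynomial.smult (p i * q j) x + Polynomial.smult (p' i * q' j) y))"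
    "j < dim_col (mat n n (\<lambda>(i, j). (if i = j then 1 else 0) + Polynomial.smult (p i * q j) x + Polynomial.smult (p' i * q' j) y))"
  then have ij: "i < n" "j < n" by auto
  have "(tv n x p q * tv n y p' q') $$ (i, j)
      = (\<Sum>k<n. ((if i = k then 1 else 0) + Polynomial.smult (p i * q k) x) *
          ((if k = j then 1 else 0) + Polynomial.smult (p' k * q' j) y))"
    using ij by (simp add: tv_def scalar_prod_def lessThan_atLeast0)
  also have "\<dots> = (\<Sum>k<n. (if i = k then (if i = j then 1 else 0) else 0))
      + (\<Sum>k<n. if k = i then Polynomial.smult (p' i * q' j) y else 0)
      + (\<Sum>k<n. if k = j then Polynomial.smult (p i * q j) x else 0)
      + (\<Sum>k<n. Polynomial.smult (p i * q' j * (q k * p' k)) (x * y))"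
    unfolding sum.distrib[symmetric] by (intro sum.cong refl) (auto simp: algebra_simps)
  also have "(\<Sum>k<n. Polynomial.smult (p i * q' j * (q k * p' k)) (x * y)) = 0"
    unfolding smult_sum[symmetric] sum_distrib_left[symmetric] assms by simp
  finally show "(tv n x p q * tv n y p' q') $$ (i, j) = mat n n (\<lambda>(i, j).
    (if i = j then 1 else 0) + Polynomial.smult (p i * q j) x + Polynomial.smult (p' i * q' j) y) $$ (i, j)"
    using ij by (simp add: sum.delta)
qed (auto simp: tv_def)

lemma orth_commute: "orth n p q \<longleftrightarrow> (\<Sum>k<n. q k * p k) = 0"
  by (simp add: orth_def mult.commute)

lemma tv_add_param: "orth n p q \<Longrightarrow> tv n (x + y) p q = tv n x p q * tv n y p q"
  by (subst tv_mult) (auto simp: orth_commute tv_def smult_add_right intro!: eq_matI)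

lemma tv_add_right:
  "orth n p q \<Longrightarrow> tv n x p (\<lambda>i. q i + q' i) = tv n x p q * tv n x p q'"
  by (subst tv_mult) (auto simp: orth_commute tv_def smult_add_left distrib_left intro!: eq_matI)

lemma tv_add_left:
  "orth n p' q \<Longrightarrow> tv n x (\<lambda>i. p i + p' i) q = tv n x p q * tv n x p' q"
  by (subst tv_mult) (auto simp: orth_commute tv_def smult_add_left distrib_right intro!: eq_matI)

lemma tv_zero: "tv n 0 p q = 1\<^sub>m n" by (intro eq_matI) (auto simp: tv_def)

lemma eval_tv: "poly x 0 = 0 \<Longrightarrow> eval_at_0 (tv n x p q) = 1\<^sub>m n"
  by (intro eq_matI) (auto simp: tv_def eval_at_0_def)

text \<open>The determinant of \<open>1 + x p q\<^sup>T\<close> is a unit, with inverse \<open>det (1 - x p q\<^sup>T)\<close>, hence constant.\<close>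

lemma tv_SL:
  assumes x: "poly x 0 = 0" and pq: "orth n p q"
  shows "tv n x p q \<in> carrier (SL n)"
proof -
  interpret ev: comm_ring_hom "\<lambda>p::'a poly. poly p 0" by unfold_locales auto
  have "tv n x p q * tv n (- x) p q = 1\<^sub>m n"
    using tv_add_param[OF pq, of x "- x"] by (simp add: tv_zero)
  then have "det (tv n x p q) * det (tv n (- x) p q) = 1"
    by (metis det_mult tv_carrier det_one)
  then have "det (tv n x p q) dvd 1" by (metis dvd_triv_left)
  then obtain c where c: "det (tv n x p q) = [:c:]" by (auto simp: is_unit_poly_iff)
  have "map_mat (\<lambda>p. poly p 0) (tv n x p q) = 1\<^sub>m n"
    using eval_tv[OF x, of n p q] by (simp add: eval_at_0_def)
  then have "poly (det (tv n x p q)) 0 = 1"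
    using ev.hom_det[of "tv n x p q"] by (metis det_one)
  then have "det (tv n x p q) = 1" by (simp add: c one_pCons)
  then show ?thesis by (simp add: SL_def)
qed

text \<open>Conjugation by \<open>g\<close> sends \<open>p\<close> to \<open>g p\<close> and
  \<open>q^T\<close> to \<open>q^T g^-1\<close>; the relation has \<open>g\<close> on both sides
  instead of an inverse.\<close>

lemma tv_conj:
  assumes g: "g \<in> carrier_mat n n" and p: "\<And>i. i < n \<Longrightarrow> p' i = (\<Sum>k<n. g $$ (i, k) * p k)"
    and q: "\<And>j. j < n \<Longrightarrow> q j = (\<Sum>k<n. q' k * g $$ (k, j))"
  shows "const_mat g * tv n x p q = tv n x p' q' * const_mat g"
proof (rule eq_matI)
  fix i j assume "i < dim_row (tv n x p' q' * const_mat g)" "j < dim_col (tv n x p' q' * const_mat g)"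
  then have ij: "i < n" "j < n" using g by (auto simp: tv_def const_mat_def)
  have "(const_mat g * tv n x p q) $$ (i, j)
     = (\<Sum>k<n. [:g $$ (i, k):] * ((if k = j then 1 else 0) + Polynomial.smult (p k * q j) x))"
    using ij g by (simp add: tv_def const_mat_def scalar_prod_def lessThan_atLeast0)
  also have "\<dots> = (\<Sum>k<n. if k = j then [:g $$ (i, j):] else 0) + (\<Sum>k<n. Polynomial.smult (g $$ (i, k) * p k * q j) x)"
    unfolding sum.distrib[symmetric] by (intro sum.cong refl) (auto simp: algebra_simps)
  also have "\<dots> = [:g $$ (i, j):] + Polynomial.smult (p' i * q j) x"
    using ij by (simp add: p smult_sum sum_distrib_right)
  finally have L: "(const_mat g * tv n x p q) $$ (i, j) = [:g $$ (i, j):] + Polynomial.smult (p' i * q j) x" .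
  have "(tv n x p' q' * const_mat g) $$ (i, j)
     = (\<Sum>k<n. ((if i = k then 1 else 0) + Polynomial.smult (p' i * q' k) x) * [:g $$ (k, j):])"
    using ij g by (simp add: tv_def const_mat_def scalar_prod_def lessThan_atLeast0)
  also have "\<dots> = (\<Sum>k<n. if k = i then [:g $$ (i, j):] else 0) + (\<Sum>k<n. Polynomial.smult (p' i * (q' k * g $$ (k, j))) x)"
    unfolding sum.distrib[symmetric] by (intro sum.cong refl) (auto simp: algebra_simps)
  also have "\<dots> = [:g $$ (i, j):] + Polynomial.smult (p' i * q j) x"
    using ij by (simp add: q smult_sum sum_distrib_left)
  finally show "(const_mat g * tv n x p q) $$ (i, j) = (tv n x p' q' * const_mat g) $$ (i, j)" using L by simp
qed (use g in \<open>auto simp: tv_def const_mat_def\<close>)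

section \<open>Functionals on a rational representation\<close>

locale rational_SL_rep =
  fixes n :: nat and V :: "('a::field_char_0, 'v) module" and \<rho> :: "'a mat \<Rightarrow> 'v \<Rightarrow> 'v"
  assumes n: "n \<ge> 2" and rational: "rational_rep n V \<rho>"
begin

sublocale rep: linear_rep "SL n" class_ring V \<rho>
  using rational by (simp add: rational_rep_def)

lemma dual_zero: "l \<in> dual V \<Longrightarrow> l \<zero>\<^bsub>V\<^esub> = 0"
  using dual_smult[of l V "\<zero>\<^bsub>V\<^esub>" 0] by simp

lemma dual_comp: "l \<in> dual V \<Longrightarrow> g \<in> carrier (SL n) \<Longrightarrow> (\<lambda>v. l (\<rho> g v)) \<in> dual V"
  by (auto simp: dual_iff rep.rep_add rep.rep_smult rep.rep_closed)

lemma dual_minus: "l \<in> dual V \<Longrightarrow> v \<in> carrier V \<Longrightarrow> l (\<ominus>\<^bsub>V\<^esub> v) = - l v"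
  using dual_add[of l V v "\<ominus>\<^bsub>V\<^esub> v"] abelian_group.r_neg[OF module_abelian_group[OF rep.module_axioms], of v]
    abelian_group.a_inv_closed[OF module_abelian_group[OF rep.module_axioms], of v]
  by (simp add: dual_zero eq_neg_iff_add_eq_0 add.commute)

lemma dual_eqI:
  assumes v: "v \<in> carrier V" and w: "w \<in> carrier V" and eq: "\<And>l. l \<in> dual V \<Longrightarrow> l v = l w"
  shows "v = w"
proof -
  note A = module_abelian_group[OF rep.module_axioms]
  have fin: "vectorspace.fin_dim class_ring V" using rational by (simp add: rational_rep_def)
  have "\<ominus>\<^bsub>V\<^esub> w \<in> carrier V" using w by (rule abelian_group.a_inv_closed[OF A])
  moreover have "v \<oplus>\<^bsub>V\<^esub> \<ominus>\<^bsub>V\<^esub> w = \<zero>\<^bsub>V\<^esub>"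
  proof (rule ccontr)
    assume "v \<oplus>\<^bsub>V\<^esub> \<ominus>\<^bsub>V\<^esub> w \<noteq> \<zero>\<^bsub>V\<^esub>"
    moreover have "v \<oplus>\<^bsub>V\<^esub> \<ominus>\<^bsub>V\<^esub> w \<in> carrier V"
      using v \<open>\<ominus>\<^bsub>V\<^esub> w \<in> carrier V\<close> by simp
    ultimately obtain l where l: "l \<in> dual V" "l (v \<oplus>\<^bsub>V\<^esub> \<ominus>\<^bsub>V\<^esub> w) \<noteq> 0"
      using dual_separates[OF rep.vectorspace_axioms fin] by blast
    then show False
      using v w eq[OF l(1)] \<open>\<ominus>\<^bsub>V\<^esub> w \<in> carrier V\<close> by (simp add: dual_add dual_minus)
  qed
  ultimately show ?thesis
    using v w abelian_group.minus_equality[OF A, of v "\<ominus>\<^bsub>V\<^esub> w"] abelian_group.minus_minus[OF A w] by simp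
qed

lemma dual_finsum:
  assumes l: "l \<in> dual V" and "finite S" "\<And>i. i \<in> S \<Longrightarrow> f i \<in> carrier V"
  shows "l (finsum V f S) = (\<Sum>i\<in>S. l (f i))"
  using assms(2,3)
proof (induction S rule: finite_induct)
  case empty
  then show ?case by (simp add: dual_zero[OF l])
next
  case (insert i S)
  then have "finsum V f (insert i S) = f i \<oplus>\<^bsub>V\<^esub> finsum V f S"
    by (intro rep.M.finsum_insert) auto
  moreover have "finsum V f S \<in> carrier V" using insert.prems by (intro rep.M.finsum_closed) auto
  ultimately show ?case using insert by (simp add: dual_add[OF l])
qed

lemma dual_rep_laurent:
  assumes l: "l \<in> dual V" and v: "v \<in> carrier V" and A: "\<And>s. s \<noteq> 0 \<Longrightarrow> A s \<in> carrier (SL n)"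
    and "\<And>i j. i < n \<Longrightarrow> j < n \<Longrightarrow> \<exists>N P. \<forall>s. s \<noteq> 0 \<longrightarrow> s ^ N * A s $$ (i, j) = poly P s"
  shows "\<exists>N P. \<forall>s. s \<noteq> 0 \<longrightarrow> s ^ N * l (\<rho> (A s) v) = poly P s"
proof -
  obtain p where p: "p \<in> entry_polys n" "\<And>A. A \<in> carrier (SL n) \<Longrightarrow> l (\<rho> A v) = p A"
    using rational l v unfolding rational_rep_def regular_on_SL_def by blast
  then show ?thesis using entry_polys_laurent_curve[OF p(1) assms(4)] A by simp
qed

lemma dual_rep_polynomial:
  assumes l: "l \<in> dual V" and v: "v \<in> carrier V" and A: "\<And>s. A s \<in> carrier (SL n)"
    and "\<And>i j. i < n \<Longrightarrow> j < n \<Longrightarrow> \<exists>P. \<forall>s. A s $$ (i, j) = poly P s"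
  shows "\<exists>P. \<forall>s. l (\<rho> (A s) v) = poly P s"
proof -
  obtain p where p: "p \<in> entry_polys n" "\<And>A. A \<in> carrier (SL n) \<Longrightarrow> l (\<rho> A v) = p A"
    using rational l v unfolding rational_rep_def regular_on_SL_def by blast
  then show ?thesis using entry_polys_polynomial_curve[OF p(1) assms(4)] A by simp
qed

end

section \<open>Values of a cocycle on the matrices \<open>1 + x p q\<^sup>T\<close>\<close>

lemma sum_units_combination:
  assumes "i < n" "j < n"
  shows "(\<Sum>k<n. (a * unitv i k + b * unitv j k) * f k) = a * f i + b * (f j :: 'a::comm_ring_1)"
    "(\<Sum>k<n. f k * (a * unitv i k + b * unitv j k)) = a * f i + b * f j"
  using assms by (simp_all add: distrib_right distrib_left sum.distrib mult.assoc mult.left_commute[of "f _"] sum_distrib_left[symmetric])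

lemma bilinear_units:
  assumes "i < n" "j < n" "k < n" "l < n"
  shows "(\<Sum>r<n. \<Sum>s<n. (a * unitv i r + b * unitv j r) * (c * unitv k s + d * unitv l s) * M r s)
    = a * c * M i k + a * d * M i l + b * c * M j k + b * d * (M j l :: 'a::comm_ring_1)"
proof -
  have "(\<Sum>r<n. \<Sum>s<n. (a * unitv i r + b * unitv j r) * (c * unitv k s + d * unitv l s) * M r s)
     = (\<Sum>r<n. (a * unitv i r + b * unitv j r) * (\<Sum>s<n. (c * unitv k s + d * unitv l s) * M r s))"
    by (simp only: sum_distrib_left mult.assoc)
  also have "\<dots> = a * (\<Sum>s<n. (c * unitv k s + d * unitv l s) * M i s) + b * (\<Sum>s<n. (c * unitv k s + d * unitv l s) * M j s)"
    by (rule sum_units_combination(1)[OF assms(1,2)])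
  finally show ?thesis
    unfolding sum_units_combination(1)[OF assms(3,4)] by (simp add: algebra_simps)
qed

lemma orth_units:
  assumes "i < n" "j < n" "k < n" "l < n"
  shows "orth n (\<lambda>r. a * unitv i r + b * unitv j r) (\<lambda>r. c * unitv k r + d * unitv l r) \<longleftrightarrow>
    a * (c * unitv k i + d * unitv l i) + b * (c * unitv k j + d * unitv l j) = (0 :: 'a::comm_ring_1)"
  using assms by (simp add: orth_def sum_units_combination)

lemma orth_unitv: "i < n \<Longrightarrow> i \<noteq> j \<Longrightarrow> orth n (unitv i) (unitv j)"
  by (simp add: orth_def) (simp add: unitv_def)

lemma addrow_mat_polynomial:
  assumes "i < n" "j < n"
  shows "\<exists>P. \<forall>s. addrow_mat n s k l $$ (i, j) = poly P (s :: 'a::field)"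
  using assms
  by (intro exI[of _ "(if k = i \<and> l = j then [:0, 1:] else 0) + (if i = j then 1 else 0)"]) auto

definition torus :: "nat \<Rightarrow> nat \<Rightarrow> nat \<Rightarrow> 'a::field \<Rightarrow> 'a mat" where
  "torus n i j a = mat n n (\<lambda>(k, l). if k = l then (if k = i then a else if k = j then inverse a else 1) else 0)"

lemma torus_SL:
  assumes "i < n" "j < n" "i \<noteq> j" "a \<noteq> 0"
  shows "torus n i j a \<in> carrier (SL n)"
proof -
  let ?d = "\<lambda>k. if k = i then a else if k = j then inverse a else 1"
  have "det (torus n i j a) = prod_list (diag_mat (torus n i j a))"
    by (rule det_upper_triangular[of _ n]) (auto simp: torus_def)
  also have "\<dots> = (\<Prod>k\<in>{0..<n}. ?d k)"
    unfolding prod_list_diag_prod by (intro prod.cong) (auto simp: torus_def)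
  also have "\<dots> = (\<Prod>k\<in>{i, j}. ?d k)"
    using assms by (intro prod.mono_neutral_right) auto
  also have "\<dots> = 1" using assms by simp
  finally show ?thesis by (simp add: SL_def torus_def)
qed

locale SL_poly_cocycle = rational_SL_rep n V \<rho>
  for n :: nat and V :: "('a::field_char_0, 'v) module" and \<rho> :: "'a mat \<Rightarrow> 'v \<Rightarrow> 'v" +
  fixes c :: "'a poly mat list \<Rightarrow> 'v"
  assumes cocycle: "c \<in> cocycles (SL n) V (\<rho> \<circ> eval_at_0) 1"
begin

lemma poly_rep: "linear_rep (SL n) class_ring V (\<rho> \<circ> eval_at_0)"
  by (rule rep.linear_rep_comp[OF group_SL eval_at_0_hom])

lemma c_closed: "A \<in> carrier (SL n) \<Longrightarrow> c [A] \<in> carrier V"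
  using cocycle linear_rep.cochain_1[OF poly_rep, of c A] unfolding cocycles_def by blast

lemma c_mult:
  "A \<in> carrier (SL n) \<Longrightarrow> B \<in> carrier (SL n) \<Longrightarrow> c [A * B] = c [A] \<oplus>\<^bsub>V\<^esub> \<rho> (eval_at_0 A) (c [B])"
  using cocycle unfolding linear_rep.cocycles_1[OF poly_rep] by (simp add: SL_def)

lemma rep_one_mat: "v \<in> carrier V \<Longrightarrow> \<rho> (1\<^sub>m n) v = v"
  using rep.rep_one by (simp add: SL_def)

lemma c_mult_kernel:
  "A \<in> carrier (SL n) \<Longrightarrow> B \<in> carrier (SL n) \<Longrightarrow> eval_at_0 A = 1\<^sub>m n \<Longrightarrow> c [A * B] = c [A] \<oplus>\<^bsub>V\<^esub> c [B]"
  by (simp add: c_mult rep_one_mat c_closed)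

definition val :: "'a poly \<Rightarrow> (nat \<Rightarrow> 'a) \<Rightarrow> (nat \<Rightarrow> 'a) \<Rightarrow> 'v" where
  "val x p q = c [tv n x p q]"

lemma val_closed: "poly x 0 = 0 \<Longrightarrow> orth n p q \<Longrightarrow> val x p q \<in> carrier V"
  by (simp add: val_def c_closed tv_SL)

lemma val_cong:
  "(\<And>i j. i < n \<Longrightarrow> j < n \<Longrightarrow> Polynomial.smult (p i * q j) x = Polynomial.smult (p' i * q' j) x') \<Longrightarrow> val x p q = val x' p' q'"
  unfolding val_def by (subst tv_cong) auto

lemma val_add_param:
  "poly x 0 = 0 \<Longrightarrow> poly y 0 = 0 \<Longrightarrow> orth n p q \<Longrightarrow> val (x + y) p q = val x p q \<oplus>\<^bsub>V\<^esub> val y p q"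
  by (simp add: val_def tv_add_param c_mult_kernel tv_SL eval_tv)

lemma val_add_right:
  "poly x 0 = 0 \<Longrightarrow> orth n p q \<Longrightarrow> orth n p q' \<Longrightarrow> val x p (\<lambda>i. q i + q' i) = val x p q \<oplus>\<^bsub>V\<^esub> val x p q'"
  by (simp add: val_def tv_add_right c_mult_kernel tv_SL eval_tv)

lemma val_add_left:
  "poly x 0 = 0 \<Longrightarrow> orth n p q \<Longrightarrow> orth n p' q \<Longrightarrow> val x (\<lambda>i. p i + p' i) q = val x p q \<oplus>\<^bsub>V\<^esub> val x p' q"
  by (simp add: val_def tv_add_left c_mult_kernel tv_SL eval_tv)

text \<open>Expand \<open>c\<close> on both sides of \<open>g M = M' g\<close>, where
  \<open>M\<close> and \<open>M'\<close> are the two transvections. Since \<open>M'\<close>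
  evaluates to 1 it acts trivially and \<open>c\<close> of the constant matrix \<open>g\<close>
  cancels, so equivariance holds even if \<open>c\<close> does not vanish on constant
  matrices.\<close>

lemma val_conj:
  assumes x: "poly x 0 = 0" and g: "g \<in> carrier (SL n)" and pq: "orth n p q"
    and p: "\<And>i. i < n \<Longrightarrow> p' i = (\<Sum>k<n. g $$ (i, k) * p k)"
    and q: "\<And>j. j < n \<Longrightarrow> q j = (\<Sum>k<n. q' k * g $$ (k, j))"
  shows "orth n p' q'" "val x p' q' = \<rho> g (val x p q)"
proof -
  have "(\<Sum>i<n. p' i * q' i) = (\<Sum>i<n. \<Sum>k<n. p k * (q' i * g $$ (i, k)))"
    by (simp add: p sum_distrib_right sum_distrib_left mult_ac)
  also have "\<dots> = (\<Sum>k<n. p k * q k)" by (subst sum.swap) (simp add: q sum_distrib_left)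
  finally show o: "orth n p' q'" using pq by (simp add: orth_def)
  have gm: "g \<in> carrier_mat n n" using g by (simp add: SL_def)
  have "c [const_mat g * tv n x p q] = c [tv n x p' q' * const_mat g]"
    by (subst tv_conj[OF gm p q]) auto
  then have "c [const_mat g] \<oplus>\<^bsub>V\<^esub> \<rho> g (val x p q) = c [const_mat g] \<oplus>\<^bsub>V\<^esub> val x p' q'"
    using x g pq o by (simp add: c_mult const_mat_SL tv_SL eval_tv rep_one_mat c_closed val_def)
      (simp add: rep.M.a_comm c_closed const_mat_SL tv_SL)
  then have "l (val x p' q') = l (\<rho> g (val x p q))" if "l \<in> dual V" for l
    using dual_add[OF that, of "c [const_mat g]"] x g pq o
    by (metis add_left_cancel c_closed const_mat_SL rep.rep_closed val_closed)
  then show "val x p' q' = \<rho> g (val x p q)"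
    using x g pq o by (intro dual_eqI) (simp_all add: val_closed rep.rep_closed)
qed

text \<open>The cocycle rule itself only gives additivity in \<open>x\<close>. Conjugation by the
  torus turns \<open>x\<close> into \<open>s^2 x\<close>, and rationality makes the value a Laurent
  polynomial in \<open>s\<close>, which is the input of \<open>additive_homogeneous\<close>.\<close>

lemma dual_val_smult:
  assumes l: "l \<in> dual V" and x: "poly x 0 = 0" and ij: "i < n" "j < n" "i \<noteq> j"
  shows "l (val (Polynomial.smult a x) (unitv i) (unitv j)) = a * l (val x (unitv i) (unitv j))"
proof -
  let ?\<psi> = "\<lambda>a. l (val (Polynomial.smult a x) (unitv i) (unitv j))"
  have o: "orth n (unitv i :: nat \<Rightarrow> 'a) (unitv j)" by (rule orth_unitv[OF ij(1,3)])
  have "\<exists>N P. \<forall>s. s \<noteq> 0 \<longrightarrow> s ^ N * l (\<rho> (torus n i j s) (val x (unitv i) (unitv j))) = poly P s"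
  proof (rule dual_rep_laurent[OF l val_closed[OF x o]])
    fix r s assume rs: "r < n" "s < n"
    show "\<exists>N P. \<forall>a. a \<noteq> 0 \<longrightarrow> a ^ N * torus n i j a $$ (r, s) = poly P a"
      using rs by (intro exI[of _ 1] exI[of _ "if r = s then (if r = i then [:0, 0, 1:] else if r = j then 1 else [:0, 1:]) else 0"])
        (simp add: torus_def)
  qed (use ij in \<open>simp add: torus_SL\<close>)
  then obtain N P where P: "\<And>s. s \<noteq> 0 \<Longrightarrow> s ^ N * l (\<rho> (torus n i j s) (val x (unitv i) (unitv j))) = poly P s"
    by blast
  have tor: "\<rho> (torus n i j s) (val x (unitv i) (unitv j)) = val (Polynomial.smult (s\<^sup>2) x) (unitv i) (unitv j)"
    if s: "s \<noteq> 0" for s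
  proof -
    have "val x (\<lambda>k. s * unitv i k) (\<lambda>k. s * unitv j k) = \<rho> (torus n i j s) (val x (unitv i) (unitv j))"
    proof (rule val_conj(2)[OF x torus_SL[OF ij s] o])
      show "s * unitv i k = (\<Sum>m<n. torus n i j s $$ (k, m) * unitv i m)" if "k < n" for k
      proof -
        have "(\<Sum>m<n. torus n i j s $$ (k, m) * unitv i m) = torus n i j s $$ (k, i)" using ij by simp
        then show ?thesis using that ij by (simp add: torus_def unitv_def)
      qed
      show "unitv j k = (\<Sum>m<n. s * unitv j m * torus n i j s $$ (m, k))" if "k < n" for k
        using that ij s by (simp add: mult.assoc sum_distrib_left[symmetric]) (simp add: torus_def unitv_def)
    qed
    also have "val x (\<lambda>k. s * unitv i k) (\<lambda>k. s * unitv j k) = val (Polynomial.smult (s\<^sup>2) x) (unitv i) (unitv j)"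
      by (rule val_cong) (simp add: power2_eq_square mult_ac)
    finally show ?thesis ..
  qed
  have "?\<psi> a = a * ?\<psi> 1"
  proof (rule additive_homogeneous)
    show "?\<psi> (a + b) = ?\<psi> a + ?\<psi> b" for a b
      using x o val_add_param[of "Polynomial.smult a x" "Polynomial.smult b x", OF _ _ o]
      by (simp add: smult_add_left dual_add[OF l] val_closed)
    show "s ^ N * ?\<psi> (s\<^sup>2) = poly P s" if "s \<noteq> 0" for s
      using P[OF that] by (simp add: tor[OF that])
  qed
  then show ?thesis by simp
qed

text \<open>\<open>pairl\<close> and \<open>pairr\<close> are \<open>e_i + s e_j\<close> and
  \<open>e_j - s e_i\<close>; their product is the conjugate of \<open>e_i e_j^T\<close> by
  \<open>1 + s E_ji\<close>. The explicit coefficients fit the two-term form of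
  \<open>sum_units_combination\<close>.\<close>

abbreviation pairl :: "nat \<Rightarrow> nat \<Rightarrow> 'a \<Rightarrow> nat \<Rightarrow> 'a" where
  "pairl i j s \<equiv> (\<lambda>k. 1 * unitv i k + s * unitv j k)"

abbreviation pairr :: "nat \<Rightarrow> nat \<Rightarrow> 'a \<Rightarrow> nat \<Rightarrow> 'a" where
  "pairr i j s \<equiv> (\<lambda>k. 1 * unitv j k + (- s) * unitv i k)"

lemma val_pair:
  assumes x: "poly x 0 = 0" and ij: "i < n" "j < n" "i \<noteq> j"
  shows "orth n (pairl i j s) (pairr i j s)"
    "val x (pairl i j s) (pairr i j s) = \<rho> (addrow_mat n s j i) (val x (unitv i) (unitv j))"
proof -
  have 1: "pairl i j s r = (\<Sum>k<n. addrow_mat n s j i $$ (r, k) * unitv i k)" if "r < n" for r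
    using that ij by simp (simp add: unitv_def)
  have 2: "unitv j r = (\<Sum>k<n. pairr i j s k * addrow_mat n s j i $$ (k, r))" if "r < n" for r
    unfolding sum_units_combination(1)[OF ij(2,1)] using that ij by simp (simp add: unitv_def)
  show "orth n (pairl i j s) (pairr i j s)"
    "val x (pairl i j s) (pairr i j s) = \<rho> (addrow_mat n s j i) (val x (unitv i) (unitv j))"
    by (rule val_conj[OF x addrow_mat_SL[OF ij(3)[symmetric]] orth_unitv[OF ij(1,3)] 1 2]; assumption)+
qed

lemma dual_val_pair_smult:
  assumes "l \<in> dual V" "poly x 0 = 0" "i < n" "j < n" "i \<noteq> j"
  shows "l (val (Polynomial.smult a x) (pairl i j s) (pairr i j s)) = a * l (val x (pairl i j s) (pairr i j s))"
proof -
  have ax: "poly (Polynomial.smult a x) 0 = 0" using assms(2) by simp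
  have g: "addrow_mat n s j i \<in> carrier (SL n)" using assms(5) by (intro addrow_mat_SL) simp
  show ?thesis
    unfolding val_pair(2)[OF ax assms(3-5)] val_pair(2)[OF assms(2-5)]
    by (rule dual_val_smult[OF dual_comp[OF assms(1) g] assms(2-5)])
qed

text \<open>\<open>(e_i + s e_j)(e_j - s e_i)^T\<close> equals \<open>- s^2\<close> times the same
  expression with \<open>i\<close>, \<open>j\<close> exchanged and \<open>1 / s\<close> in place of
  \<open>s\<close>. Together with polynomial dependence on \<open>s\<close> this is the situation of
  \<open>quadratic_of_inversion\<close>.\<close>

lemma dual_val_pair:
  assumes l: "l \<in> dual V" and x: "poly x 0 = 0" and ij: "i < n" "j < n" "i \<noteq> j"
  shows "l (val x (pairl i j s) (pairr i j s)) = l (val x (unitv i) (unitv j))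
     + s * (l (val x (pairl i j 1) (pairr i j 1)) - l (val x (unitv i) (unitv j)) + l (val x (unitv j) (unitv i)))
     - s\<^sup>2 * l (val x (unitv j) (unitv i))"
proof -
  have pol: "\<exists>f. \<forall>s. l (val x (pairl i j s) (pairr i j s)) = poly f s" if ij: "i < n" "j < n" "i \<noteq> j" for i j
    unfolding val_pair(2)[OF x ij]
    by (rule dual_rep_polynomial[OF l val_closed[OF x orth_unitv]])
      (use ij in \<open>auto intro: addrow_mat_SL addrow_mat_polynomial simp del: index_mat_addrow_mat\<close>)
  obtain f where f: "\<And>s. l (val x (pairl i j s) (pairr i j s)) = poly f s" using pol[OF ij] by blast
  obtain g where g: "\<And>s. l (val x (pairl j i s) (pairr j i s)) = poly g s"
    using pol[OF ij(2,1) ij(3)[symmetric]] by blast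
  have "poly f s = - (s\<^sup>2) * poly g (1 / s)" if s: "s \<noteq> 0" for s
  proof -
    have "poly f s = l (val (Polynomial.smult (- (s\<^sup>2)) x) (pairl j i (1 / s)) (pairr j i (1 / s)))"
      unfolding f[symmetric] using s
      by (intro arg_cong[of _ _ l] val_cong, unfold smult_smult, intro arg_cong2[of _ _ _ _ Polynomial.smult] refl)
        (simp add: power2_eq_square field_simps)
    also have "\<dots> = - (s\<^sup>2) * poly g (1 / s)"
      unfolding g[symmetric] by (rule dual_val_pair_smult[OF l x ij(2,1) ij(3)[symmetric]])
    finally show ?thesis .
  qed
  then have "poly f s = poly f 0 + s * (poly f 1 - poly f 0 + poly g 0) - s\<^sup>2 * poly g 0"
    by (rule quadratic_of_inversion)
  then show ?thesis unfolding f[symmetric] g[symmetric] by simp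
qed

text \<open>The coefficients of \<open>val x\<close> as a function of \<open>p q\<^sup>T\<close>. The diagonal ones are defined only up to a common
  summand, chosen so that \<open>coef x 0 0\<close> vanishes; the last case uses
  \<open>(e\<^sub>0 + e\<^sub>i) (e\<^sub>i - e\<^sub>0)\<^sup>T = E\<^sub>0\<^sub>i - E\<^sub>i\<^sub>0 + E\<^sub>i\<^sub>i - E\<^sub>0\<^sub>0\<close>.\<close>

definition coef :: "'a poly \<Rightarrow> nat \<Rightarrow> nat \<Rightarrow> 'v" where
  "coef x i j = (if i \<noteq> j then val x (unitv i) (unitv j) else if i = 0 then \<zero>\<^bsub>V\<^esub>
     else val x (pairl 0 i 1) (pairr 0 i 1) \<ominus>\<^bsub>V\<^esub> val x (unitv 0) (unitv i) \<oplus>\<^bsub>V\<^esub> val x (unitv i) (unitv 0))"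

lemma coef_closed:
  assumes "poly x 0 = 0" "i < n" "j < n"
  shows "coef x i j \<in> carrier V"
proof (cases "i = j \<and> i \<noteq> 0")
  case True
  note A = module_abelian_group[OF rep.module_axioms]
  have "val x (pairl 0 i 1) (pairr 0 i 1) \<in> carrier V"
    by (rule val_closed[OF assms(1) val_pair(1)[OF assms(1)]]) (use True assms n in auto)
  moreover have "val x (unitv 0) (unitv i) \<in> carrier V" "val x (unitv i) (unitv 0) \<in> carrier V"
    using True assms n by (auto intro!: val_closed orth_unitv)
  ultimately show ?thesis
    using True by (simp add: coef_def abelian_group.minus_closed[OF A])
next
  case False
  then show ?thesis using assms by (auto simp: coef_def intro!: val_closed orth_unitv)
qed

text \<open>The left side, \<open>U i j\<close> in the proof, plays the part of the value at
  \<open>E_jj - E_ii\<close>, a matrix which is not of the form \<open>p q^T\<close>. As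
  \<open>coef\<close> is normalised by \<open>U 0 k\<close>, it suffices that \<open>U\<close> is
  antisymmetric and additive along \<open>i\<close>, \<open>k\<close>, \<open>j\<close>.\<close>

lemma dual_coef_diff:
  assumes l: "l \<in> dual V" and x: "poly x 0 = 0" and ij: "i < n" "j < n" "i \<noteq> j"
  shows "l (val x (pairl i j 1) (pairr i j 1)) - l (val x (unitv i) (unitv j)) + l (val x (unitv j) (unitv i))
     = l (coef x j j) - l (coef x i i)"
proof -
  note A = module_abelian_group[OF rep.module_axioms]
  let ?t = "\<lambda>p q. l (val x p q)"
  define T where "T = (\<lambda>i j. ?t (unitv i) (unitv j))"
  define S where "S = (\<lambda>i j. ?t (pairl i j 1) (pairr i j 1))"
  define U where "U = (\<lambda>i j. S i j - T i j + T j i)"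
  have cong: "?t p q = ?t p' q'" if "\<And>i j. i < n \<Longrightarrow> j < n \<Longrightarrow> p i * q j = p' i * q' j" for p q p' q'
    by (intro arg_cong[of _ _ l] val_cong) (simp add: that)
  have right: "?t p (\<lambda>i. q i + q' i) = ?t p q + ?t p q'" if "orth n p q" "orth n p q'" for p q q'
    using that x by (simp add: val_add_right dual_add[OF l] val_closed)
  have left: "?t (\<lambda>i. p i + p' i) q = ?t p q + ?t p' q" if "orth n p q" "orth n p' q" for p q p'
    using that x by (simp add: val_add_left dual_add[OF l] val_closed)
  have zero: "?t p (\<lambda>i. 0) = 0" for p
    using right[of p "\<lambda>i. 0" "\<lambda>i. 0"] by (simp add: orth_def)
  have anti: "U i j + U j i = 0" if ij: "i < n" "j < n" "i \<noteq> j" for i j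
  proof -
    have "S j i = ?t (pairl i j 1) (pairr j i 1)" unfolding S_def by (rule cong) (simp add: add.commute)
    moreover have "?t (pairl i j 1) (\<lambda>k. pairr i j 1 k + pairr j i 1 k) = S i j + ?t (pairl i j 1) (pairr j i 1)"
      unfolding S_def by (rule right[OF val_pair(1)[OF x ij]]) (subst orth_units, use ij in \<open>auto simp: unitv_def\<close>)
    moreover have "?t (pairl i j 1) (\<lambda>k. pairr i j 1 k + pairr j i 1 k) = 0"
      using zero[of "pairl i j 1"] by simp
    ultimately show ?thesis by (simp add: U_def)
  qed
  have split: "?t (\<lambda>m. pairl i j 1 m + unitv k m) (pairr i j 1) = S i j + T k j - T k i"
    if ijk: "i < n" "j < n" "k < n" "i \<noteq> j" "k \<noteq> i" "k \<noteq> j" for i j k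
  proof -
    have o: "orth n (unitv k) (\<lambda>m. a * unitv r m + b * unitv s m)" if "r < n" "s < n" "r \<noteq> k" "s \<noteq> k" for a b r s
      using orth_units[of k n k r s 1 0 a b] ijk that by (simp add: unitv_def)
    have "?t (unitv k) (pairr i j 1) = T k j + ?t (unitv k) (\<lambda>m. - unitv i m)"
      unfolding T_def using right[of "unitv k" "unitv j" "\<lambda>m. - unitv i m"] o[of j j 1 0] o[of i i "- 1" 0] ijk by simp
    moreover have 0: "T k i + ?t (unitv k) (\<lambda>m. - unitv i m) = 0"
      unfolding T_def using right[of "unitv k" "unitv i" "\<lambda>m. - unitv i m"] o[of i i 1 0] o[of i i "- 1" 0] ijk zero[of "unitv k"] by simp
    moreover have "?t (\<lambda>m. pairl i j 1 m + unitv k m) (pairr i j 1) = S i j + ?t (unitv k) (pairr i j 1)"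
      unfolding S_def using ijk by (intro left val_pair(1)[OF x] o) auto
    moreover have "?t (unitv k) (\<lambda>m. - unitv i m) = - T k i"
      using 0 by (simp only: eq_neg_iff_add_eq_0 add.commute)
    ultimately show ?thesis by simp
  qed
  have chain: "U i j = U i k + U k j"
    if ijk: "i < n" "j < n" "k < n" "i \<noteq> j" "k \<noteq> i" "k \<noteq> j" for i j k
  proof -
    \<comment> \<open>The vector \<open>e_i + e_j + e_k\<close> is orthogonal to all differences of
      its summands, and \<open>e_j - e_i = (e_k - e_i) + (e_j - e_k)\<close>; computing the three
      values with \<open>split\<close> gives the chain rule.\<close>
    let ?p = "\<lambda>m. pairl i j 1 m + unitv k m"
    have o: "orth n ?p (pairr r s 1)" if "r \<in> {i, j, k}" "s \<in> {i, j, k}" "r \<noteq> s" for r s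
    proof -
      have rs: "s < n" "r < n" using that ijk by auto
      show ?thesis
        unfolding orth_def sum_units_combination(2)[OF rs] using that ijk by (auto simp: unitv_def)
    qed
    have "?t ?p (pairr i j 1) = ?t ?p (\<lambda>m. pairr i k 1 m + pairr k j 1 m)" by (rule cong) simp
    also have "\<dots> = ?t ?p (pairr i k 1) + ?t ?p (pairr k j 1)"
      using ijk by (intro right o) auto
    also have "?t ?p (pairr i k 1) = ?t (\<lambda>m. pairl i k 1 m + unitv j m) (pairr i k 1)"
      by (rule cong) (simp add: algebra_simps)
    also have "?t ?p (pairr k j 1) = ?t (\<lambda>m. pairl k j 1 m + unitv i m) (pairr k j 1)"
      by (rule cong) (simp add: algebra_simps)
    also have "?t (\<lambda>m. pairl i k 1 m + unitv j m) (pairr i k 1) = S i k + T j k - T j i"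
      by (rule split) (use ijk in auto)
    also have "?t (\<lambda>m. pairl k j 1 m + unitv i m) (pairr k j 1) = S k j + T i j - T i k"
      by (rule split) (use ijk in auto)
    also have "?t ?p (pairr i j 1) = S i j + T k j - T k i"
      by (rule split) (use ijk in auto)
    finally have eq: "S i j + T k j - T k i = S i k + T j k - T j i + (S k j + T i j - T i k)" .
    have "S i j = (S i j + T k j - T k i) + T k i - T k j" by simp
    also have "\<dots> = S i k + T j k - T j i + (S k j + T i j - T i k) + T k i - T k j" by (simp only: eq)
    finally have "S i j = \<dots>" .
    then show ?thesis unfolding U_def by simp
  qed
  have n0: "0 < n" using n by simp
  have coef0: "l (coef x k k) = (if k = 0 then 0 else U 0 k)" if "k < n" for k
  proof (cases "k = 0")
    case False
    have "val x (pairl 0 k 1) (pairr 0 k 1) \<in> carrier V"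
      by (rule val_closed[OF x val_pair(1)[OF x]]) (use False that n0 in auto)
    moreover have "val x (unitv 0) (unitv k) \<in> carrier V" "val x (unitv k) (unitv 0) \<in> carrier V"
      using False that n0 x by (auto intro!: val_closed orth_unitv)
    ultimately show ?thesis
      using False by (simp add: coef_def abelian_group.minus_eq[OF A] dual_add[OF l] dual_minus[OF l]
          abelian_group.a_inv_closed[OF A] U_def S_def T_def)
  qed (simp add: coef_def dual_zero[OF l])
  consider "i = 0" | "j = 0" | "i \<noteq> 0" "j \<noteq> 0" by blast
  then have "U i j = l (coef x j j) - l (coef x i i)"
  proof cases
    case 1
    then show ?thesis using coef0[OF ij(1)] coef0[OF ij(2)] ij by simp
  next
    case 2
    then show ?thesis using coef0[OF ij(1)] coef0[OF ij(2)] ij anti[OF n0 ij(1)] by (simp add: eq_neg_iff_add_eq_0 add.commute)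
  next
    case 3
    then show ?thesis
      using coef0[OF ij(1)] coef0[OF ij(2)] ij anti[OF n0 ij(1)] chain[OF ij(1,2) n0 ij(3)]
      by (simp add: eq_neg_iff_add_eq_0 algebra_simps)
  qed
  then show ?thesis by (simp only: U_def S_def T_def)
qed

text \<open>The difference of the two sides is biadditive on orthogonal pairs. It vanishes on unit
  vectors by homogeneity and on pairs in two coordinates by the quadratic formula, hence everywhere
  by \<open>biadditive_on_orthogonal_zero\<close>.\<close>

lemma dual_val:
  assumes l: "l \<in> dual V" and x: "poly x 0 = 0" and pq: "orth n p q"
  shows "l (val x p q) = (\<Sum>i<n. \<Sum>j<n. p i * q j * l (coef x i j))"
proof -
  define B where "B = (\<lambda>p q :: nat \<Rightarrow> 'a. \<Sum>i<n. \<Sum>j<n. p i * q j * l (coef x i j))"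
  have "l (val x p q) - B p q = 0"
  proof (rule biadditive_on_orthogonal_zero[OF _ _ _ _ _ pq, where D = "\<lambda>p q. l (val x p q) - B p q"])
    show "l (val x p q) - B p q = l (val x p' q') - B p' q'"
      if "\<And>i j. i < n \<Longrightarrow> j < n \<Longrightarrow> p i * q j = p' i * q' j" for p q p' q'
    proof -
      have "val x p q = val x p' q'" by (rule val_cong) (simp add: that)
      moreover have "B p q = B p' q'" unfolding B_def by (intro sum.cong refl) (simp add: that)
      ultimately show ?thesis by simp
    qed
    show "l (val x p (\<lambda>i. q i + q' i)) - B p (\<lambda>i. q i + q' i) = l (val x p q) - B p q + (l (val x p q') - B p q')"
      if "orth n p q" "orth n p q'" for p q q'
      using that x by (simp add: val_add_right dual_add[OF l] val_closed B_def distrib_left distrib_right sum.distrib)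
    show "l (val x (\<lambda>i. p i + p' i) q) - B (\<lambda>i. p i + p' i) q = l (val x p q) - B p q + (l (val x p' q) - B p' q)"
      if "orth n p q" "orth n p' q" for p q p'
      using that x by (simp add: val_add_left dual_add[OF l] val_closed B_def distrib_left distrib_right sum.distrib)
  next
    fix i j and a :: 'a assume ij: "i < n" "j < n" "i \<noteq> j"
    have "val x (\<lambda>k. a * unitv i k) (unitv j) = val (Polynomial.smult a x) (unitv i) (unitv j)"
      by (rule val_cong) (simp add: mult_ac)
    moreover have "B (\<lambda>k. a * unitv i k) (unitv j) = a * l (coef x i j)"
      using bilinear_units[of i n i j j a 0 1 0 "\<lambda>i j. l (coef x i j)"] ij by (simp add: B_def)
    ultimately show "l (val x (\<lambda>k. a * unitv i k) (unitv j)) - B (\<lambda>k. a * unitv i k) (unitv j) = 0"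
      using dual_val_smult[OF l x ij, of a] ij by (simp add: coef_def)
  next
    fix i j and a s :: 'a assume ij: "i < n" "j < n" "i \<noteq> j"
    let ?p = "\<lambda>k. a * (unitv i k + s * unitv j k)" and ?q = "\<lambda>k. unitv j k - s * unitv i k"
    have "val x ?p ?q = val (Polynomial.smult a x) (pairl i j s) (pairr i j s)"
      by (rule val_cong) (simp add: algebra_simps)
    then have 1: "l (val x ?p ?q) = a * (l (coef x i j) + s * (l (coef x j j) - l (coef x i i)) - s\<^sup>2 * l (coef x j i))"
      using dual_val_pair_smult[OF l x ij, of a s] dual_val_pair[OF l x ij, of s]
      unfolding dual_coef_diff[OF l x ij] using ij by (simp add: coef_def)
    have "B ?p ?q = B (\<lambda>k. a * unitv i k + a * s * unitv j k) (\<lambda>k. 1 * unitv j k + (- s) * unitv i k)"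
      by (simp add: algebra_simps)
    also have "\<dots> = a * 1 * l (coef x i j) + a * (- s) * l (coef x i i) + a * s * 1 * l (coef x j j) + a * s * (- s) * l (coef x j i)"
      unfolding B_def by (rule bilinear_units) (use ij in auto)
    finally show "l (val x ?p ?q) - B ?p ?q = 0"
      unfolding 1 by (simp add: algebra_simps power2_eq_square)
  qed
  then show ?thesis by (simp add: B_def)
qed

end

lemma sum_swap_4:
  "(\<Sum>r\<in>A. \<Sum>s\<in>B. \<Sum>i\<in>C. \<Sum>j\<in>D. F r s i j) = (\<Sum>i\<in>C. \<Sum>j\<in>D. \<Sum>r\<in>A. \<Sum>s\<in>B. F r s i j)"
proof -
  have "(\<Sum>r\<in>A. \<Sum>s\<in>B. \<Sum>i\<in>C. \<Sum>j\<in>D. F r s i j) = (\<Sum>r\<in>A. \<Sum>i\<in>C. \<Sum>s\<in>B. \<Sum>j\<in>D. F r s i j)"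
    by (intro sum.cong refl sum.swap)
  also have "\<dots> = (\<Sum>i\<in>C. \<Sum>r\<in>A. \<Sum>s\<in>B. \<Sum>j\<in>D. F r s i j)" by (rule sum.swap)
  also have "\<dots> = (\<Sum>i\<in>C. \<Sum>r\<in>A. \<Sum>j\<in>D. \<Sum>s\<in>B. F r s i j)"
    by (intro sum.cong refl sum.swap)
  also have "\<dots> = (\<Sum>i\<in>C. \<Sum>j\<in>D. \<Sum>r\<in>A. \<Sum>s\<in>B. F r s i j)"
    by (intro sum.cong refl sum.swap)
  finally show ?thesis .
qed

text \<open>The dual form of the fact that the matrices \<open>p q^T\<close> with orthogonal
  \<open>p\<close>, \<open>q\<close> span the traceless ones: \<open>N\<close> has zero off-diagonal
  entries and a constant diagonal, so pairing with it is a multiple of the trace.\<close>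

lemma traceless_annihilator:
  fixes N :: "nat \<Rightarrow> nat \<Rightarrow> 'a::comm_ring_1"
  assumes N: "\<And>p q. orth n p q \<Longrightarrow> (\<Sum>i<n. \<Sum>j<n. p i * q j * N i j) = 0"
    and X: "(\<Sum>i<n. X i i) = 0" and n: "0 < n"
  shows "(\<Sum>i<n. \<Sum>j<n. X i j * N i j) = 0"
proof -
  have off: "N i j = 0" if ij: "i < n" "j < n" "i \<noteq> j" for i j
    using N[of "\<lambda>r. 1 * unitv i r + 0 * unitv i r" "\<lambda>r. 1 * unitv j r + 0 * unitv j r"] ij
    unfolding bilinear_units[OF ij(1,1) ij(2,2)] orth_units[OF ij(1,1) ij(2,2)]
    by (simp add: unitv_def)
  have diag: "N i i = N 0 0" if i: "i < n" for i
  proof (cases "i = 0")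
    case False
    have o: "orth n (\<lambda>r. 1 * unitv i r + 1 * unitv 0 r) (\<lambda>r. 1 * unitv i r + (- 1) * unitv 0 r :: 'a)"
      unfolding orth_units[OF i n i n] using False by (simp add: unitv_def)
    have "N i 0 = 0" "N 0 i = 0" using off i n False by auto
    then show ?thesis using N[OF o] unfolding bilinear_units[OF i n i n] by simp
  qed simp
  have "(\<Sum>i<n. \<Sum>j<n. X i j * N i j) = (\<Sum>i<n. \<Sum>j<n. if j = i then X i i * N 0 0 else 0)"
  proof (intro sum.cong refl)
    fix i j assume "i \<in> {..<n}" "j \<in> {..<n}"
    then show "X i j * N i j = (if j = i then X i i * N 0 0 else 0)"
      using off[of i j] diag[of i] by (cases "j = i") auto
  qed
  also have "\<dots> = (\<Sum>i<n. X i i) * N 0 0" by (simp add: sum_distrib_right)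
  finally show ?thesis using X by simp
qed

lemma inv_SL_addrow_mat:
  assumes "i < n" "j < n" "i \<noteq> j"
  shows "inv\<^bsub>SL n\<^esub> (addrow_mat n s i j) = addrow_mat n (- s :: 'a::comm_ring_1) i j"
proof -
  interpret G: group "SL n :: 'a mat monoid" by (rule group_SL)
  show ?thesis
    using addrow_mat_inv[OF assms, of "- s"] assms
    by (intro G.inv_equality) (auto simp: SL_def det_addrow_mat)
qed

text \<open>The entries of \<open>(1 + s E_ij) X (1 - s E_ij)\<close>, whose quadratic term is
  \<open>E_ij X E_ij = X_ji E_ij\<close>.\<close>

lemma Ad_addrow_mat_index:
  assumes X: "X \<in> carrier_mat n n" and ij: "i < n" "j < n" "i \<noteq> j" and rc: "r < n" "c < n"
  shows "Ad n (addrow_mat n s i j) X $$ (r, c) = X $$ (r, c) + (if r = i then s * X $$ (j, c) else 0)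
     - (if c = j then s * X $$ (r, i) else 0) - (if r = i \<and> c = j then s\<^sup>2 * X $$ (j, i) else 0)"
proof -
  have Y: "addrow s i j X \<in> carrier_mat n n" using X by simp
  have "Ad n (addrow_mat n s i j) X = addrow s i j X * addrow_mat n (- s) i j"
    unfolding Ad_def inv_SL_addrow_mat[OF ij] by (simp only: addrow_mat[OF X ij(2)])
  also have "\<dots> = addcol (- s) j i (addrow s i j X)"
    by (rule addcol_mat[OF Y ij(1), symmetric])
  finally have "Ad n (addrow_mat n s i j) X = addcol (- s) j i (addrow s i j X)" .
  then show ?thesis using X ij rc by (auto simp: power2_eq_square algebra_simps)
qed

section \<open>The induced map on the adjoint representation\<close>

definition outer :: "nat \<Rightarrow> (nat \<Rightarrow> 'a::times) \<Rightarrow> (nat \<Rightarrow> 'a) \<Rightarrow> 'a mat" where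
  "outer n p q = mat n n (\<lambda>(i, j). p i * q j)"

lemma outer_carrier [simp]: "outer n p q \<in> carrier_mat n n" by (simp add: outer_def)

lemma mat_trace_outer: "mat_trace (outer n p q) = (\<Sum>i<n. p i * q i)"
  by (simp add: mat_trace_def outer_def)

lemma sl_vs_carrier: "X \<in> carrier (sl_vs n) \<longleftrightarrow> X \<in> carrier_mat n n \<and> mat_trace X = 0"
  by (simp add: sl_vs_def)

lemma tv_units: "k < n \<Longrightarrow> l < n \<Longrightarrow> k \<noteq> l \<Longrightarrow> tv n x (unitv k) (unitv l) = addrow_mat n x k l"
  by (intro eq_matI) (auto simp: tv_def unitv_def)

lemma addrow_mat_split:
  assumes "k < n" "l < n" "k \<noteq> l"
  shows "addrow_mat n f k l = const_mat (addrow_mat n (poly f 0) k l) * tv n (f - [:poly f 0:]) (unitv k) (unitv l)"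
proof -
  have "const_mat (addrow_mat n (poly f 0) k l) = addrow_mat n [:poly f 0:] k l"
  proof (rule eq_matI)
    fix r c assume "r < dim_row (addrow_mat n [:poly f 0:] k l)" "c < dim_col (addrow_mat n [:poly f 0:] k l)"
    then show "const_mat (addrow_mat n (poly f 0) k l) $$ (r, c) = addrow_mat n [:poly f 0:] k l $$ (r, c)"
      using assms(3) by (auto simp: const_mat_def)
  qed (auto simp: const_mat_def)
  then show ?thesis
    unfolding tv_units[OF assms] using assms
    by (simp add: addrow_mat[symmetric, of _ n n]) (intro eq_matI; auto)
qed

context SL_poly_cocycle begin

lemma rep_zero: "g \<in> carrier (SL n) \<Longrightarrow> \<rho> g \<zero>\<^bsub>V\<^esub> = \<zero>\<^bsub>V\<^esub>"
  by (rule dual_eqI) (simp_all add: rep.rep_closed dual_zero dual_zero[OF dual_comp])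

text \<open>Conjugation by \<open>1 + E_ki\<close> or \<open>1 - E_jk\<close> adds a unit vector to
  one argument, and additivity carries the vanishing to another row or column. The step from
  \<open>(i, j)\<close> to \<open>(j, i)\<close>, the only one left when \<open>n = 2\<close>, comes
  from the quadratic formula instead.\<close>

lemma val_zero_propagate:
  assumes x: "poly x 0 = 0" and ij: "i < n" "j < n" "i \<noteq> j" and zero: "val x (unitv i) (unitv j) = \<zero>\<^bsub>V\<^esub>"
    and kl: "k < n" "l < n" "k \<noteq> l"
  shows "val x (unitv k) (unitv l) = \<zero>\<^bsub>V\<^esub>"
proof -
  have cl: "val x (unitv i) (unitv j) \<in> carrier V" if "i < n" "i \<noteq> j" for i j
    using x that by (intro val_closed orth_unitv)
  have row: "val x (unitv k) (unitv j) = \<zero>\<^bsub>V\<^esub>"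
    if ij: "i < n" "j < n" "i \<noteq> j" and zero: "val x (unitv i) (unitv j) = \<zero>\<^bsub>V\<^esub>" and k: "k < n" "k \<noteq> j" for i j k
  proof (cases "k = i")
    case False
    have g: "addrow_mat n (1::'a) k i \<in> carrier (SL n)" using False by (intro addrow_mat_SL)
    have "val x (\<lambda>r. unitv i r + unitv k r) (unitv j) = \<rho> (addrow_mat n 1 k i) (val x (unitv i) (unitv j))"
    proof (rule val_conj(2)[OF x g orth_unitv[OF ij(1,3)]])
      show "unitv i r + unitv k r = (\<Sum>m<n. addrow_mat n (1::'a) k i $$ (r, m) * unitv i m)" if "r < n" for r
        using that ij False by simp (simp add: unitv_def)
      show "unitv j r = (\<Sum>m<n. unitv j m * addrow_mat n (1::'a) k i $$ (m, r))" if "r < n" for r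
        using that ij k by simp (simp add: unitv_def)
    qed
    moreover have "val x (\<lambda>r. unitv i r + unitv k r) (unitv j) = val x (unitv i) (unitv j) \<oplus>\<^bsub>V\<^esub> val x (unitv k) (unitv j)"
      using ij k x by (intro val_add_left orth_unitv)
    ultimately show ?thesis using zero rep_zero[OF g] cl[OF k] by simp
  qed (use zero in simp)
  have col: "val x (unitv i) (unitv k) = \<zero>\<^bsub>V\<^esub>"
    if ij: "i < n" "j < n" "i \<noteq> j" and zero: "val x (unitv i) (unitv j) = \<zero>\<^bsub>V\<^esub>" and k: "k < n" "k \<noteq> i" for i j k
  proof (cases "k = j")
    case False
    have g: "addrow_mat n (- 1::'a) j k \<in> carrier (SL n)" using False by (intro addrow_mat_SL) simp
    have "val x (unitv i) (\<lambda>r. unitv j r + unitv k r) = \<rho> (addrow_mat n (- 1) j k) (val x (unitv i) (unitv j))"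
    proof (rule val_conj(2)[OF x g orth_unitv[OF ij(1,3)]])
      show "unitv i r = (\<Sum>m<n. addrow_mat n (- 1::'a) j k $$ (r, m) * unitv i m)" if "r < n" for r
        using that ij k by simp (simp add: unitv_def)
      show "unitv j r = (\<Sum>m<n. (unitv j m + unitv k m) * addrow_mat n (- 1::'a) j k $$ (m, r))" if "r < n" for r
        unfolding distrib_right sum.distrib using that ij k False by simp (simp add: unitv_def)
    qed
    moreover have "val x (unitv i) (\<lambda>r. unitv j r + unitv k r) = val x (unitv i) (unitv j) \<oplus>\<^bsub>V\<^esub> val x (unitv i) (unitv k)"
      using ij k x by (intro val_add_right orth_unitv) auto
    ultimately show ?thesis using zero rep_zero[OF g] cl[OF ij(1) k(2)[symmetric]] by simp
  qed (use zero in simp)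
  have swap: "val x (unitv j) (unitv i) = \<zero>\<^bsub>V\<^esub>"
  proof (rule dual_eqI)
    fix l assume l: "l \<in> dual V"
    have 0: "val x (pairl i j s) (pairr i j s) = \<zero>\<^bsub>V\<^esub>" for s
      unfolding val_pair(2)[OF x ij] zero using ij by (intro rep_zero addrow_mat_SL) simp
    \<comment> \<open>All values on the curve are zero, being conjugate to
      \<open>val x (unitv i) (unitv j)\<close>. At \<open>s = 1\<close> the quadratic formula is a
      tautology; at \<open>s = - 1\<close> it isolates twice the remaining coefficient.\<close>
    have "- 2 * l (val x (unitv j) (unitv i)) = 0"
      using dual_val_pair[OF l x ij, of "- 1"] unfolding 0 zero dual_zero[OF l] by simp
    then show "l (val x (unitv j) (unitv i)) = l \<zero>\<^bsub>V\<^esub>" using dual_zero[OF l] by simp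
  qed (use cl ij in auto)
  show ?thesis
  proof (cases "k = j")
    case True
    then show ?thesis using col[OF ij(2,1) ij(3)[symmetric] swap] kl by auto
  next
    case False
    then show ?thesis using col[OF kl(1) ij(2) False row[OF ij zero kl(1) False] kl(2)] kl by auto
  qed
qed

text \<open>On traceless matrices this does not depend on the normalisation of the diagonal of
  \<open>coef\<close>, since a common summand there contributes a multiple of the trace.\<close>

definition phi :: "'a poly \<Rightarrow> 'a mat \<Rightarrow> 'v" where
  "phi x X = finsum V (\<lambda>(i, j). X $$ (i, j) \<odot>\<^bsub>V\<^esub> coef x i j) ({..<n} \<times> {..<n})"

lemma phi_closed: "poly x 0 = 0 \<Longrightarrow> phi x X \<in> carrier V"
  unfolding phi_def by (intro rep.M.finsum_closed) (auto intro!: rep.smult_closed coef_closed)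

lemma dual_phi:
  assumes "l \<in> dual V" "poly x 0 = 0"
  shows "l (phi x X) = (\<Sum>i<n. \<Sum>j<n. X $$ (i, j) * l (coef x i j))"
proof -
  have "l (phi x X) = (\<Sum>ij\<in>{..<n} \<times> {..<n}. l (case ij of (i, j) \<Rightarrow> X $$ (i, j) \<odot>\<^bsub>V\<^esub> coef x i j))"
    unfolding phi_def using assms by (intro dual_finsum) (auto intro!: rep.smult_closed coef_closed)
  also have "\<dots> = (\<Sum>(i, j)\<in>{..<n} \<times> {..<n}. X $$ (i, j) * l (coef x i j))"
    using assms by (intro sum.cong refl) (auto simp: dual_smult coef_closed)
  finally show ?thesis by (simp add: sum.cartesian_product)
qed

lemma phi_linear:
  assumes x: "poly x 0 = 0" and X: "X \<in> carrier_mat n n" "Y \<in> carrier_mat n n"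
  shows "phi x (X + Y) = phi x X \<oplus>\<^bsub>V\<^esub> phi x Y" "phi x (a \<cdot>\<^sub>m X) = a \<odot>\<^bsub>V\<^esub> phi x X"
  using x X by (intro dual_eqI; simp add: phi_closed dual_add dual_smult dual_phi distrib_right sum.distrib
      sum_distrib_left mult.assoc rep.smult_closed)+

lemma phi_outer: "poly x 0 = 0 \<Longrightarrow> orth n p q \<Longrightarrow> phi x (outer n p q) = val x p q"
  by (intro dual_eqI) (simp_all add: phi_closed val_closed dual_phi dual_val outer_def)

text \<open>Both sides are linear in \<open>X\<close> and agree on \<open>outer n p q\<close> for
  orthogonal \<open>p\<close>, \<open>q\<close> by \<open>val_conj\<close>. \<open>N\<close> holds
  the coefficients of their difference under a functional, so \<open>traceless_annihilator\<close>
  extends the equality to all traceless \<open>X\<close>.\<close>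

lemma phi_Ad:
  assumes x: "poly x 0 = 0" and g: "g \<in> carrier (SL n)" and X: "X \<in> carrier (sl_vs n)"
  shows "phi x (Ad n g X) = \<rho> g (phi x X)"
proof (rule dual_eqI)
  show "phi x (Ad n g X) \<in> carrier V" "\<rho> g (phi x X) \<in> carrier V"
    using x g by (auto intro: phi_closed rep.rep_closed)
  fix l assume l: "l \<in> dual V"
  let ?h = "inv\<^bsub>SL n\<^esub> g"
  have "?h \<in> carrier (SL n)" "?h \<otimes>\<^bsub>SL n\<^esub> g = \<one>\<^bsub>SL n\<^esub>"
    using group.inv_closed[OF group_SL g] group.l_inv[OF group_SL g] by auto
  then have h: "?h \<in> carrier_mat n n" "?h * g = 1\<^sub>m n" by (auto simp: SL_def)
  have gm: "g \<in> carrier_mat n n" using g by (simp add: SL_def)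
  have Xm: "X \<in> carrier_mat n n" "mat_trace X = 0" using X by (auto simp: sl_vs_carrier)
  have lg: "(\<lambda>v. l (\<rho> g v)) \<in> dual V" by (rule dual_comp[OF l g])
  define N where "N = (\<lambda>r s. (\<Sum>i<n. \<Sum>j<n. g $$ (i, r) * ?h $$ (s, j) * l (coef x i j)) - l (\<rho> g (coef x r s)))"
  have N: "(\<Sum>r<n. \<Sum>s<n. Y r s * N r s) = (\<Sum>i<n. \<Sum>j<n. (\<Sum>r<n. \<Sum>s<n. g $$ (i, r) * Y r s * ?h $$ (s, j)) * l (coef x i j))
      - (\<Sum>r<n. \<Sum>s<n. Y r s * l (\<rho> g (coef x r s)))" for Y
    unfolding N_def right_diff_distrib sum_subtractf sum_distrib_left sum_distrib_right
    by (subst sum_swap_4) (simp add: mult_ac)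
  have "(\<Sum>r<n. \<Sum>s<n. X $$ (r, s) * N r s) = 0"
  proof (rule traceless_annihilator[where X = "\<lambda>r s. X $$ (r, s)"])
    fix p q :: "nat \<Rightarrow> 'a" assume pq: "orth n p q"
    let ?p = "\<lambda>i. \<Sum>r<n. g $$ (i, r) * p r" and ?q = "\<lambda>j. \<Sum>s<n. q s * ?h $$ (s, j)"
    have q: "q j = (\<Sum>k<n. ?q k * g $$ (k, j))" if j: "j < n" for j
    proof -
      have "(\<Sum>k<n. ?q k * g $$ (k, j)) = (\<Sum>s<n. q s * (\<Sum>k<n. ?h $$ (s, k) * g $$ (k, j)))"
        unfolding sum_distrib_left sum_distrib_right by (subst sum.swap) (simp add: mult.assoc)
      also have "\<dots> = (\<Sum>s<n. q s * (?h * g) $$ (s, j))"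
        using h(1) gm j by (intro sum.cong refl) (simp add: scalar_prod_def lessThan_atLeast0)
      also have "\<dots> = (\<Sum>s<n. if s = j then q s else 0)"
        unfolding h(2) using j by (intro sum.cong refl) auto
      finally show ?thesis using j by simp
    qed
    have v: "orth n ?p ?q" "val x ?p ?q = \<rho> g (val x p q)"
      by (rule val_conj[OF x g pq refl q]; assumption)+
    have "(\<Sum>r<n. \<Sum>s<n. p r * q s * N r s) = (\<Sum>i<n. \<Sum>j<n. ?p i * ?q j * l (coef x i j))
        - (\<Sum>r<n. \<Sum>s<n. p r * q s * l (\<rho> g (coef x r s)))"
      unfolding N by (simp add: sum_product mult_ac)
    also have "\<dots> = l (val x ?p ?q) - l (\<rho> g (val x p q))"
      unfolding dual_val[OF l x v(1)] dual_val[OF lg x pq] ..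
    finally show "(\<Sum>r<n. \<Sum>s<n. p r * q s * N r s) = 0" using v(2) by simp
  next
    show "(\<Sum>i<n. X $$ (i, i)) = 0" using Xm by (simp add: mat_trace_def)
  qed (use n in simp)
  moreover have "(\<Sum>r<n. \<Sum>s<n. g $$ (i, r) * X $$ (r, s) * ?h $$ (s, j)) = Ad n g X $$ (i, j)" if "i < n" "j < n" for i j
  proof -
    have "Ad n g X $$ (i, j) = (\<Sum>r<n. g $$ (i, r) * (\<Sum>s<n. X $$ (r, s) * ?h $$ (s, j)))"
      using that gm Xm h(1) by (simp add: Ad_def scalar_prod_def lessThan_atLeast0)
    then show ?thesis by (simp add: sum_distrib_left mult.assoc)
  qed
  ultimately show "l (phi x (Ad n g X)) = l (\<rho> g (phi x X))"
    unfolding N using dual_phi[OF l x] dual_phi[OF lg x] by simp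
qed

lemma phi_linear_map: "poly x 0 = 0 \<Longrightarrow> linear_map class_ring (sl_vs n) V (phi x)"
  unfolding linear_map_def mod_hom_def mod_hom_axioms_def
  using sl_vs_is_vs[of n, where 'a = 'a] rep.vectorspace_axioms
  by (auto simp: vectorspace_def LinearCombinations.module_hom_def phi_closed phi_linear sl_vs_carrier)
     (simp_all add: sl_vs_def module_mat_simps phi_linear)

text \<open>Irreducibility of \<open>sl_n\<close> made concrete. The kernel is stable under
  \<open>Ad\<close>; second differences along \<open>1 + s E_ij\<close> produce multiples of
  \<open>X_ji E_ij\<close> and, once \<open>X\<close> is diagonal, first differences produce
  \<open>(X_jj - X_ii) E_ij\<close>. No nonzero multiple of \<open>E_ij\<close> is killed, so
  \<open>X\<close> is scalar, and trace zero makes it vanish.\<close>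

lemma phi_inj:
  assumes x: "poly x 0 = 0" and nz: "\<And>i j. i < n \<Longrightarrow> j < n \<Longrightarrow> i \<noteq> j \<Longrightarrow> val x (unitv i) (unitv j) \<noteq> \<zero>\<^bsub>V\<^esub>"
    and X: "X \<in> carrier (sl_vs n)" and phi0: "phi x X = \<zero>\<^bsub>V\<^esub>"
  shows "X = 0\<^sub>m n n"
proof -
  have Xm: "X \<in> carrier_mat n n" "mat_trace X = 0" using X by (auto simp: sl_vs_carrier)
  let ?E = "\<lambda>i j. outer n (unitv i) (unitv j) :: 'a mat"
  have Ad0: "phi x (Ad n (addrow_mat n s i j) X) = \<zero>\<^bsub>V\<^esub>" if "i \<noteq> j" for s i j
    using phi_Ad[OF x addrow_mat_SL[OF that] X] rep_zero[OF addrow_mat_SL[OF that]] phi0 by simp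
  have E: "a = 0" if ij: "i < n" "j < n" "i \<noteq> j" and az: "phi x (a \<cdot>\<^sub>m ?E i j) = \<zero>\<^bsub>V\<^esub>" for a i j
  proof (rule ccontr)
    assume a: "a \<noteq> 0"
    have c: "val x (unitv i) (unitv j) \<in> carrier V" using x ij by (intro val_closed orth_unitv)
    have "a \<odot>\<^bsub>V\<^esub> val x (unitv i) (unitv j) = \<zero>\<^bsub>V\<^esub>"
      using az phi_linear(2)[OF x outer_carrier outer_carrier, of a "unitv i" "unitv j"] phi_outer[OF x orth_unitv[OF ij(1,3)]] by simp
    then have lz: "a * l (val x (unitv i) (unitv j)) = 0" if "l \<in> dual V" for l
      using dual_smult[OF that c, of a] dual_zero[OF that] by simp
    have "val x (unitv i) (unitv j) = \<zero>\<^bsub>V\<^esub>"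
    proof (rule dual_eqI[OF c])
      fix l assume "l \<in> dual V"
      from lz[OF this] dual_zero[OF this] a show "l (val x (unitv i) (unitv j)) = l \<zero>\<^bsub>V\<^esub>" by simp
    qed simp
    then show False using nz[OF ij] by simp
  qed
  have off: "X $$ (j, i) = 0" if ij: "i < n" "j < n" "i \<noteq> j" for i j
  proof -
    have "Ad n (addrow_mat n 1 i j) X + Ad n (addrow_mat n (- 1) i j) X
        = 2 \<cdot>\<^sub>m X + (- 2 * X $$ (j, i)) \<cdot>\<^sub>m ?E i j" (is "?A + ?B = ?C + ?D")
    proof (rule eq_matI)
      fix r c assume "r < dim_row (?C + ?D)" "c < dim_col (?C + ?D)"
      then have rc: "r < n" "c < n" by (auto simp: outer_def)
      have "?A \<in> carrier_mat n n" "?B \<in> carrier_mat n n" using ij Xm by (auto intro!: Ad_closed addrow_mat_SL)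
      then show "(?A + ?B) $$ (r, c) = (?C + ?D) $$ (r, c)"
        using rc Xm ij by (auto simp: Ad_addrow_mat_index outer_def unitv_def)
    qed (use Xm ij in \<open>auto simp: outer_def carrier_matD[OF Ad_closed[OF addrow_mat_SL]]\<close>)
    moreover have "phi x (?A + ?B) = \<zero>\<^bsub>V\<^esub>"
      using ij Xm by (simp add: phi_linear(1)[OF x] Ad_closed addrow_mat_SL Ad0)
    moreover have "phi x (?C + ?D) = 2 \<odot>\<^bsub>V\<^esub> phi x X \<oplus>\<^bsub>V\<^esub> phi x ?D"
      using Xm by (simp add: phi_linear[OF x])
    ultimately have "phi x ?D = \<zero>\<^bsub>V\<^esub>"
      using phi_closed[OF x, of ?D] by (simp add: phi0)
    then show ?thesis using E[OF ij] by fastforce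
  qed
  have diag: "X $$ (j, j) = X $$ (i, i)" if ij: "i < n" "j < n" "i \<noteq> j" for i j
  proof -
    have "Ad n (addrow_mat n 1 i j) X = X + (X $$ (j, j) - X $$ (i, i)) \<cdot>\<^sub>m ?E i j" (is "?A = X + ?D")
    proof (rule eq_matI)
      fix r c assume "r < dim_row (X + ?D)" "c < dim_col (X + ?D)"
      then have rc: "r < n" "c < n" by (auto simp: outer_def)
      then show "?A $$ (r, c) = (X + ?D) $$ (r, c)"
        using Xm ij off by (auto simp: Ad_addrow_mat_index outer_def unitv_def)
    qed (use Xm ij in \<open>auto simp: outer_def carrier_matD[OF Ad_closed[OF addrow_mat_SL]]\<close>)
    then have "phi x X \<oplus>\<^bsub>V\<^esub> phi x ?D = \<zero>\<^bsub>V\<^esub>"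
      using Ad0[OF ij(3), of 1] Xm by (simp add: phi_linear(1)[OF x])
    then have "phi x ?D = \<zero>\<^bsub>V\<^esub>" using phi_closed[OF x, of ?D] by (simp add: phi0)
    then show ?thesis using E[OF ij] by fastforce
  qed
  have n0: "0 < n" using n by simp
  have d0: "X $$ (i, i) = X $$ (0, 0)" if "i < n" for i using diag[of 0 i] that n0 by (cases "i = 0") auto
  have "(\<Sum>i<n. X $$ (i, i)) = (\<Sum>i<n. X $$ (0, 0))" by (rule sum.cong) (use d0 in blast)+
  then have "(\<Sum>i<n. X $$ (0, 0)) = 0" using Xm by (simp add: mat_trace_def)
  then have z: "X $$ (0, 0) = 0" using n0 by simp
  show ?thesis
  proof (rule eq_matI)
    fix i j assume "i < dim_row (0\<^sub>m n n :: 'a mat)" "j < dim_col (0\<^sub>m n n :: 'a mat)"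
    then have ij: "i < n" "j < n" by auto
    then show "X $$ (i, j) = 0\<^sub>m n n $$ (i, j)"
      using off[of j i] d0[of i] z by (cases "i = j") auto
  qed (use Xm in auto)
qed

text \<open>Schur's argument: the image of \<open>phi x\<close> is a nonzero subrepresentation,
  hence \<open>V\<close>. For injectivity, a nonzero value at one position forces nonzero values at
  all by \<open>val_zero_propagate\<close>. The isomorphism asked for starts at \<open>V\<close>, so
  the witness is the inverse of \<open>phi x\<close>.\<close>

lemma rep_isomorphic_Ad:
  assumes irr: "rep_irreducible (SL n) class_ring V \<rho>"
    and x: "poly x 0 = 0" and ij: "i < n" "j < n" "i \<noteq> j" and nz: "val x (unitv i) (unitv j) \<noteq> \<zero>\<^bsub>V\<^esub>"
  shows "rep_isomorphic (SL n) class_ring V \<rho> (sl_vs n) (Ad n)"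
proof -
  interpret phi: linear_map class_ring "sl_vs n" V "phi x" by (rule phi_linear_map[OF x])
  interpret A: linear_rep "SL n" class_ring "sl_vs n" "Ad n" by (rule linear_rep_Ad)
  have im: "phi.imT = phi x ` carrier (sl_vs n)" by (simp add: phi.im_def)
  have "VectorSpace.subspace class_ring (phi x ` carrier (sl_vs n)) V"
    using phi.imT_is_subspace unfolding im .
  moreover have "\<forall>g\<in>carrier (SL n). \<forall>w\<in>phi x ` carrier (sl_vs n). \<rho> g w \<in> phi x ` carrier (sl_vs n)"
    by (auto simp: phi_Ad[OF x, symmetric] intro!: imageI A.rep_closed)
  moreover have "val x (unitv i) (unitv j) \<in> phi x ` carrier (sl_vs n)"
    using phi_outer[OF x orth_unitv[OF ij(1,3)], symmetric] orth_unitv[OF ij(1,3)]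
    by (intro image_eqI[of _ _ "outer n (unitv i) (unitv j)"]) (auto simp: sl_vs_carrier mat_trace_outer orth_def)
  ultimately have surj: "phi x ` carrier (sl_vs n) = carrier V"
    using irr nz unfolding rep_irreducible_def by blast
  have nz': "val x (unitv k) (unitv l) \<noteq> \<zero>\<^bsub>V\<^esub>" if "k < n" "l < n" "k \<noteq> l" for k l
    using val_zero_propagate[OF x that _ ij] nz by blast
  have inj: "inj_on (phi x) (carrier (sl_vs n))"
  proof (rule inj_onI)
    fix X Y assume X: "X \<in> carrier (sl_vs n)" and Y: "Y \<in> carrier (sl_vs n)" and eq: "phi x X = phi x Y"
    have m: "X \<in> carrier_mat n n" "Y \<in> carrier_mat n n" using X Y by (auto simp: sl_vs_carrier)
    have s: "X + (- 1) \<cdot>\<^sub>m Y \<in> carrier (sl_vs n)"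
      using X Y by (auto simp: sl_vs_carrier mat_trace_def sum_subtractf)
    have z: "phi x (X + (- 1) \<cdot>\<^sub>m Y) = \<zero>\<^bsub>V\<^esub>"
      using m x by (intro dual_eqI) (simp_all add: phi_closed phi_linear dual_add dual_smult dual_zero eq rep.smult_closed)
    have "X + (- 1) \<cdot>\<^sub>m Y = 0\<^sub>m n n" by (rule phi_inj[OF x _ s z]) (rule nz')
    then have 0: "(X + (- 1) \<cdot>\<^sub>m Y) $$ (r, c) = 0\<^sub>m n n $$ (r, c)" for r c by simp
    show "X = Y"
    proof (rule eq_matI)
      fix r c assume "r < dim_row Y" "c < dim_col Y"
      then show "X $$ (r, c) = Y $$ (r, c)" using 0[of r c] m by simp
    qed (use m in auto)
  qed
  let ?f = "inv_into (carrier (sl_vs n)) (phi x)"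
  have bij: "bij_betw (phi x) (carrier (sl_vs n)) (carrier V)" using inj surj by (simp add: bij_betw_def)
  have fcl: "?f v \<in> carrier (sl_vs n)" if "v \<in> carrier V" for v using that surj by (metis inv_into_into)
  have ff: "phi x (?f v) = v" if "v \<in> carrier V" for v using that surj by (metis f_inv_into_f)
  have fI: "?f v = X" if "X \<in> carrier (sl_vs n)" "phi x X = v" for v X using that inj by (metis inv_into_f_f)
  have "?f \<in> LinearCombinations.module_hom class_ring V (sl_vs n)"
    unfolding LinearCombinations.module_hom_def
    using fcl ff by (auto intro!: fI)
  then have "linear_map class_ring V (sl_vs n) ?f"
    using sl_vs_is_vs[of n, where 'a = 'a] rep.vectorspace_axioms
    by (simp add: linear_map_def mod_hom_def mod_hom_axioms_def vectorspace_def)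
  moreover have "bij_betw ?f (carrier V) (carrier (sl_vs n))" by (rule bij_betw_inv_into[OF bij])
  moreover have "?f (\<rho> g v) = Ad n g (?f v)" if "g \<in> carrier (SL n)" "v \<in> carrier V" for g v
    using that ff phi_Ad[OF x] A.rep_closed[OF that(1) fcl[OF that(2)]] fcl[OF that(2)] by (intro fI) auto
  ultimately show ?thesis unfolding rep_isomorphic_def by blast
qed

lemma cocycle_eq_zero:
  assumes const: "\<And>g. g \<in> carrier (SL n) \<Longrightarrow> c [const_mat g] = \<zero>\<^bsub>V\<^esub>"
    and ij: "i < n" "j < n" "i \<noteq> j"
    and zero: "\<And>x. poly x 0 = 0 \<Longrightarrow> val x (unitv i) (unitv j) = \<zero>\<^bsub>V\<^esub>"
    and A: "A \<in> carrier (SL n)"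
  shows "c [A] = \<zero>\<^bsub>V\<^esub>"
  using SL_elementary_products[OF A]
proof induction
  case one
  have "const_mat (1\<^sub>m n) = (1\<^sub>m n :: 'a poly mat)" by (intro eq_matI) (auto simp: const_mat_def pCons_one)
  then show ?case using const[of "1\<^sub>m n"] by (simp add: SL_def)
next
  case (mult A k l f)
  have A: "A \<in> carrier (SL n)" by (rule elementary_products_SL[OF mult.hyps(1)])
  have e: "addrow_mat n (poly f 0) k l \<in> carrier (SL n)" "addrow_mat n f k l \<in> carrier (SL n)"
    using mult.hyps by (auto intro: addrow_mat_SL)
  have x: "poly (f - [:poly f 0:]) 0 = 0" by simp
  have "c [tv n (f - [:poly f 0:]) (unitv k) (unitv l)] = \<zero>\<^bsub>V\<^esub>"
    using val_zero_propagate[OF x ij zero[OF x] mult.hyps(2-4)] by (simp add: val_def)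
  then have "c [addrow_mat n f k l] = \<zero>\<^bsub>V\<^esub>"
    unfolding addrow_mat_split[OF mult.hyps(2-4), of f] using e mult.hyps x
    by (simp add: c_mult const_mat_SL tv_SL orth_unitv const rep_zero)
  then show ?case using e A by (simp add: c_mult mult.IH rep_zero eval_at_0_SL)
qed

end

section \<open>Restriction to constant matrices\<close>

lemma linear_mapI:
  assumes "vectorspace K M" "vectorspace K N" "\<And>x. x \<in> carrier M \<Longrightarrow> f x \<in> carrier N"
    and "\<And>x y. x \<in> carrier M \<Longrightarrow> y \<in> carrier M \<Longrightarrow> f (x \<oplus>\<^bsub>M\<^esub> y) = f x \<oplus>\<^bsub>N\<^esub> f y"
    and "\<And>a x. a \<in> carrier K \<Longrightarrow> x \<in> carrier M \<Longrightarrow> f (a \<odot>\<^bsub>M\<^esub> x) = a \<odot>\<^bsub>N\<^esub> f x"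
  shows "linear_map K M N f"
  using assms by (simp add: linear_map_def mod_hom_def mod_hom_axioms_def vectorspace_def LinearCombinations.module_hom_def)

context Module.module begin

lemma quot_vs_ops:
  assumes N: "LinearCombinations.submodule R N M"
  shows "carrier (quot_vs M N) = (\<lambda>x. N +>\<^bsub>M\<^esub> x) ` carrier M"
    and "\<lbrakk>x \<in> carrier M; y \<in> carrier M\<rbrakk> \<Longrightarrow>
      (N +>\<^bsub>M\<^esub> x) \<oplus>\<^bsub>quot_vs M N\<^esub> (N +>\<^bsub>M\<^esub> y) = N +>\<^bsub>M\<^esub> (x \<oplus>\<^bsub>M\<^esub> y)"
    and "\<zero>\<^bsub>quot_vs M N\<^esub> = N"
    and "x \<in> carrier M \<Longrightarrow> N +>\<^bsub>M\<^esub> x = N \<longleftrightarrow> x \<in> N"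
proof -
  interpret S: abelian_subgroup N M by (rule submodule_abelian_subgroup[OF N])
  show "carrier (quot_vs M N) = (\<lambda>x. N +>\<^bsub>M\<^esub> x) ` carrier M"
    by (auto simp: quot_vs_def A_RCOSETS_def RCOSETS_def a_r_coset_def)
  show "(N +>\<^bsub>M\<^esub> x) \<oplus>\<^bsub>quot_vs M N\<^esub> (N +>\<^bsub>M\<^esub> y) = N +>\<^bsub>M\<^esub> (x \<oplus>\<^bsub>M\<^esub> y)"
    if "x \<in> carrier M" "y \<in> carrier M" for x y
    using S.a_rcos_sum[OF that] by (simp add: quot_vs_def)
  show "\<zero>\<^bsub>quot_vs M N\<^esub> = N" by (simp add: quot_vs_def)
  show "N +>\<^bsub>M\<^esub> x = N \<longleftrightarrow> x \<in> N" if "x \<in> carrier M" for x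
    using S.a_rcos_self[OF that] S.a_rcos_const by auto
qed

lemma coset_linear_map:
  assumes N: "LinearCombinations.submodule R N M" and R: "Ring.field R"
  shows "linear_map R M (quot_vs M N) (\<lambda>x. N +>\<^bsub>M\<^esub> x)"
  using quot_vs_ops[OF N] coset_smult[OF N] quot_vs_module[OF N] module_axioms R
  by (intro linear_mapI vectorspaceI) auto

text \<open>The induced map sends a coset \<open>X\<close> to the unique element of \<open>T ` X\<close>.\<close>

lemma quot_vs_isomorphic:
  assumes N: "LinearCombinations.submodule R N M" and T: "linear_map R M W T"
    and surj: "T ` carrier M = carrier W" and ker: "\<And>x. x \<in> carrier M \<Longrightarrow> T x = \<zero>\<^bsub>W\<^esub> \<longleftrightarrow> x \<in> N"
  shows "vs_isomorphic R (quot_vs M N) W"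
proof -
  interpret T: linear_map R M W T by fact
  interpret N: LinearCombinations.submodule R N M by fact
  define f where "f X = the_elem (T ` X)" for X
  have f: "f (N +>\<^bsub>M\<^esub> x) = T x" if x: "x \<in> carrier M" for x
  proof -
    have "T ` (N +>\<^bsub>M\<^esub> x) = {T x}"
    proof -
      have "T (h \<oplus>\<^bsub>M\<^esub> x) = T x" if h: "h \<in> N" for h
      proof -
        have "h \<in> carrier M" using h N.subset by blast
        then have "T (h \<oplus>\<^bsub>M\<^esub> x) = T h \<oplus>\<^bsub>W\<^esub> T x" using x by simp
        also have "T h = \<zero>\<^bsub>W\<^esub>" using ker[OF \<open>h \<in> carrier M\<close>] h by simp
        finally show ?thesis using x by simp
      qed
      then show ?thesis by (auto simp: a_r_coset_def' image_iff) (metis N.zero_closed)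
    qed
    then show ?thesis by (simp add: f_def)
  qed
  note ops = quot_vs_ops[OF N]
  have "linear_map R (quot_vs M N) W f"
  proof (rule linear_mapI)
    show "vectorspace R (quot_vs M N)"
      using quot_vs_module[OF N] T.V.vectorspace_axioms by (simp add: vectorspace_def)
    show "vectorspace R W" by (rule T.W.vectorspace_axioms)
    show "f X \<in> carrier W" if "X \<in> carrier (quot_vs M N)" for X using that f ops(1) by auto
    show "f (X \<oplus>\<^bsub>quot_vs M N\<^esub> Y) = f X \<oplus>\<^bsub>W\<^esub> f Y" if "X \<in> carrier (quot_vs M N)" "Y \<in> carrier (quot_vs M N)" for X Y
      using that f ops(1,2) by auto
    show "f (a \<odot>\<^bsub>quot_vs M N\<^esub> X) = a \<odot>\<^bsub>W\<^esub> f X" if "a \<in> carrier R" "X \<in> carrier (quot_vs M N)" for a X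
      using that f ops(1) coset_smult[OF N] by auto
  qed
  moreover have "bij_betw f (carrier (quot_vs M N)) (carrier W)"
  proof -
    have "f ` carrier (quot_vs M N) = carrier W"
      unfolding ops(1) image_image surj[symmetric] using f by (intro image_cong) auto
    moreover have "inj_on f (carrier (quot_vs M N))"
    proof (rule inj_onI)
      fix X Y assume XY: "X \<in> carrier (quot_vs M N)" "Y \<in> carrier (quot_vs M N)" "f X = f Y"
      then obtain x y where x: "x \<in> carrier M" "X = N +>\<^bsub>M\<^esub> x" and y: "y \<in> carrier M" "Y = N +>\<^bsub>M\<^esub> y"
        unfolding ops(1) by blast
      interpret S: abelian_subgroup N M by (rule submodule_abelian_subgroup[OF N])
      have "T (x \<ominus>\<^bsub>M\<^esub> y) = T x \<ominus>\<^bsub>W\<^esub> T y" using x y by simp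
      also have "\<dots> = \<zero>\<^bsub>W\<^esub>"
        using XY(3) x y f by (simp add: abelian_group.minus_eq[OF module_abelian_group[OF vectorspace.axioms(1)[OF T.W.vectorspace_axioms]]]
            abelian_group.r_neg[OF module_abelian_group[OF vectorspace.axioms(1)[OF T.W.vectorspace_axioms]]])
      finally have Tz: "T (x \<ominus>\<^bsub>M\<^esub> y) = \<zero>\<^bsub>W\<^esub>" .
      note A = module_abelian_group[OF module_axioms]
      have "x \<ominus>\<^bsub>M\<^esub> y \<in> carrier M" using x(1) y(1) by (rule abelian_group.minus_closed[OF A])
      then have "x \<ominus>\<^bsub>M\<^esub> y \<in> N" using ker Tz by blast
      moreover have "x = x \<ominus>\<^bsub>M\<^esub> y \<oplus>\<^bsub>M\<^esub> y"
        using x(1) y(1) abelian_group.a_inv_closed[OF A y(1)] abelian_group.l_neg[OF A y(1)]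
        by (simp add: abelian_group.minus_eq[OF A] M.a_assoc)
      ultimately have "x \<in> N +>\<^bsub>M\<^esub> y" unfolding a_r_coset_def' by blast
      from abelian_group.a_repr_independence[OF A this y(1)] S.a_subgroup
      show "X = Y" unfolding x(2) y(2) by simp
    qed
    ultimately show ?thesis by (simp add: bij_betw_def)
  qed
  ultimately show ?thesis unfolding vs_isomorphic_def by blast
qed

end

section \<open>Cocycles of degree one as functions of one group element\<close>

abbreviation (in linear_rep) cocycle_vs where
  "cocycle_vs \<equiv> (cochains G V 1)\<lparr>carrier := cocycles G V \<rho> 1\<rparr>"

lemma (in linear_rep) cocycle_vs: "vectorspace K cocycle_vs"
proof -
  interpret C: Module.module K "cochains G V 1" by (rule fun_vs_module)
  show ?thesis
    by (intro vectorspaceI vectorspace.axioms(2)[OF vectorspace_axioms] C.submodule_is_module[OF cocycles_1_submodule])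
qed

lemma (in linear_rep) cocycle_eqI:
  assumes "f \<in> cocycles G V \<rho> 1" "f' \<in> cocycles G V \<rho> 1" "\<And>g. g \<in> carrier G \<Longrightarrow> f [g] = f' [g]"
  shows "f = f'"
proof (rule extensionalityI)
  show "f \<in> extensional (tuples G 1)" "f' \<in> extensional (tuples G 1)"
    using assms(1,2) by (auto simp: cocycles_def fun_vs_def PiE_def)
  show "f gs = f' gs" if "gs \<in> tuples G 1" for gs using that assms(3) unfolding tuples_1 by blast
qed

lemma (in linear_rep) cocycle_vs_ops:
  "g \<in> carrier G \<Longrightarrow> (f \<oplus>\<^bsub>cocycle_vs\<^esub> f') [g] = f [g] \<oplus>\<^bsub>V\<^esub> f' [g]"
  "g \<in> carrier G \<Longrightarrow> (a \<odot>\<^bsub>cocycle_vs\<^esub> f) [g] = a \<odot>\<^bsub>V\<^esub> f [g]"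
  by (simp_all add: fun_vs_def tuples_def)

lemma (in linear_rep) cocycleI:
  assumes "\<And>g. g \<in> carrier G \<Longrightarrow> f g \<in> carrier V"
    and "\<And>g h. g \<in> carrier G \<Longrightarrow> h \<in> carrier G \<Longrightarrow> f (g \<otimes>\<^bsub>G\<^esub> h) = f g \<oplus>\<^bsub>V\<^esub> \<rho> g (f h)"
  shows "restrict (\<lambda>gs. f (hd gs)) (tuples G 1) \<in> cocycles G V \<rho> 1"
proof -
  have t: "[g] \<in> tuples G 1" if "g \<in> carrier G" for g using that by (simp add: tuples_def)
  have "restrict (\<lambda>gs. f (hd gs)) (tuples G 1) \<in> carrier (cochains G V 1)"
    using assms(1) tuples_1[of _ G] by (auto simp: fun_vs_def simp del: One_nat_def)
  then show ?thesis unfolding cocycles_1 using t assms(2) by (simp del: One_nat_def)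
qed

lemma (in linear_rep) cocycle_closed: "f \<in> cocycles G V \<rho> 1 \<Longrightarrow> g \<in> carrier G \<Longrightarrow> f [g] \<in> carrier V"
  by (rule cochain_1) (auto simp: cocycles_def)

lemma (in linear_rep) cocycle_mult:
  "f \<in> cocycles G V \<rho> 1 \<Longrightarrow> g \<in> carrier G \<Longrightarrow> h \<in> carrier G \<Longrightarrow> f [g \<otimes>\<^bsub>G\<^esub> h] = f [g] \<oplus>\<^bsub>V\<^esub> \<rho> g (f [h])"
  unfolding cocycles_1 by simp

lemma (in linear_rep) cocycle_one:
  assumes f: "f \<in> cocycles G V \<rho> 1"
  shows "f [\<one>\<^bsub>G\<^esub>] = \<zero>\<^bsub>V\<^esub>"
proof -
  have c: "f [\<one>\<^bsub>G\<^esub>] \<in> carrier V" using f by (intro cocycle_closed) auto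
  then have "f [\<one>\<^bsub>G\<^esub>] \<oplus>\<^bsub>V\<^esub> f [\<one>\<^bsub>G\<^esub>] = f [\<one>\<^bsub>G\<^esub>]"
    using cocycle_mult[OF f, of "\<one>\<^bsub>G\<^esub>" "\<one>\<^bsub>G\<^esub>"] by (simp add: rep_one)
  then show ?thesis using c by simp
qed

lemma (in linear_rep) coboundary_iff:
  "f \<in> coboundaries G V \<rho> 1 \<longleftrightarrow>
    f \<in> extensional (tuples G 1) \<and> (\<exists>v\<in>carrier V. \<forall>g\<in>carrier G. f [g] = \<rho> g v \<ominus>\<^bsub>V\<^esub> v)"
proof -
  have t: "[g] \<in> tuples G 1" if "g \<in> carrier G" for g using that by (simp add: tuples_def)
  show ?thesis
  proof (intro iffI; (elim conjE bexE)?)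
    assume "f \<in> coboundaries G V \<rho> 1"
    then show "f \<in> extensional (tuples G 1) \<and> (\<exists>v\<in>carrier V. \<forall>g\<in>carrier G. f [g] = \<rho> g v \<ominus>\<^bsub>V\<^esub> v)"
      unfolding coboundaries_1 using t by (auto simp del: One_nat_def)
  next
    fix v assume f: "f \<in> extensional (tuples G 1)" and v: "v \<in> carrier V" "\<forall>g\<in>carrier G. f [g] = \<rho> g v \<ominus>\<^bsub>V\<^esub> v"
    have "f = restrict (\<lambda>gs. \<rho> (hd gs) v \<ominus>\<^bsub>V\<^esub> v) (tuples G 1)"
    proof (rule extensionalityI[OF f])
      fix gs assume gs: "gs \<in> tuples G 1"
      then obtain g where "g \<in> carrier G" "gs = [g]" unfolding tuples_1 by blast
      then show "f gs = restrict (\<lambda>gs. \<rho> (hd gs) v \<ominus>\<^bsub>V\<^esub> v) (tuples G 1) gs" using v(2) gs by (simp del: One_nat_def)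
    qed simp
    then show "f \<in> coboundaries G V \<rho> 1" unfolding coboundaries_1 using v(1) by blast
  qed
qed

context rational_SL_rep begin

sublocale pol: linear_rep "SL n" class_ring V "\<rho> \<circ> eval_at_0"
  by (rule rep.linear_rep_comp[OF group_SL eval_at_0_hom])

definition res :: "('a poly mat list \<Rightarrow> 'v) \<Rightarrow> 'a mat list \<Rightarrow> 'v" where
  "res c = restrict (\<lambda>gs. c [const_mat (hd gs)]) (tuples (SL n) 1)"

definition inflate :: "('a mat list \<Rightarrow> 'v) \<Rightarrow> 'a poly mat list \<Rightarrow> 'v" where
  "inflate f = restrict (\<lambda>gs. f [eval_at_0 (hd gs)]) (tuples (SL n) 1)"

lemma res_apply: "g \<in> carrier (SL n) \<Longrightarrow> res c [g] = c [const_mat g]"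
  by (simp add: res_def tuples_def)

lemma inflate_apply: "A \<in> carrier (SL n) \<Longrightarrow> inflate f [A] = f [eval_at_0 A]"
  by (simp add: inflate_def tuples_def)

lemma res_cocycle:
  assumes c: "c \<in> cocycles (SL n) V (\<rho> \<circ> eval_at_0) 1"
  shows "res c \<in> cocycles (SL n) V \<rho> 1"
  unfolding res_def
proof (rule rep.cocycleI)
  fix g h :: "'a mat" assume g: "g \<in> carrier (SL n)"
  show "c [const_mat g] \<in> carrier V" by (rule pol.cocycle_closed[OF c const_mat_SL[OF g]])
  assume h: "h \<in> carrier (SL n)"
  have "const_mat (g \<otimes>\<^bsub>SL n\<^esub> h) = const_mat g \<otimes>\<^bsub>SL n\<^esub> const_mat h"
    using const_mat_hom[of n] g h by (auto simp: hom_def)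
  then show "c [const_mat (g \<otimes>\<^bsub>SL n\<^esub> h)] = c [const_mat g] \<oplus>\<^bsub>V\<^esub> \<rho> g (c [const_mat h])"
    using pol.cocycle_mult[OF c const_mat_SL[OF g] const_mat_SL[OF h]] by simp
qed

lemma inflate_cocycle:
  assumes f: "f \<in> cocycles (SL n) V \<rho> 1"
  shows "inflate f \<in> cocycles (SL n) V (\<rho> \<circ> eval_at_0) 1"
  unfolding inflate_def
proof (rule pol.cocycleI)
  fix A B :: "'a poly mat" assume A: "A \<in> carrier (SL n)"
  show "f [eval_at_0 A] \<in> carrier V" by (rule rep.cocycle_closed[OF f eval_at_0_SL[OF A]])
  assume B: "B \<in> carrier (SL n)"
  have "eval_at_0 (A \<otimes>\<^bsub>SL n\<^esub> B) = eval_at_0 A \<otimes>\<^bsub>SL n\<^esub> eval_at_0 B"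
    using eval_at_0_hom[of n] A B by (auto simp: hom_def)
  then show "f [eval_at_0 (A \<otimes>\<^bsub>SL n\<^esub> B)] = f [eval_at_0 A] \<oplus>\<^bsub>V\<^esub> (\<rho> \<circ> eval_at_0) A (f [eval_at_0 B])"
    using rep.cocycle_mult[OF f eval_at_0_SL[OF A] eval_at_0_SL[OF B]] by simp
qed

lemma res_linear_map: "linear_map class_ring pol.cocycle_vs rep.cocycle_vs res"
proof (rule linear_mapI[OF pol.cocycle_vs rep.cocycle_vs])
  interpret P: vectorspace class_ring pol.cocycle_vs by (rule pol.cocycle_vs)
  interpret Q: vectorspace class_ring rep.cocycle_vs by (rule rep.cocycle_vs)
  show "res c \<in> carrier rep.cocycle_vs" if "c \<in> carrier pol.cocycle_vs" for c
    using that res_cocycle by simp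
  show "res (c \<oplus>\<^bsub>pol.cocycle_vs\<^esub> d) = res c \<oplus>\<^bsub>rep.cocycle_vs\<^esub> res d"
    if cd: "c \<in> carrier pol.cocycle_vs" "d \<in> carrier pol.cocycle_vs" for c d
  proof (rule rep.cocycle_eqI)
    show "res (c \<oplus>\<^bsub>pol.cocycle_vs\<^esub> d) \<in> cocycles (SL n) V \<rho> 1"
      using P.a_closed[OF cd] by (intro res_cocycle) simp
    show "res c \<oplus>\<^bsub>rep.cocycle_vs\<^esub> res d \<in> cocycles (SL n) V \<rho> 1"
      using Q.a_closed[of "res c" "res d"] cd res_cocycle by simp
  qed (simp only: res_apply pol.cocycle_vs_ops rep.cocycle_vs_ops const_mat_SL)
  show "res (a \<odot>\<^bsub>pol.cocycle_vs\<^esub> c) = a \<odot>\<^bsub>rep.cocycle_vs\<^esub> res c"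
    if c: "c \<in> carrier pol.cocycle_vs" for a c
  proof (rule rep.cocycle_eqI)
    show "res (a \<odot>\<^bsub>pol.cocycle_vs\<^esub> c) \<in> cocycles (SL n) V \<rho> 1"
      using P.smult_closed[OF _ c, of a] by (intro res_cocycle) simp
    show "a \<odot>\<^bsub>rep.cocycle_vs\<^esub> res c \<in> cocycles (SL n) V \<rho> 1"
      using Q.smult_closed[of a "res c"] c res_cocycle by simp
  qed (simp only: res_apply pol.cocycle_vs_ops rep.cocycle_vs_ops const_mat_SL)
qed

lemma res_coboundary: "c \<in> coboundaries (SL n) V (\<rho> \<circ> eval_at_0) 1 \<Longrightarrow> res c \<in> coboundaries (SL n) V \<rho> 1"
  unfolding rep.coboundary_iff pol.coboundary_iff
  by (auto simp: res_apply const_mat_SL) (simp add: res_def)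

lemma coboundary_cocycle:
  "c \<in> coboundaries (SL n) V (\<rho> \<circ> eval_at_0) 1 \<Longrightarrow> c \<in> cocycles (SL n) V (\<rho> \<circ> eval_at_0) 1"
  using LinearCombinations.submodule.subset[OF pol.coboundaries_1_submodule] by auto

text \<open>The vector \<open>v\<close> that bounds \<open>res c\<close> also defines a coboundary
  over \<open>F[t]\<close>, and this one agrees with \<open>c\<close> on constant matrices.\<close>

lemma res_coboundaryE:
  assumes c: "c \<in> cocycles (SL n) V (\<rho> \<circ> eval_at_0) 1" and "res c \<in> coboundaries (SL n) V \<rho> 1"
  obtains b where "b \<in> coboundaries (SL n) V (\<rho> \<circ> eval_at_0) 1"
    "\<And>g. g \<in> carrier (SL n) \<Longrightarrow> c [const_mat g] = b [const_mat g]"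
proof -
  obtain v where v: "v \<in> carrier V" "\<And>g. g \<in> carrier (SL n) \<Longrightarrow> res c [g] = \<rho> g v \<ominus>\<^bsub>V\<^esub> v"
    using assms(2) unfolding rep.coboundary_iff by blast
  let ?b = "restrict (\<lambda>gs. (\<rho> \<circ> eval_at_0) (hd gs) v \<ominus>\<^bsub>V\<^esub> v) (tuples (SL n) 1)"
  have "?b \<in> coboundaries (SL n) V (\<rho> \<circ> eval_at_0) 1"
    unfolding pol.coboundaries_1 using v(1) by blast
  moreover have "c [const_mat g] = ?b [const_mat g]" if "g \<in> carrier (SL n)" for g
    using v(2)[OF that] const_mat_SL[OF that] by (simp add: res_apply that tuples_def)
  ultimately show ?thesis by (rule that)
qed

text \<open>The common frame of the three cases: \<open>\<tau>\<close> measures what restriction to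
  constant matrices does not see. The hypotheses make the map from \<open>c\<close> to the class of
  \<open>res c\<close> paired with \<open>\<tau> c\<close> surjective, with the coboundaries as its
  kernel.\<close>

lemma cohomology_isomorphic_onto:
  assumes \<tau>: "linear_map class_ring pol.cocycle_vs W \<tau>"
    and coboundary: "\<And>b. b \<in> coboundaries (SL n) V (\<rho> \<circ> eval_at_0) 1 \<Longrightarrow> \<tau> b = \<zero>\<^bsub>W\<^esub>"
    and inflated: "\<And>f. f \<in> cocycles (SL n) V \<rho> 1 \<Longrightarrow> \<tau> (inflate f) = \<zero>\<^bsub>W\<^esub>"
    and inj: "\<And>c A. \<lbrakk>c \<in> cocycles (SL n) V (\<rho> \<circ> eval_at_0) 1; \<tau> c = \<zero>\<^bsub>W\<^esub>;
      \<And>g. g \<in> carrier (SL n) \<Longrightarrow> c [const_mat g] = \<zero>\<^bsub>V\<^esub>; A \<in> carrier (SL n)\<rbrakk> \<Longrightarrow> c [A] = \<zero>\<^bsub>V\<^esub>"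
    and surj: "\<And>w. w \<in> carrier W \<Longrightarrow> \<exists>c\<in>cocycles (SL n) V (\<rho> \<circ> eval_at_0) 1.
      \<tau> c = w \<and> (\<forall>g\<in>carrier (SL n). c [const_mat g] = \<zero>\<^bsub>V\<^esub>)"
  shows "vs_isomorphic class_ring (group_cohomology 1 (SL n) V (\<rho> \<circ> eval_at_0))
    (direct_sum (group_cohomology 1 (SL n) V \<rho>) W)"
proof -
  let ?B = "coboundaries (SL n) V \<rho> 1" and ?Bp = "coboundaries (SL n) V (\<rho> \<circ> eval_at_0) 1"
  interpret P: vectorspace class_ring pol.cocycle_vs by (rule pol.cocycle_vs)
  interpret Q: vectorspace class_ring rep.cocycle_vs by (rule rep.cocycle_vs)
  interpret \<tau>: linear_map class_ring pol.cocycle_vs W \<tau> by (rule \<tau>)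
  interpret r: linear_map class_ring pol.cocycle_vs rep.cocycle_vs res by (rule res_linear_map)
  interpret q: linear_map class_ring rep.cocycle_vs "quot_vs rep.cocycle_vs ?B" "\<lambda>x. ?B +>\<^bsub>rep.cocycle_vs\<^esub> x"
    by (rule Q.coset_linear_map[OF rep.coboundaries_1_submodule class_field])
  note ops = Q.quot_vs_ops[OF rep.coboundaries_1_submodule]
  let ?T = "\<lambda>c. (?B +>\<^bsub>rep.cocycle_vs\<^esub> res c, \<tau> c)"
  let ?D = "direct_sum (quot_vs rep.cocycle_vs ?B) W"
  have T: "linear_map class_ring pol.cocycle_vs ?D ?T"
    by (rule linear_mapI[OF pol.cocycle_vs direct_sum_is_vs[OF q.W.vectorspace_axioms \<tau>.W.vectorspace_axioms]])
      (simp_all only: direct_sum_def module.simps monoid.simps ring.simps partial_object.simps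
        fst_conv snd_conv mem_Times_iff simp_thms r.f_im q.f_im \<tau>.f_im r.f_add q.f_add \<tau>.f_add r.f_smult q.f_smult \<tau>.f_smult)
  have "vs_isomorphic class_ring (quot_vs pol.cocycle_vs ?Bp) ?D"
  proof (rule P.quot_vs_isomorphic[OF pol.coboundaries_1_submodule T])
    show "?T ` carrier pol.cocycle_vs = carrier ?D"
    proof
      show "?T ` carrier pol.cocycle_vs \<subseteq> carrier ?D"
        using linear_map.axioms(3)[OF T] unfolding mod_hom_def mod_hom_axioms_def LinearCombinations.module_hom_def by blast
      show "carrier ?D \<subseteq> ?T ` carrier pol.cocycle_vs"
      proof
        fix X assume "X \<in> carrier ?D"
        then obtain f w where X: "X = (?B +>\<^bsub>rep.cocycle_vs\<^esub> f, w)" "f \<in> cocycles (SL n) V \<rho> 1" "w \<in> carrier W"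
          unfolding direct_sum_def ops(1) by auto
        obtain c where c: "c \<in> cocycles (SL n) V (\<rho> \<circ> eval_at_0) 1" "\<tau> c = w" "\<forall>g\<in>carrier (SL n). c [const_mat g] = \<zero>\<^bsub>V\<^esub>"
          using surj[OF X(3)] by blast
        note i = inflate_cocycle[OF X(2)]
        \<comment> \<open>Inflation splits restriction and is killed by \<open>\<tau>\<close>, so
          adding \<open>c\<close> prescribes the second component without disturbing the
          first.\<close>
        let ?c = "inflate f \<oplus>\<^bsub>pol.cocycle_vs\<^esub> c"
        have cc: "?c \<in> carrier pol.cocycle_vs" using i c(1) by (intro P.a_closed) simp_all
        have "res ?c = f"
        proof (rule rep.cocycle_eqI)
          show "res ?c \<in> cocycles (SL n) V \<rho> 1" using cc by (intro res_cocycle) simp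
          show "res ?c [g] = f [g]" if "g \<in> carrier (SL n)" for g
            using that c(3) rep.cocycle_closed[OF X(2) that]
            by (simp only: res_apply pol.cocycle_vs_ops const_mat_SL inflate_apply eval_const_mat) simp
        qed (rule X(2))
        moreover have "\<tau> ?c = w"
        proof -
          have "\<tau> ?c = \<tau> (inflate f) \<oplus>\<^bsub>W\<^esub> \<tau> c" using i c(1) by (intro \<tau>.f_add) simp_all
          then show ?thesis using inflated[OF X(2)] c(2) X(3) by simp
        qed
        ultimately show "X \<in> ?T ` carrier pol.cocycle_vs" unfolding X(1) using cc by (intro image_eqI[of _ _ ?c]) simp_all
      qed
    qed
    fix c assume "c \<in> carrier pol.cocycle_vs"
    then have c: "c \<in> cocycles (SL n) V (\<rho> \<circ> eval_at_0) 1" by simp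
    have "?T c = \<zero>\<^bsub>?D\<^esub> \<longleftrightarrow> res c \<in> ?B \<and> \<tau> c = \<zero>\<^bsub>W\<^esub>"
      using ops(3) ops(4)[of "res c"] res_cocycle[OF c] by (simp add: direct_sum_def)
    also have "\<dots> \<longleftrightarrow> c \<in> ?Bp"
    proof
      assume h: "res c \<in> ?B \<and> \<tau> c = \<zero>\<^bsub>W\<^esub>"
      obtain b where b: "b \<in> ?Bp" "\<And>g. g \<in> carrier (SL n) \<Longrightarrow> c [const_mat g] = b [const_mat g]"
        using res_coboundaryE[OF c] h by blast
      note bz = coboundary_cocycle[OF b(1)]
      let ?m = "(- 1) \<odot>\<^bsub>pol.cocycle_vs\<^esub> b"
      \<comment> \<open>Subtracting the coboundary with the same values on constant matrices leaves
        a cocycle to which \<open>inj\<close> applies.\<close>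
      let ?d = "c \<oplus>\<^bsub>pol.cocycle_vs\<^esub> ?m"
      have m: "?m \<in> carrier pol.cocycle_vs" using bz by (intro P.smult_closed) simp_all
      have d: "?d \<in> carrier pol.cocycle_vs" using c m by (intro P.a_closed) simp_all
      have dA: "l (?d [A]) = l (c [A]) - l (b [A])" if "l \<in> dual V" "A \<in> carrier (SL n)" for l A
        using that pol.cocycle_closed[OF c that(2)] pol.cocycle_closed[OF bz that(2)]
        by (simp only: pol.cocycle_vs_ops dual_add dual_smult rep.smult_closed partial_object.simps UNIV_I) simp
      have dcl: "?d [A] \<in> carrier V" if "A \<in> carrier (SL n)" for A
        using d that by (intro pol.cocycle_closed) simp_all
      have d0: "?d [A] = \<zero>\<^bsub>V\<^esub>" if "A \<in> carrier (SL n)" for A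
      proof (rule inj[OF _ _ _ that])
        show "?d \<in> cocycles (SL n) V (\<rho> \<circ> eval_at_0) 1" using d by simp
        have "\<tau> ?d = \<tau> c \<oplus>\<^bsub>W\<^esub> \<tau> ?m" using c m by (intro \<tau>.f_add) simp_all
        also have "\<tau> ?m = (- 1) \<odot>\<^bsub>W\<^esub> \<tau> b" using bz by (intro \<tau>.f_smult) simp_all
        finally show "\<tau> ?d = \<zero>\<^bsub>W\<^esub>" using h coboundary[OF b(1)] by simp
        show "?d [const_mat g] = \<zero>\<^bsub>V\<^esub>" if "g \<in> carrier (SL n)" for g
          using that by (intro dual_eqI dcl) (simp_all only: dA b(2) const_mat_SL dual_zero, simp_all)
      qed
      have "c = b"
      proof (intro pol.cocycle_eqI c bz dual_eqI pol.cocycle_closed)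
        fix A l assume A: "A \<in> carrier (SL n :: 'a poly mat monoid)" and l: "l \<in> dual V"
        show "l (c [A]) = l (b [A])" using dA[OF l A] unfolding d0[OF A] dual_zero[OF l] by simp
      qed
      then show "c \<in> ?Bp" using b(1) by simp
    next
      assume "c \<in> ?Bp"
      then show "res c \<in> ?B \<and> \<tau> c = \<zero>\<^bsub>W\<^esub>" using res_coboundary coboundary by blast
    qed
    finally show "?T c = \<zero>\<^bsub>?D\<^esub> \<longleftrightarrow> c \<in> ?Bp" .
  qed
  then show ?thesis by (simp only: group_cohomology_def)
qed

end

lemma vs_isomorphic_trans:
  assumes "vs_isomorphic K U V" "vs_isomorphic K V W"
  shows "vs_isomorphic K U W"
proof -
  obtain f g where f: "linear_map K U V f" "bij_betw f (carrier U) (carrier V)"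
    and g: "linear_map K V W g" "bij_betw g (carrier V) (carrier W)"
    using assms unfolding vs_isomorphic_def by blast
  interpret f: linear_map K U V f by (rule f)
  interpret g: linear_map K V W g by (rule g)
  have "linear_map K U W (g \<circ> f)"
    by (rule linear_mapI[OF f.V.vectorspace_axioms g.W.vectorspace_axioms]) (simp_all add: f.f_im)
  then show ?thesis unfolding vs_isomorphic_def using bij_betw_trans[OF f(2) g(2)] by blast
qed

lemma direct_sum_trivial:
  assumes V: "vectorspace K V" and W: "vectorspace K W" and "carrier W = {\<zero>\<^bsub>W\<^esub>}"
  shows "vs_isomorphic K (direct_sum V W) V"
proof -
  have "linear_map K (direct_sum V W) V fst"
    by (rule linear_mapI[OF direct_sum_is_vs[OF V W] V]) (auto simp: direct_sum_def)
  moreover have "bij_betw fst (carrier (direct_sum V W)) (carrier V)"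
    using assms(3) by (auto simp: bij_betw_def inj_on_def direct_sum_def)
  ultimately show ?thesis unfolding vs_isomorphic_def by blast
qed

lemma tFt_carrier: "x \<in> carrier tFt \<longleftrightarrow> poly x 0 = 0"
  using poly_eq_0_iff_dvd[of x 0] by (auto simp: tFt_def dvd_def)

lemma coeff_1_mult: "coeff (p * q) 1 = coeff p 1 * poly q 0 + poly p 0 * coeff q 1"
  by (simp add: coeff_mult poly_0_coeff_0 add.commute)

section \<open>The adjoint representation\<close>

definition log_deriv_at_0 :: "nat \<Rightarrow> 'a::field poly mat \<Rightarrow> 'a mat" where
  "log_deriv_at_0 n A = map_mat (\<lambda>p. coeff p 1) A * inv\<^bsub>SL n\<^esub> (eval_at_0 A)"

lemma inv_SL_carrier:
  assumes "A \<in> carrier (SL n)"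
  shows "inv\<^bsub>SL n\<^esub> A \<in> carrier_mat n n" "A * inv\<^bsub>SL n\<^esub> A = 1\<^sub>m n"
  using group.inv_closed[OF group_SL assms] group.r_inv[OF group_SL assms] by (auto simp: SL_def)

lemma inv_SL_one: "inv\<^bsub>SL n\<^esub> (1\<^sub>m n) = (1\<^sub>m n :: 'a::comm_ring_1 mat)"
  using monoid.inv_one[OF group.is_monoid[OF group_SL], of n] by (simp add: SL_def)

text \<open>The product rule at 0, multiplied on the right by
  \<open>B(0)^-1 A(0)^-1\<close>.\<close>

lemma log_deriv_at_0_mult:
  fixes A B :: "'a::field poly mat"
  assumes A: "A \<in> carrier (SL n)" and B: "B \<in> carrier (SL n)"
  shows "log_deriv_at_0 n (A * B) = log_deriv_at_0 n A + Ad n (eval_at_0 A) (log_deriv_at_0 n B)"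
proof -
  interpret G: group "SL n :: 'a mat monoid" by (rule group_SL)
  define A0 where "A0 = eval_at_0 A"
  define B0 where "B0 = eval_at_0 B"
  define A1 where "A1 = map_mat (\<lambda>p. coeff p 1) A"
  define B1 where "B1 = map_mat (\<lambda>p. coeff p 1) B"
  define iA where "iA = inv\<^bsub>SL n\<^esub> A0"
  define iB where "iB = inv\<^bsub>SL n\<^esub> B0"
  note defs = A0_def B0_def A1_def B1_def iA_def iB_def
  have E: "A0 \<in> carrier (SL n)" "B0 \<in> carrier (SL n)" using A B by (auto simp: defs eval_at_0_SL)
  have m: "A \<in> carrier_mat n n" "B \<in> carrier_mat n n" using A B by (auto simp: SL_def)
  have c: "A0 \<in> carrier_mat n n" "A1 \<in> carrier_mat n n" "B0 \<in> carrier_mat n n" "B1 \<in> carrier_mat n n"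
    "iA \<in> carrier_mat n n" "iB \<in> carrier_mat n n"
    using m inv_SL_carrier(1)[OF E(1)] inv_SL_carrier(1)[OF E(2)] by (auto simp: defs eval_at_0_def)
  have i: "B0 * iB = 1\<^sub>m n" using inv_SL_carrier(2)[OF E(2)] by (simp add: defs)
  have "inv\<^bsub>SL n\<^esub> (eval_at_0 (A * B)) = iB * iA"
    using G.inv_mult_group[OF E] eval_at_0_mult[OF A B] by (simp add: defs) (simp add: SL_def)
  moreover have "map_mat (\<lambda>p. coeff p 1) (A * B) = A1 * B0 + A0 * B1"
  proof (rule eq_matI)
    fix r s assume "r < dim_row (A1 * B0 + A0 * B1)" "s < dim_col (A1 * B0 + A0 * B1)"
    then have rs: "r < n" "s < n" using c by auto
    then show "map_mat (\<lambda>p. coeff p 1) (A * B) $$ (r, s) = (A1 * B0 + A0 * B1) $$ (r, s)"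
      using m by (simp add: defs eval_at_0_def scalar_prod_def coeff_sum coeff_1_mult sum.distrib del: One_nat_def)
  qed (use m c in auto)
  ultimately have "log_deriv_at_0 n (A * B) = (A1 * B0 + A0 * B1) * (iB * iA)" by (simp add: log_deriv_at_0_def)
  also have "\<dots> = A1 * B0 * (iB * iA) + A0 * B1 * (iB * iA)"
    using c by (intro add_mult_distrib_mat[of _ n n]) auto
  also have "A1 * B0 * (iB * iA) = A1 * (B0 * iB) * iA"
    using c by (simp add: assoc_mult_mat[of _ n n _ n _ n])
  also have "\<dots> = log_deriv_at_0 n A" using c unfolding i by (simp add: log_deriv_at_0_def) (simp add: defs)
  also have "A0 * B1 * (iB * iA) = Ad n A0 (B1 * iB)"
    unfolding Ad_def iA_def[symmetric] using c by (simp add: assoc_mult_mat[of _ n n _ n _ n])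
  also have "B1 * iB = log_deriv_at_0 n B" by (simp add: log_deriv_at_0_def defs)
  finally show ?thesis by (simp add: defs)
qed

lemma eval_addrow_mat: "eval_at_0 (addrow_mat n f k l) = addrow_mat n (poly f 0) k l"
  by (intro eq_matI) (auto simp: eval_at_0_def)

text \<open>Infinitesimally this is \<open>det A = 1\<close>. The cocycle rule reduces it to
  elementary matrices, so that no derivative of a determinant is computed.\<close>

lemma log_deriv_at_0_sl:
  fixes A :: "'a::field poly mat"
  assumes "A \<in> carrier (SL n)"
  shows "log_deriv_at_0 n A \<in> carrier (sl_vs n)"
  using SL_elementary_products[OF assms]
proof induction
  case one
  have "eval_at_0 (1\<^sub>m n) = (1\<^sub>m n :: 'a mat)" "map_mat (\<lambda>p. coeff p 1) (1\<^sub>m n) = (0\<^sub>m n n :: 'a mat)"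
    by (auto intro!: eq_matI simp: eval_at_0_def)
  then show ?case
    by (simp add: log_deriv_at_0_def inv_SL_one sl_vs_carrier mat_trace_def)
next
  case (mult A k l f)
  interpret A: linear_rep "SL n" class_ring "sl_vs n :: ('a, 'a mat) module" "Ad n" by (rule linear_rep_Ad)
  have A: "A \<in> carrier (SL n)" by (rule elementary_products_SL[OF mult.hyps(1)])
  have e: "addrow_mat n f k l \<in> carrier (SL n)" using mult.hyps by (intro addrow_mat_SL)
  let ?C = "map_mat (\<lambda>p. coeff p 1) (addrow_mat n f k l)"
  have C: "?C \<in> carrier_mat n n" by simp
  have "log_deriv_at_0 n (addrow_mat n f k l) = ?C * addrow_mat n (- poly f 0) k l"
    unfolding log_deriv_at_0_def eval_addrow_mat using mult.hyps by (simp add: inv_SL_addrow_mat)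
  also have "\<dots> = addcol (- poly f 0) l k ?C"
    by (rule addcol_mat[OF C mult.hyps(2), symmetric])
  finally have "log_deriv_at_0 n (addrow_mat n f k l) \<in> carrier (sl_vs n)"
    using mult.hyps by (simp add: sl_vs_carrier carrier_matI mat_trace_def) (auto intro!: sum.neutral)
  then have "log_deriv_at_0 n (addrow_mat n f k l) \<oplus>\<^bsub>sl_vs n\<^esub> Ad n (eval_at_0 (addrow_mat n f k l)) (log_deriv_at_0 n A)
      \<in> carrier (sl_vs n)"
    using A.rep_closed[OF eval_at_0_SL[OF e] mult.IH] by simp
  then show ?case unfolding log_deriv_at_0_mult[OF e A] by (simp add: sl_vs_def module_mat_simps)
qed

lemma log_deriv_at_0_const:
  assumes "g \<in> carrier (SL n)"
  shows "log_deriv_at_0 n (const_mat g) = 0\<^sub>m n n"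
proof -
  have "map_mat (\<lambda>p. coeff p 1) (const_mat g) = 0\<^sub>m n n"
    using assms by (intro eq_matI) (auto simp: const_mat_def SL_def)
  then show ?thesis using inv_SL_carrier[OF assms] by (simp add: log_deriv_at_0_def)
qed

lemma (in SL_poly_cocycle) val_mult_zero:
  assumes m: "m < n" "m \<noteq> 0" "m \<noteq> 1" and x: "poly x 0 = 0" and y: "poly y 0 = 0"
  shows "val (x * y) (unitv 0) (unitv m) = \<zero>\<^bsub>V\<^esub>"
proof -
  let ?X = "addrow_mat n x 0 1" and ?Y = "addrow_mat n y 1 m" and ?Z = "addrow_mat n (x * y) 0 m"
  have ij: "0 < n" "1 < n" using n by auto
  have car: "?X \<in> carrier_mat n n" "?Y \<in> carrier_mat n n" "?Z \<in> carrier_mat n n" by auto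
  have SL: "?X \<in> carrier (SL n)" "?Y \<in> carrier (SL n)" "?Z \<in> carrier (SL n)"
    using m by (auto intro: addrow_mat_SL)
  have ev: "eval_at_0 ?X = 1\<^sub>m n" "eval_at_0 ?Y = 1\<^sub>m n" "eval_at_0 ?Z = 1\<^sub>m n"
    unfolding eval_addrow_mat using x y by (auto intro!: eq_matI)
  \<comment> \<open>The commutator relation without inverses. All factors evaluate to 1, so
    \<open>c\<close> is additive on them and the terms of \<open>?X\<close> and \<open>?Y\<close>
    cancel.\<close>
  have "?X * ?Y = ?Y * (?X * ?Z)"
    unfolding addrow_mat[OF car(2) ij(2), symmetric] addrow_mat[OF car(3) ij(2), symmetric]
    by (subst addrow_mat[symmetric, of _ n n]) (use m ij in \<open>auto intro!: eq_matI\<close>)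
  then have eq: "c [?X * ?Y] = c [?Y * (?X * ?Z)]" by simp
  have "l (c [?Z]) = 0" if l: "l \<in> dual V" for l
  proof -
    have "l (c [?X]) + l (c [?Y]) = l (c [?Y]) + (l (c [?X]) + l (c [?Z]))"
      using arg_cong[OF eq, of l] SL by (simp add: c_mult_kernel ev mult_SL c_closed dual_add[OF l] del: One_nat_def)
    then show ?thesis by simp
  qed
  then have "c [?Z] = \<zero>\<^bsub>V\<^esub>" using c_closed[OF SL(3)] by (intro dual_eqI) (auto simp: dual_zero)
  then show ?thesis using m ij by (simp add: val_def tv_units)
qed

lemma sl_vs_ops [simp]:
  "X \<oplus>\<^bsub>sl_vs n\<^esub> Y = X + Y" "a \<odot>\<^bsub>sl_vs n\<^esub> X = a \<cdot>\<^sub>m X" "\<zero>\<^bsub>sl_vs n\<^esub> = 0\<^sub>m n n"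
  by (simp_all add: sl_vs_def module_mat_simps)

section \<open>Representations isomorphic to the adjoint one\<close>

locale adjoint_SL_rep = rational_SL_rep n V \<rho>
  for n :: nat and V :: "('a::field_char_0, 'v) module" and \<rho> :: "'a mat \<Rightarrow> 'v \<Rightarrow> 'v" +
  fixes F :: "'v \<Rightarrow> 'a mat"
  assumes F_linear: "linear_map class_ring V (sl_vs n) F"
    and F_bij: "bij_betw F (carrier V) (carrier (sl_vs n))"
    and F_rep: "g \<in> carrier (SL n) \<Longrightarrow> v \<in> carrier V \<Longrightarrow> F (\<rho> g v) = Ad n g (F v)"
begin

interpretation F: linear_map class_ring V "sl_vs n" F by (rule F_linear)

lemma F_sl: "v \<in> carrier V \<Longrightarrow> F v \<in> carrier_mat n n" "v \<in> carrier V \<Longrightarrow> mat_trace (F v) = 0"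
  using F.f_im[of v] by (auto simp: sl_vs_carrier)

lemma F_add: "v \<in> carrier V \<Longrightarrow> w \<in> carrier V \<Longrightarrow> F (v \<oplus>\<^bsub>V\<^esub> w) = F v + F w"
  using F.f_add[of v w] by (simp add: sl_vs_def module_mat_simps)

lemma F_zero: "F \<zero>\<^bsub>V\<^esub> = 0\<^sub>m n n"
  using F.f0_is_0 by (simp add: sl_vs_def module_mat_simps)

lemma F_inj: "v \<in> carrier V \<Longrightarrow> w \<in> carrier V \<Longrightarrow> F v = F w \<Longrightarrow> v = w"
  using F_bij by (auto simp: bij_betw_def inj_on_def)

text \<open>The coordinate at the highest root vector, which is \<open>e_0 e_(n-1)^T\<close> in
  zero-based numbering.\<close>

definition corner :: "'v \<Rightarrow> 'a" where
  "corner v = F v $$ (0, n - 1)"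

lemma corner_dual: "corner \<in> dual V"
proof -
  have "0 < n" "n - 1 < n" using n by auto
  then show ?thesis using carrier_matD[OF F_sl(1)] by (auto simp: dual_iff corner_def)
qed

text \<open>The transvection commutes with \<open>1 + E_ij\<close> if \<open>j\<close> is not 0 and
  \<open>i\<close> is not \<open>n - 1\<close>, so its value \<open>?Y\<close> in
  \<open>sl_n\<close> is fixed by these matrices. This makes \<open>?Y\<close> a scalar plus a
  multiple of the highest root vector; the trace kills the scalar and the hypothesis kills the
  multiple.\<close>

lemma val_corner_zero:
  assumes c: "c \<in> cocycles (SL n) V (\<rho> \<circ> eval_at_0) 1" and x: "poly x 0 = 0"
    and zero: "corner (c [tv n x (unitv 0) (unitv (n - 1))]) = 0"
  shows "c [tv n x (unitv 0) (unitv (n - 1))] = \<zero>\<^bsub>V\<^esub>"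
proof -
  interpret C: SL_poly_cocycle n V \<rho> c by unfold_locales (rule c)
  let ?m = "n - 1"
  let ?v = "C.val x (unitv 0) (unitv ?m)"
  have m: "0 < n" "?m < n" "0 \<noteq> ?m" using n by auto
  have o: "orth n (unitv 0 :: nat \<Rightarrow> 'a) (unitv ?m)" by (rule orth_unitv[OF m(1,3)])
  have v: "?v \<in> carrier V" by (rule C.val_closed[OF x o])
  let ?Y = "F ?v"
  note Y = F_sl[OF v]
  have inv_Y: "Ad n (addrow_mat n 1 i j) ?Y = ?Y" if ij: "i < n" "j < n" "i \<noteq> j" "j \<noteq> 0" "i \<noteq> ?m" for i j
  proof -
    have g: "addrow_mat n (1::'a) i j \<in> carrier (SL n)" using ij by (intro addrow_mat_SL)
    have "?v = \<rho> (addrow_mat n 1 i j) ?v"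
    proof (rule C.val_conj(2)[OF x g o])
      show "unitv 0 r = (\<Sum>k<n. addrow_mat n (1::'a) i j $$ (r, k) * unitv 0 k)" if "r < n" for r
        using that ij m by simp (simp add: unitv_def)
      show "unitv ?m r = (\<Sum>k<n. unitv ?m k * addrow_mat n (1::'a) i j $$ (k, r))" if "r < n" for r
        using that ij m by simp (simp add: unitv_def)
    qed
    then show ?thesis using F_rep[OF g v] by simp
  qed
  have ent: "(if r = i then ?Y $$ (j, s) else 0) - (if s = j then ?Y $$ (r, i) else 0)
      - (if r = i \<and> s = j then ?Y $$ (j, i) else 0) = 0"
    if ij: "i < n" "j < n" "i \<noteq> j" "j \<noteq> 0" "i \<noteq> ?m" and rs: "r < n" "s < n" for i j r s
    using Ad_addrow_mat_index[OF Y(1) ij(1-3) rs, of 1] unfolding inv_Y[OF ij]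
    by (simp add: algebra_simps split: if_splits)
  have row: "?Y $$ (j, s) = 0" if "j < n" "s < n" "j \<noteq> 0" "s \<noteq> j" for j s
    using ent[of 0 j 0 s] that m by simp
  have col: "?Y $$ (0, i) = 0" if "i < n" "i \<noteq> 0" "i \<noteq> ?m" for i
    using ent[of i ?m 0 ?m] that m by simp
  have diag: "?Y $$ (j, j) = ?Y $$ (0, 0)" if "j < n" for j
    using ent[of 0 j 0 j] row[of j 0] that m by (cases "j = 0") auto
  have "(\<Sum>j<n. ?Y $$ (j, j)) = (\<Sum>j<n. ?Y $$ (0, 0))" by (rule sum.cong[OF refl]) (rule diag, simp)
  then have "of_nat n * ?Y $$ (0, 0) = 0" using Y by (simp add: mat_trace_def)
  then have z: "?Y $$ (0, 0) = 0" using m by simp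
  have "?Y = 0\<^sub>m n n"
  proof (rule eq_matI)
    fix r s assume "r < dim_row (0\<^sub>m n n :: 'a mat)" "s < dim_col (0\<^sub>m n n :: 'a mat)"
    then have rs: "r < n" "s < n" by auto
    have "?Y $$ (0, ?m) = 0" using zero by (simp add: corner_def C.val_def)
    then have "?Y $$ (r, s) = 0"
      using row[of r s] col[of s] diag[of r] z rs n by (cases "r = s"; cases "r = 0"; cases "s = ?m") auto
    then show "?Y $$ (r, s) = 0\<^sub>m n n $$ (r, s)" using rs by simp
  qed (use Y in auto)
  then have "?v = \<zero>\<^bsub>V\<^esub>" by (intro F_inj v) (simp_all add: F_zero)
  then show ?thesis by (simp add: C.val_def)
qed

lemma transport_cocycle:
  fixes d :: "'a poly mat \<Rightarrow> 'a mat"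
  assumes d: "\<And>A. A \<in> carrier (SL n) \<Longrightarrow> d A \<in> carrier (sl_vs n)"
    and mult: "\<And>A B. A \<in> carrier (SL n) \<Longrightarrow> B \<in> carrier (SL n) \<Longrightarrow> d (A * B) = d A + Ad n (eval_at_0 A) (d B)"
  obtains c where "c \<in> cocycles (SL n) V (\<rho> \<circ> eval_at_0) 1" "\<And>A. A \<in> carrier (SL n) \<Longrightarrow> F (c [A]) = d A"
proof -
  let ?G = "inv_into (carrier V) F"
  have im: "F ` carrier V = carrier (sl_vs n)" using F_bij by (simp add: bij_betw_def)
  have G: "?G X \<in> carrier V" "F (?G X) = X" if "X \<in> carrier (sl_vs n)" for X
    using that im by (metis inv_into_into, metis f_inv_into_f)
  let ?c = "restrict (\<lambda>gs. ?G (d (hd gs))) (tuples (SL n) 1)"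
  have "?c \<in> cocycles (SL n) V (\<rho> \<circ> eval_at_0) 1"
  proof (rule pol.cocycleI)
    fix A B :: "'a poly mat" assume A: "A \<in> carrier (SL n)"
    show "?G (d A) \<in> carrier V" by (rule G[OF d[OF A]])
    assume B: "B \<in> carrier (SL n)"
    have AB: "A \<otimes>\<^bsub>SL n\<^esub> B = A * B" by (simp add: SL_def)
    have 1: "\<rho> (eval_at_0 A) (?G (d B)) \<in> carrier V"
      by (intro rep.rep_closed eval_at_0_SL A G d B)
    show "?G (d (A \<otimes>\<^bsub>SL n\<^esub> B)) = ?G (d A) \<oplus>\<^bsub>V\<^esub> (\<rho> \<circ> eval_at_0) A (?G (d B))"
      unfolding AB o_apply
    proof (rule F_inj)
      show "F (?G (d (A * B))) = F (?G (d A) \<oplus>\<^bsub>V\<^esub> \<rho> (eval_at_0 A) (?G (d B)))"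
        using G[OF d[OF A]] G[OF d[OF B]] G[OF d[OF mult_SL[OF A B]]] 1
        by (simp add: F_add F_rep eval_at_0_SL A mult[OF A B])
    qed (use G d mult_SL[OF A B] A 1 in auto)
  qed
  moreover have "F (?c [A]) = d A" if "A \<in> carrier (SL n)" for A
    using that G[OF d[OF that]] by (simp add: tuples_def)
  ultimately show ?thesis by (rule that)
qed

lemma coboundary_kernel:
  assumes b: "b \<in> coboundaries (SL n) V (\<rho> \<circ> eval_at_0) 1" and A: "A \<in> carrier (SL n)" "eval_at_0 A = 1\<^sub>m n"
  shows "b [A] = \<zero>\<^bsub>V\<^esub>"
proof -
  obtain v where v: "v \<in> carrier V" "b [A] = \<rho> (eval_at_0 A) v \<ominus>\<^bsub>V\<^esub> v"
    using b A(1) unfolding pol.coboundary_iff by auto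
  have "\<rho> (1\<^sub>m n) v = v" using rep.rep_one[OF v(1)] by (simp add: SL_def)
  then show ?thesis using v A(2)
    by (simp add: abelian_group.minus_eq[OF module_abelian_group[OF rep.module_axioms]]
        abelian_group.r_neg[OF module_abelian_group[OF rep.module_axioms]])
qed

lemma inflate_kernel:
  assumes f: "f \<in> cocycles (SL n) V \<rho> 1" and A: "A \<in> carrier (SL n)" "eval_at_0 A = 1\<^sub>m n"
  shows "inflate f [A] = \<zero>\<^bsub>V\<^esub>"
  using rep.cocycle_one[OF f] A by (simp add: inflate_apply) (simp add: SL_def)

lemma tv_corner:
  assumes "poly x 0 = 0"
  shows "tv n x (unitv 0) (unitv (n - 1)) \<in> carrier (SL n)" "eval_at_0 (tv n x (unitv 0) (unitv (n - 1))) = 1\<^sub>m n"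
  using n by (auto intro!: tv_SL eval_tv orth_unitv assms)

text \<open>One number suffices, the corner entry at the parameter \<open>t\<close>, since
  parameters divisible by \<open>t^2\<close> give zero. Surjectivity comes from multiples of the
  cocycle \<open>log_deriv_at_0\<close>, whose corner entry there is 1.\<close>

lemma cohomology_rank_ge_3:
  assumes n3: "n \<ge> 3"
  shows "vs_isomorphic class_ring (group_cohomology 1 (SL n) V (\<rho> \<circ> eval_at_0))
    (direct_sum (group_cohomology 1 (SL n) V \<rho>) self_vs)"
proof (rule cohomology_isomorphic_onto)
  let ?m = "n - 1"
  let ?t = "[:0, 1:] :: 'a poly"
  let ?A = "tv n ?t (unitv 0) (unitv ?m)"
  let ?tau = "\<lambda>c. corner (c [?A])"
  have t: "poly ?t 0 = 0" by simp
  note A = tv_corner[OF t]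
  show "linear_map class_ring pol.cocycle_vs self_vs ?tau"
  proof (rule linear_mapI[OF pol.cocycle_vs self_vs_is_vs])
    fix c d assume "c \<in> carrier pol.cocycle_vs" "d \<in> carrier pol.cocycle_vs"
    then have cd: "c [?A] \<in> carrier V" "d [?A] \<in> carrier V" using A(1) by (auto intro: pol.cocycle_closed)
    show "?tau (c \<oplus>\<^bsub>pol.cocycle_vs\<^esub> d) = ?tau c \<oplus>\<^bsub>self_vs\<^esub> ?tau d"
      unfolding pol.cocycle_vs_ops[OF A(1)] dual_add[OF corner_dual cd] by (simp add: self_vs_def)
  next
    fix a c assume "c \<in> carrier pol.cocycle_vs"
    then have c: "c [?A] \<in> carrier V" using A(1) by (auto intro: pol.cocycle_closed)
    show "?tau (a \<odot>\<^bsub>pol.cocycle_vs\<^esub> c) = a \<odot>\<^bsub>self_vs\<^esub> ?tau c"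
      unfolding pol.cocycle_vs_ops[OF A(1)] dual_smult[OF corner_dual c] by (simp add: self_vs_def)
  qed (simp add: self_vs_def)
  show "?tau b = \<zero>\<^bsub>self_vs\<^esub>" if "b \<in> coboundaries (SL n) V (\<rho> \<circ> eval_at_0) 1" for b
    using coboundary_kernel[OF that A] dual_zero[OF corner_dual] by (simp add: self_vs_def)
  show "?tau (inflate f) = \<zero>\<^bsub>self_vs\<^esub>" if "f \<in> cocycles (SL n) V \<rho> 1" for f
    using inflate_kernel[OF that A] dual_zero[OF corner_dual] by (simp add: self_vs_def)
  show "c [B] = \<zero>\<^bsub>V\<^esub>"
    if c: "c \<in> cocycles (SL n) V (\<rho> \<circ> eval_at_0) 1" and zero: "?tau c = \<zero>\<^bsub>self_vs\<^esub>"
      and const: "\<And>g. g \<in> carrier (SL n) \<Longrightarrow> c [const_mat g] = \<zero>\<^bsub>V\<^esub>" and B: "B \<in> carrier (SL n)" for c B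
  proof -
    interpret C: SL_poly_cocycle n V \<rho> c by unfold_locales (rule c)
    have m: "0 < n" "?m < n" "0 \<noteq> ?m" "?m \<noteq> 1" using n3 by auto
    have o: "orth n (unitv 0 :: nat \<Rightarrow> 'a) (unitv ?m)" by (rule orth_unitv[OF m(1,3)])
    have "C.val x (unitv 0) (unitv ?m) = \<zero>\<^bsub>V\<^esub>" if x: "poly x 0 = 0" for x
    proof -
      \<comment> \<open>\<open>x = a t + t (t z)\<close>, and the second summand is a product of two
        elements of \<open>tF[t]\<close>, as \<open>val_mult_zero\<close> requires.\<close>
      obtain a z where xz: "x = pCons 0 (pCons a z)" using x by (cases x, rename_tac b y, case_tac y) auto
      have "x = Polynomial.smult a ?t + ?t * (?t * z)" unfolding xz by simp
      moreover have "corner (C.val (Polynomial.smult a ?t + ?t * (?t * z)) (unitv 0) (unitv ?m)) = 0"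
        using C.val_add_param[of "Polynomial.smult a ?t" "?t * (?t * z)", OF _ _ o]
          C.val_mult_zero[OF m(2) m(3)[symmetric] m(4) t, of "?t * z"]
          C.dual_val_smult[OF corner_dual t m(1-3), of a] zero C.val_closed[OF _ o, of "Polynomial.smult a ?t"]
        by (simp add: self_vs_def C.val_def)
      ultimately show ?thesis using val_corner_zero[OF c x] by (simp add: C.val_def)
    qed
    then show ?thesis by (intro C.cocycle_eq_zero[OF const m(1-3) _ B])
  qed
  show "\<exists>c\<in>cocycles (SL n) V (\<rho> \<circ> eval_at_0) 1. ?tau c = w \<and> (\<forall>g\<in>carrier (SL n). c [const_mat g] = \<zero>\<^bsub>V\<^esub>)" for w
  proof -
    interpret P: vectorspace class_ring pol.cocycle_vs by (rule pol.cocycle_vs)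
    obtain c where c: "c \<in> cocycles (SL n) V (\<rho> \<circ> eval_at_0) 1"
      and Fc: "\<And>A. A \<in> carrier (SL n) \<Longrightarrow> F (c [A]) = log_deriv_at_0 n A"
      using transport_cocycle[OF log_deriv_at_0_sl log_deriv_at_0_mult] by blast
    have "log_deriv_at_0 n ?A $$ (0, ?m) = 1"
      unfolding log_deriv_at_0_def A(2) inv_SL_one using n by (simp add: tv_def unitv_def)
    then have tau: "?tau c = 1" unfolding corner_def Fc[OF A(1)] .
    have zero: "c [const_mat g] = \<zero>\<^bsub>V\<^esub>" if g: "g \<in> carrier (SL n)" for g
      using pol.cocycle_closed[OF c const_mat_SL[OF g]] Fc[OF const_mat_SL[OF g]] log_deriv_at_0_const[OF g]
      by (intro F_inj) (auto simp: F_zero)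
    have cc: "w \<odot>\<^bsub>pol.cocycle_vs\<^esub> c \<in> carrier pol.cocycle_vs" using c by (intro P.smult_closed) simp_all
    show ?thesis
    proof (intro bexI[of _ "w \<odot>\<^bsub>pol.cocycle_vs\<^esub> c"] conjI ballI)
      show "w \<odot>\<^bsub>pol.cocycle_vs\<^esub> c \<in> cocycles (SL n) V (\<rho> \<circ> eval_at_0) 1" using cc by simp
      show "?tau (w \<odot>\<^bsub>pol.cocycle_vs\<^esub> c) = w"
        unfolding pol.cocycle_vs_ops[OF A(1)] dual_smult[OF corner_dual pol.cocycle_closed[OF c A(1)]] tau by simp
      show "(w \<odot>\<^bsub>pol.cocycle_vs\<^esub> c) [const_mat g] = \<zero>\<^bsub>V\<^esub>" if "g \<in> carrier (SL n)" for g
        unfolding pol.cocycle_vs_ops[OF const_mat_SL[OF that]] zero[OF that] by simp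
    qed
  qed
qed

text \<open>Here the corner entry is recorded for all parameters \<open>x\<close> at once. Its
  linearity in \<open>x\<close> is \<open>dual_val_smult\<close>, and \<open>sl2_cocycle\<close>
  realises every functional.\<close>

lemma cohomology_rank_2:
  assumes n2: "n = 2"
  shows "vs_isomorphic class_ring (group_cohomology 1 (SL n) V (\<rho> \<circ> eval_at_0))
    (direct_sum (group_cohomology 1 (SL n) V \<rho>) F_infinity)"
proof (rule cohomology_isomorphic_onto)
  let ?A = "\<lambda>x. tv n x (unitv 0) (unitv (n - 1)) :: 'a poly mat"
  let ?tau = "\<lambda>c. restrict (\<lambda>x. corner (c [?A x])) (carrier tFt)"
  note A = tv_corner
  note [simp del] = One_nat_def
  have m: "0 < n" "n - 1 < n" "0 \<noteq> n - 1" using n by auto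
  have o: "orth n (unitv 0 :: nat \<Rightarrow> 'a) (unitv (n - 1))" by (rule orth_unitv[OF m(1,3)])
  have Finf: "carrier (F_infinity :: ('a, 'a poly \<Rightarrow> 'a) module) = dual tFt \<inter> extensional (carrier tFt)"
    "f \<oplus>\<^bsub>F_infinity\<^esub> f' = restrict (\<lambda>x. f x + f' x) (carrier tFt)"
    "a \<odot>\<^bsub>F_infinity\<^esub> f = restrict (\<lambda>x. a * f x) (carrier tFt)"
    "\<zero>\<^bsub>F_infinity\<^esub> = restrict (\<lambda>x. 0) (carrier tFt)" for f f' :: "'a poly \<Rightarrow> 'a" and a
    by (simp_all add: F_infinity_def hom_vs_def fun_vs_def self_vs_def)
  have tFt: "x \<oplus>\<^bsub>tFt\<^esub> y = x + y" "a \<odot>\<^bsub>tFt\<^esub> x = Polynomial.smult a x" for x y :: "'a poly" and a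
    by (simp_all add: tFt_def)
  show "linear_map class_ring pol.cocycle_vs F_infinity ?tau"
  proof (rule linear_mapI[OF pol.cocycle_vs F_infinity_is_vs])
    fix c assume "c \<in> carrier pol.cocycle_vs"
    then have c: "c \<in> cocycles (SL n) V (\<rho> \<circ> eval_at_0) 1" by simp
    interpret C: SL_poly_cocycle n V \<rho> c by unfold_locales (rule c)
    have "?tau c \<in> dual tFt"
      unfolding dual_iff
    proof (intro conjI ballI allI)
      fix x y :: "'a poly" assume "x \<in> carrier tFt" "y \<in> carrier tFt"
      then have xy: "poly x 0 = 0" "poly y 0 = 0" by (auto simp: tFt_carrier)
      show "?tau c (x \<oplus>\<^bsub>tFt\<^esub> y) = ?tau c x + ?tau c y"
        using C.val_add_param[OF xy o] C.val_closed[OF xy(1) o] C.val_closed[OF xy(2) o] xy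
        by (simp add: tFt tFt_carrier C.val_def dual_add[OF corner_dual])
    next
      fix a and x :: "'a poly" assume "x \<in> carrier tFt"
      then have x: "poly x 0 = 0" by (auto simp: tFt_carrier)
      show "?tau c (a \<odot>\<^bsub>tFt\<^esub> x) = a * ?tau c x"
        using C.dual_val_smult[OF corner_dual x m, of a] x by (simp add: tFt tFt_carrier C.val_def)
    qed
    then show "?tau c \<in> carrier F_infinity" unfolding Finf(1) by simp
    fix a
    show "?tau (a \<odot>\<^bsub>pol.cocycle_vs\<^esub> c) = a \<odot>\<^bsub>F_infinity\<^esub> ?tau c"
      unfolding Finf
    proof (rule restrict_ext)
      fix x :: "'a poly" assume x: "x \<in> carrier tFt"
      then have x0: "poly x 0 = 0" by (simp add: tFt_carrier)
      show "corner ((a \<odot>\<^bsub>pol.cocycle_vs\<^esub> c) [?A x]) = a * ?tau c x"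
        unfolding pol.cocycle_vs_ops[OF A(1)[OF x0]] dual_smult[OF corner_dual pol.cocycle_closed[OF c A(1)[OF x0]]]
        using x by simp
    qed
    fix d assume "d \<in> carrier pol.cocycle_vs"
    then have d: "d \<in> cocycles (SL n) V (\<rho> \<circ> eval_at_0) 1" by simp
    show "?tau (c \<oplus>\<^bsub>pol.cocycle_vs\<^esub> d) = ?tau c \<oplus>\<^bsub>F_infinity\<^esub> ?tau d"
      unfolding Finf
    proof (rule restrict_ext)
      fix x :: "'a poly" assume x: "x \<in> carrier tFt"
      then have x0: "poly x 0 = 0" by (simp add: tFt_carrier)
      show "corner ((c \<oplus>\<^bsub>pol.cocycle_vs\<^esub> d) [?A x]) = ?tau c x + ?tau d x"
        unfolding pol.cocycle_vs_ops[OF A(1)[OF x0]]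
          dual_add[OF corner_dual pol.cocycle_closed[OF c A(1)[OF x0]] pol.cocycle_closed[OF d A(1)[OF x0]]]
        using x by simp
    qed
  qed
  show "?tau b = \<zero>\<^bsub>F_infinity\<^esub>" if "b \<in> coboundaries (SL n) V (\<rho> \<circ> eval_at_0) 1" for b
    unfolding Finf by (rule restrict_ext) (simp add: coboundary_kernel[OF that A] tFt_carrier dual_zero[OF corner_dual])
  show "?tau (inflate f) = \<zero>\<^bsub>F_infinity\<^esub>" if "f \<in> cocycles (SL n) V \<rho> 1" for f
    unfolding Finf by (rule restrict_ext) (simp add: inflate_kernel[OF that A] tFt_carrier dual_zero[OF corner_dual])
  show "c [B] = \<zero>\<^bsub>V\<^esub>"
    if c: "c \<in> cocycles (SL n) V (\<rho> \<circ> eval_at_0) 1" and zero: "?tau c = \<zero>\<^bsub>F_infinity\<^esub>"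
      and const: "\<And>g. g \<in> carrier (SL n) \<Longrightarrow> c [const_mat g] = \<zero>\<^bsub>V\<^esub>" and B: "B \<in> carrier (SL n)" for c B
  proof -
    interpret C: SL_poly_cocycle n V \<rho> c by unfold_locales (rule c)
    have "C.val x (unitv 0) (unitv (n - 1)) = \<zero>\<^bsub>V\<^esub>" if x: "poly x 0 = 0" for x
      using fun_cong[OF zero, of x] val_corner_zero[OF c x] x by (simp add: Finf tFt_carrier C.val_def)
    then show ?thesis by (intro C.cocycle_eq_zero[OF const m _ B])
  qed
  show "\<exists>c\<in>cocycles (SL n) V (\<rho> \<circ> eval_at_0) 1. ?tau c = w \<and> (\<forall>g\<in>carrier (SL n). c [const_mat g] = \<zero>\<^bsub>V\<^esub>)"
    if w: "w \<in> carrier F_infinity" for w :: "'a poly \<Rightarrow> 'a"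
  proof -
    have wl: "w \<in> dual tFt" "w \<in> extensional (carrier tFt)" using w by (auto simp: Finf)
    have red: "f - [:poly f 0:] \<in> carrier tFt" for f :: "'a poly" by (simp add: tFt_carrier)
    \<comment> \<open>\<open>w\<close> is extended to all polynomials by removing the constant term
      first, so it is never evaluated outside \<open>tF[t]\<close>.\<close>
    interpret E: vanishing_functional "\<lambda>f. w (f - [:poly f 0:])"
    proof
      show "w (f + g - [:poly (f + g) 0:]) = w (f - [:poly f 0:]) + w (g - [:poly g 0:])" for f g
      proof -
        have "f + g - [:poly (f + g) 0:] = (f - [:poly f 0:]) \<oplus>\<^bsub>tFt\<^esub> (g - [:poly g 0:])"
          by (simp add: tFt poly_eq_iff coeff_pCons split: nat.split)
        then show ?thesis using dual_add[OF wl(1) red red] by simp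
      qed
      show smul: "w (Polynomial.smult a f - [:poly (Polynomial.smult a f) 0:]) = a * w (f - [:poly f 0:])" for a f
      proof -
        have "Polynomial.smult a f - [:poly (Polynomial.smult a f) 0:] = a \<odot>\<^bsub>tFt\<^esub> (f - [:poly f 0:])"
          by (simp add: tFt smult_diff_right)
        then show ?thesis using dual_smult[OF wl(1) red] by simp
      qed
      show "w ([:a:] - [:poly [:a:] 0:]) = 0" for a using smul[of 0 0] by simp
    qed
    obtain c where c: "c \<in> cocycles (SL n) V (\<rho> \<circ> eval_at_0) 1"
      and Fc: "\<And>A. A \<in> carrier (SL n) \<Longrightarrow> F (c [A]) = E.sl2_cocycle A"
    proof (rule transport_cocycle[of E.sl2_cocycle])
      show "E.sl2_cocycle B \<in> carrier (sl_vs n)" for B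
        using E.mat_trace_sl2_cocycle[of B] by (simp add: sl_vs_carrier n2 E.sl2_cocycle_def)
      show "E.sl2_cocycle (B * B') = E.sl2_cocycle B + Ad n (eval_at_0 B) (E.sl2_cocycle B')"
        if "B \<in> carrier (SL n)" "B' \<in> carrier (SL n)" for B B'
        using E.sl2_cocycle_mult that by (simp add: n2)
    qed (rule that)
    have zero: "c [const_mat g] = \<zero>\<^bsub>V\<^esub>" if g: "g \<in> carrier (SL n)" for g
    proof (rule F_inj[OF pol.cocycle_closed[OF c const_mat_SL[OF g]]])
      have "E.sl2_cocycle (const_mat g) = 0\<^sub>m 2 2"
        by (rule E.sl2_cocycle_const) (use const_mat_SL[OF g] g n2 in \<open>auto simp: const_mat_def SL_def\<close>)
      then show "F (c [const_mat g]) = F \<zero>\<^bsub>V\<^esub>" unfolding Fc[OF const_mat_SL[OF g]] F_zero by (simp add: n2)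
    qed simp
    have "?tau c = w"
    proof (rule extensionalityI[OF _ wl(2)])
      fix x :: "'a poly" assume x: "x \<in> carrier tFt"
      then have x0: "poly x 0 = 0" by (simp add: tFt_carrier)
      have n1: "n - 1 = 1" using n2 by simp
      have "?A x = addrow_mat 2 x 0 1" unfolding n1 using tv_units[of 0 2 1 x] by (simp add: n2)
      moreover have "E.sl2_cocycle (addrow_mat 2 x 0 1) $$ (0, 1) = w x"
        by (subst E.sl2_cocycle_elementary) (simp_all add: x0)
      ultimately show "?tau c x = w x" using x Fc[OF A(1)[OF x0]] by (simp add: corner_def n1)
    qed simp
    then show ?thesis by (intro bexI[of _ c] conjI ballI zero c)
  qed
qed

end

section \<open>The remaining representations and the theorem\<close>

lemma (in rational_SL_rep) cohomology_not_adjoint: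
  assumes irr: "rep_irreducible (SL n) class_ring V \<rho>"
    and not_Ad: "\<not> rep_isomorphic (SL n) class_ring V \<rho> (sl_vs n) (Ad n)"
  shows "vs_isomorphic class_ring (group_cohomology 1 (SL n) V (\<rho> \<circ> eval_at_0)) (group_cohomology 1 (SL n) V \<rho>)"
proof -
  \<comment> \<open>The zero space serves as second summand, so that the common frame applies;
    \<open>direct_sum_trivial\<close> removes it at the end.\<close>
  let ?W = "(self_vs :: ('a, 'a) module)\<lparr>carrier := {0}\<rparr>"
  interpret S: vectorspace class_ring "self_vs :: ('a, 'a) module" by (rule self_vs_is_vs)
  have "LinearCombinations.submodule class_ring {0} (self_vs :: ('a, 'a) module)"
    by unfold_locales (auto simp: self_vs_def)
  then have W: "vectorspace class_ring ?W" by (intro vectorspaceI class_field S.submodule_is_module)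
  have "vs_isomorphic class_ring (group_cohomology 1 (SL n) V (\<rho> \<circ> eval_at_0))
      (direct_sum (group_cohomology 1 (SL n) V \<rho>) ?W)"
  proof (rule cohomology_isomorphic_onto[where \<tau> = "\<lambda>_. 0"])
    show "linear_map class_ring pol.cocycle_vs ?W (\<lambda>_. 0)"
      by (rule linear_mapI[OF pol.cocycle_vs W]) (simp_all add: self_vs_def)
    show "c [A] = \<zero>\<^bsub>V\<^esub>"
      if c: "c \<in> cocycles (SL n) V (\<rho> \<circ> eval_at_0) 1"
        and const: "\<And>g. g \<in> carrier (SL n) \<Longrightarrow> c [const_mat g] = \<zero>\<^bsub>V\<^esub>" and A: "A \<in> carrier (SL n)" for c A
    proof -
      interpret C: SL_poly_cocycle n V \<rho> c by unfold_locales (rule c)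
      have ij: "0 < n" "1 < n" "(0::nat) \<noteq> 1" using n by auto
      show ?thesis
        using C.cocycle_eq_zero[OF const ij _ A] C.rep_isomorphic_Ad[OF irr _ ij] not_Ad by blast
    qed
    show "\<exists>c\<in>cocycles (SL n) V (\<rho> \<circ> eval_at_0) 1. 0 = w \<and> (\<forall>g\<in>carrier (SL n). c [const_mat g] = \<zero>\<^bsub>V\<^esub>)"
      if "w \<in> carrier ?W" for w
    proof -
      interpret P: vectorspace class_ring pol.cocycle_vs by (rule pol.cocycle_vs)
      have "\<zero>\<^bsub>pol.cocycle_vs\<^esub> [A] = \<zero>\<^bsub>V\<^esub>" if "A \<in> carrier (SL n)" for A
        using that by (simp add: fun_vs_def tuples_def)
      then show ?thesis using that P.zero_closed const_mat_SL by (intro bexI[of _ "\<zero>\<^bsub>pol.cocycle_vs\<^esub>"]) auto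
    qed
  qed (simp_all add: self_vs_def)
  then show ?thesis
    using direct_sum_trivial[OF rep.group_cohomology_1_is_vs W] vs_isomorphic_trans by (simp add: self_vs_def) blast
qed

theorem mainTheorem1:
  fixes n :: nat
    and V :: "('a::field_char_0, 'v) module"
    and \<rho> :: "'a mat \<Rightarrow> 'v \<Rightarrow> 'v"
  assumes "n \<ge> 2"
    and "irreducible_rational_rep n V \<rho>"
  shows "let H1_poly = group_cohomology 1 (SL n) V (\<rho> \<circ> eval_at_0);
             H1 = group_cohomology 1 (SL n) V \<rho>;
             V_is_Ad = rep_isomorphic (SL n) class_ring V \<rho> (sl_vs n) (Ad n)
         in (\<not> V_is_Ad \<longrightarrow> vs_isomorphic class_ring H1_poly H1)
          \<and> (V_is_Ad \<and> n = 2 \<longrightarrow> vs_isomorphic class_ring H1_poly (direct_sum H1 F_infinity))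
          \<and> (V_is_Ad \<and> n \<ge> 3 \<longrightarrow> vs_isomorphic class_ring H1_poly (direct_sum H1 self_vs))"
proof -
  interpret rational_SL_rep n V \<rho>
    using assms by unfold_locales (auto simp: irreducible_rational_rep_def)
  have irr: "rep_irreducible (SL n) class_ring V \<rho>"
    using assms(2) by (simp add: irreducible_rational_rep_def)
  have Ad: "\<exists>F. adjoint_SL_rep n V \<rho> F" if "rep_isomorphic (SL n) class_ring V \<rho> (sl_vs n) (Ad n)"
    using that rational_SL_rep_axioms
    by (auto simp: rep_isomorphic_def adjoint_SL_rep_def adjoint_SL_rep_axioms_def)
  show ?thesis
    unfolding Let_def
    using cohomology_not_adjoint[OF irr] Ad adjoint_SL_rep.cohomology_rank_2 adjoint_SL_rep.cohomology_rank_ge_3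
    by blast
qed

end
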